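(* Let $G$ be a finite disconnected simple graph with no isolated vertices such that $M=M(G)$ (its matching complex) is a 2-dimensional homology manifold with boundary. Then $M$ is a ball, and $|M|\cong B^0\ast B^1$, $|M|\cong B^0\ast S^1$, or $|M|\cong S^0\ast B^1$. Furthermore, up to isomorphism, the pair $(G,M(G))$ is one of the following pairs: - $(3P_2,\ P_1\ast P_2)$ (a triangle); - $(2P_2\sqcup P_3,\ P_1\ast P_3)$ (two triangles sharing an edge); - $(P_2\sqcup P_5,\ P_1\ast P_4)$ (chain of three triangles sharing a vertex); - $(P_2\sqcup\Gamma,\ P_1\ast P_5)$ (chain of four triangles sharing a vertex); - $(P_2\sqcup 2P_3,\ P_1\ast C_4)$ (triangulated square); - $(P_2\sqcup C_5,\ P_1\ast C_5)$ (triangulated pentagon); - $(P_2\sqcup K_{3,2},\ P_1\ast C_6)$ (triangulated hexagon); - $(P_3\sqcup P_5,\ 2P_1\ast P_4)$ (six triangles: suspension over a path of three edges); - $(P_3\sqcup\Gamma,\ 2P_1\ast P_5)$ (eight triangles: suspension over a path of four edges).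
   Context: A matching of a graph $G$ is a set of edges of $G$ no two of which share a vertex. The matching complex $M(G)$ is the simplicial complex whose vertices are the edges of $G$ and whose faces are the matchings of $G$ (including the empty matching). $P_n$ is the path with $n$ vertices ($P_1$ a single vertex), $C_n$ the cycle with $n$ vertices, $K_{m,n}$ the complete bipartite graph; $\sqcup$ is disjoint union and $nH$ denotes $n$ disjoint copies of $H$. The banner graph $\Gamma$ is a 4-cycle together with one pendant edge attached to one of its vertices (5 vertices, 5 edges). In the second entry of each pair, paths, cycles and $2P_1$ (two isolated points) are regarded as simplicial complexes of dimension at most 1. The join of disjoint simplicial complexes is $\Delta\ast\Sigma=\{\tau\cup\sigma:\tau\in\Delta,\sigma\in\Sigma\}$; $|M|$ is the geometric realization; $B^k$, $S^k$ are the topological $k$-ball and $k$-sphere and $\ast$ between them is the topological join. For a face $\sigma$ of a simplicial complex $\Delta$, $\mathrm{link}_\Delta\sigma=\{\tau\in\Delta:\tau\cup\sigma\in\Delta,\ \tau\cap\sigma=\varnothing\}$. Fix a field $\Bbbk$; homology is taken over $\Bbbk$. A homology manifold (without boundary) is a (finite) $d$-dimensional simplicial complex $\Delta$ such that $\mathrm{link}_\Delta\sigma$ has the homology of a $(d-|\sigma|)$-sphere for all nonempty faces $\sigma$ (the $(-1)$-sphere is $\{\varnothing\}$). A homology manifold with boundary is a $d$-dimensional simplicial complex $\Delta$ such that $\mathrm{link}_\Delta\sigma$ has the homology of a $(d-|\sigma|)$-sphere or a $(d-|\sigma|)$-ball for all nonempty faces $\sigma\in\Delta$, and the set $\partial\Delta=\{\sigma\in\Delta:\mathrm{link}_\Delta\sigma\text{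 has the homology of a }(d-|\sigma|)\text{-ball}\}\cup\{\varnothing\}$ is a $(d-1)$-dimensional homology manifold (without boundary). A homology ball is a $d$-dimensional homology manifold with boundary that itself has the homology of a $d$-ball; "ball" means homology ball. *)

theory Defs
  imports "HOL-Analysis.Analysis" "HOL-Library.Function_Algebras"
begin

section \<open>Finite simple graphs\<close>

record 'v graph =
  verts :: "'v set"
  edges :: "'v set set"

definition finite_simple_graph :: "'v graph \<Rightarrow> bool" where
  "finite_simple_graph G \<longleftrightarrow>
     finite (verts G) \<and> (\<forall>e \<in> edges G. e \<subseteq> verts G \<and> card e = 2)"

definition connected_graph :: "'v graph \<Rightarrow> bool" where
  "connected_graph G \<longleftrightarrow> verts G \<noteq> {} \<and>
     (\<forall>u \<in> verts G. \<forall>v \<in> verts G. (u, v) \<in> {(x, y). {x, y} \<in> edges G}\<^sup>*)"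

definition no_isolated_vertices :: "'v graph \<Rightarrow> bool" where
  "no_isolated_vertices G \<longleftrightarrow> (\<forall>v \<in> verts G. \<exists>e \<in> edges G. v \<in> e)"

definition graph_iso :: "'v graph \<Rightarrow> 'w graph \<Rightarrow> bool" (infix \<open>\<cong>\<^sub>G\<close> 50) where
  "G \<cong>\<^sub>G H \<longleftrightarrow> (\<exists>f. bij_betw f (verts G) (verts H) \<and> (image f) ` edges G = edges H)"

definition path_graph :: "nat \<Rightarrow> nat graph" where
  "path_graph n = \<lparr>verts = {..<n}, edges = {{i, i + 1} | i. i + 1 < n}\<rparr>"

text \<open>Meaningful for \<open>n \<ge> 3\<close> only.\<close>

definition cycle_graph :: "nat \<Rightarrow> nat graph" where
  "cycle_graph n = \<lparr>verts = {..<n}, edges = {{i, (i + 1) mod n} | i. i < n}\<rparr>"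

definition complete_bipartite :: "nat \<Rightarrow> nat \<Rightarrow> (nat + nat) graph" where
  "complete_bipartite m n =
     \<lparr>verts = {..<m} <+> {..<n}, edges = {{Inl i, Inr j} | i j. i < m \<and> j < n}\<rparr>"

definition banner_graph :: "nat graph" where
  "banner_graph = \<lparr>verts = {0, 1, 2, 3, 4}, edges = {{0, 1}, {1, 2}, {2, 3}, {3, 0}, {0, 4}}\<rparr>"

definition disjoint_graph_union :: "'v graph \<Rightarrow> 'w graph \<Rightarrow> ('v + 'w) graph"
    (infixr \<open>\<squnion>\<^sub>G\<close> 65) where
  "G \<squnion>\<^sub>G H = \<lparr>verts = verts G <+> verts H,
               edges = (image Inl) ` edges G \<union> (image Inr) ` edges H\<rparr>"

definition graph_copies :: "nat \<Rightarrow> 'v graph \<Rightarrow> (nat \<times> 'v) graph" where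
  "graph_copies n G = \<lparr>verts = {..<n} \<times> verts G,
                       edges = {Pair i ` e | i e. i < n \<and> e \<in> edges G}\<rparr>"


section \<open>Abstract simplicial complexes\<close>

text \<open>
  A complex is the set of its faces, the empty face included; every element of \<open>\<Union>\<Delta>\<close> is a vertex.
\<close>

definition finite_complex :: "'a set set \<Rightarrow> bool" where
  "finite_complex \<Delta> \<longleftrightarrow> finite \<Delta> \<and> {} \<in> \<Delta> \<and>
     (\<forall>\<sigma> \<in> \<Delta>. finite \<sigma> \<and> (\<forall>\<tau>. \<tau> \<subseteq> \<sigma> \<longrightarrow> \<tau> \<in> \<Delta>))"

text \<open>Dimensions are integers, so that \<open>{{}}\<close> has dimension \<open>- 1\<close>.\<close>

definition complex_dim :: "'a set set \<Rightarrow> int" where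
  "complex_dim \<Delta> = Max ((\<lambda>\<sigma>. int (card \<sigma>) - 1) ` \<Delta>)"

definition complex_iso :: "'a set set \<Rightarrow> 'b set set \<Rightarrow> bool" (infix \<open>\<cong>\<^sub>C\<close> 50) where
  "\<Delta> \<cong>\<^sub>C \<Sigma> \<longleftrightarrow> (\<exists>f. bij_betw f (\<Union>\<Delta>) (\<Union>\<Sigma>) \<and> (image f) ` \<Delta> = \<Sigma>)"

definition complex_link :: "'a set set \<Rightarrow> 'a set \<Rightarrow> 'a set set" where
  "complex_link \<Delta> \<sigma> = {\<tau> \<in> \<Delta>. \<tau> \<union> \<sigma> \<in> \<Delta> \<and> \<tau> \<inter> \<sigma> = {}}"

text \<open>The vertex sets are made disjoint by passing to the sum type.\<close>

definition complex_join :: "'a set set \<Rightarrow> 'b set set \<Rightarrow> ('a + 'b) set set"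
    (infixr \<open>\<star>\<^sub>C\<close> 65) where
  "\<Delta> \<star>\<^sub>C \<Sigma> = {\<tau> <+> \<sigma> | \<tau> \<sigma>. \<tau> \<in> \<Delta> \<and> \<sigma> \<in> \<Sigma>}"

definition graph_complex :: "'v graph \<Rightarrow> 'v set set" where
  "graph_complex G = {{}} \<union> {{v} | v. v \<in> verts G} \<union> edges G"

definition matching_complex :: "'v graph \<Rightarrow> 'v set set set" where
  "matching_complex G =
     {m. m \<subseteq> edges G \<and> (\<forall>e \<in> m. \<forall>f \<in> m. e \<noteq> f \<longrightarrow> e \<inter> f = {})}"


section \<open>Reduced simplicial homology over a field\<close>

text \<open>
  An oriented \<open>q\<close>-chain is an alternating function on the orderings of the \<open>q\<close>-faces: the oriented
  simplex \<open>[x\<^sub>0, \<dots>, x\<^sub>q]\<close> is the function that takes the sign of \<open>\<pi>\<close> at the list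
  \<open>x\<^bsub>\<pi> 0\<^esub>, \<dots>, x\<^bsub>\<pi> q\<^esub>\<close> and vanishes elsewhere. The \<open>- 1\<close>-chains live on the empty face, so
  the complex is augmented. Alternation is stated for adjacent transpositions.
\<close>

definition chains :: "'a set set \<Rightarrow> int \<Rightarrow> ('a list \<Rightarrow> 'k::field) set" where
  "chains \<Delta> q = {c.
     (\<forall>xs. c xs \<noteq> 0 \<longrightarrow> distinct xs \<and> set xs \<in> \<Delta> \<and> int (length xs) = q + 1) \<and>
     (\<forall>xs x y ys. c (xs @ x # y # ys) = - c (xs @ y # x # ys))}"

text \<open>
  The coefficient at \<open>[y\<^sub>0, \<dots>]\<close> of the boundary of an oriented simplex is its value at
  \<open>[v, y\<^sub>0, \<dots>]\<close>, \<open>v\<close> being the omitted vertex; for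
  \<open>v = x\<^sub>i\<close> this is the usual sign \<open>(- 1) ^ i\<close>.
\<close>

definition chain_boundary :: "'a set set \<Rightarrow> ('a list \<Rightarrow> 'k::field) \<Rightarrow> 'a list \<Rightarrow> 'k" where
  "chain_boundary \<Delta> c = (\<lambda>ys. \<Sum>v \<in> \<Union>\<Delta>. c (v # ys))"

definition cycles :: "'a set set \<Rightarrow> int \<Rightarrow> ('a list \<Rightarrow> 'k::field) set" where
  "cycles \<Delta> q = {c \<in> chains \<Delta> q. chain_boundary \<Delta> c = (\<lambda>_. 0)}"

definition boundaries :: "'a set set \<Rightarrow> int \<Rightarrow> ('a list \<Rightarrow> 'k::field) set" where
  "boundaries \<Delta> q = chain_boundary \<Delta> ` chains \<Delta> (q + 1)"

definition chain_scale :: "'k::field \<Rightarrow> ('a list \<Rightarrow> 'k) \<Rightarrow> 'a list \<Rightarrow> 'k" where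
  "chain_scale a c = (\<lambda>xs. a * c xs)"

lemma vector_space_chain_scale: "vector_space chain_scale"
  by unfold_locales (auto simp: chain_scale_def algebra_simps)

lemma chain_boundary_chain_boundary:
  assumes c: "c \<in> chains \<Delta> q" and \<Delta>: "finite_complex \<Delta>"
  shows "chain_boundary \<Delta> (chain_boundary \<Delta> c) = (\<lambda>_. 0)"
proof
  fix ys
  let ?V = "\<Union>\<Delta>"
  have fin: "finite ?V"
    using \<Delta> by (auto simp: finite_complex_def)
  have swap: "c (x # y # ys) = - c (y # x # ys)" for x y
  proof -
    have "c ([] @ x # y # ys) = - c ([] @ y # x # ys)"
      using c unfolding chains_def by blast
    then show ?thesis by simp
  qed
  have diag: "c (x # x # ys) = 0" for x
  proof (rule ccontr)
    assume "c (x # x # ys) \<noteq> 0"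
    then have "distinct (x # x # ys)"
      using c unfolding chains_def by blast
    then show False by simp
  qed
  have "(\<Sum>u\<in>W. \<Sum>v\<in>W. c (v # u # ys)) = 0" if "finite W" for W
    using that
  proof (induction W rule: finite_induct)
    case (insert w W)
    have "(\<Sum>u\<in>W. c (w # u # ys)) = - (\<Sum>u\<in>W. c (u # w # ys))"
      by (subst swap) (simp add: sum_negf)
    with insert show ?case
      by (simp add: sum.distrib diag)
  qed simp
  from this[OF fin] show "chain_boundary \<Delta> (chain_boundary \<Delta> c) ys = 0"
    by (simp add: chain_boundary_def)
qed

text \<open>
  The dimension over \<open>'k\<close> of the reduced homology space, cycles modulo boundaries; both spaces
  have finite dimension when the complex is finite.
\<close>

definition reduced_betti :: "'k::field itself \<Rightarrow> 'a set set \<Rightarrow> int \<Rightarrow> nat" where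
  "reduced_betti _ \<Delta> q =
     vector_space.dim chain_scale (cycles \<Delta> q :: ('a list \<Rightarrow> 'k) set) -
     vector_space.dim chain_scale (boundaries \<Delta> q :: ('a list \<Rightarrow> 'k) set)"

definition has_homology_of_sphere :: "'k::field itself \<Rightarrow> int \<Rightarrow> 'a set set \<Rightarrow> bool" where
  "has_homology_of_sphere K m \<Delta> \<longleftrightarrow> (\<forall>q. reduced_betti K \<Delta> q = (if q = m then 1 else 0))"

text \<open>
  The reduced homology of a ball vanishes, whatever its dimension; there is no ball of negative
  dimension.
\<close>

definition has_homology_of_ball :: "'k::field itself \<Rightarrow> int \<Rightarrow> 'a set set \<Rightarrow> bool" where
  "has_homology_of_ball K m \<Delta> \<longleftrightarrow> 0 \<le> m \<and> (\<forall>q. reduced_betti K \<Delta> q = 0)"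


section \<open>Homology manifolds\<close>

definition homology_manifold :: "'k::field itself \<Rightarrow> int \<Rightarrow> 'a set set \<Rightarrow> bool" where
  "homology_manifold K d \<Delta> \<longleftrightarrow> finite_complex \<Delta> \<and> complex_dim \<Delta> = d \<and>
     (\<forall>\<sigma> \<in> \<Delta>. \<sigma> \<noteq> {} \<longrightarrow> has_homology_of_sphere K (d - int (card \<sigma>)) (complex_link \<Delta> \<sigma>))"

definition manifold_boundary :: "'k::field itself \<Rightarrow> int \<Rightarrow> 'a set set \<Rightarrow> 'a set set" where
  "manifold_boundary K d \<Delta> =
     {\<sigma> \<in> \<Delta>. has_homology_of_ball K (d - int (card \<sigma>)) (complex_link \<Delta> \<sigma>)} \<union> {{}}"

definition homology_manifold_with_boundary :: "'k::field itself \<Rightarrow> int \<Rightarrow> 'a set set \<Rightarrow> bool" where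
  "homology_manifold_with_boundary K d \<Delta> \<longleftrightarrow> finite_complex \<Delta> \<and> complex_dim \<Delta> = d \<and>
     (\<forall>\<sigma> \<in> \<Delta>. \<sigma> \<noteq> {} \<longrightarrow>
        has_homology_of_sphere K (d - int (card \<sigma>)) (complex_link \<Delta> \<sigma>) \<or>
        has_homology_of_ball K (d - int (card \<sigma>)) (complex_link \<Delta> \<sigma>)) \<and>
     homology_manifold K (d - 1) (manifold_boundary K d \<Delta>)"

definition homology_ball :: "'k::field itself \<Rightarrow> int \<Rightarrow> 'a set set \<Rightarrow> bool" where
  "homology_ball K d \<Delta> \<longleftrightarrow>
     homology_manifold_with_boundary K d \<Delta> \<and> has_homology_of_ball K d \<Delta>"


section \<open>Geometric realization, balls and topological joins\<close>

text \<open>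
  Barycentric coordinates, with the topology of pointwise convergence; for a finite complex this
  is the usual topology.
\<close>

definition geometric_realization :: "'a set set \<Rightarrow> ('a \<Rightarrow> real) topology" where
  "geometric_realization \<Delta> = subtopology (powertop_real UNIV)
     {\<alpha>. (\<forall>v. 0 \<le> \<alpha> v) \<and> {v. \<alpha> v \<noteq> 0} \<in> \<Delta> \<and> (\<Sum>v | \<alpha> v \<noteq> 0. \<alpha> v) = 1}"

definition nball :: "nat \<Rightarrow> (nat \<Rightarrow> real) topology" where
  "nball n = subtopology (Euclidean_space n) {x. (\<Sum>i<n. x i ^ 2) \<le> 1}"

definition quotient_topology :: "'a topology \<Rightarrow> ('a \<times> 'a) set \<Rightarrow> 'a set topology" where
  "quotient_topology X r =
     topology (\<lambda>U. U \<subseteq> topspace X // r \<and> openin X {x \<in> topspace X. r `` {x} \<in> U})"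

lemma openin_quotient_topology:
  "openin (quotient_topology X r) U \<longleftrightarrow>
     U \<subseteq> topspace X // r \<and> openin X {x \<in> topspace X. r `` {x} \<in> U}"
proof -
  let ?P = "\<lambda>U. U \<subseteq> topspace X // r \<and> openin X {x \<in> topspace X. r `` {x} \<in> U}"
  have int: "?P (S \<inter> T)" if "?P S" "?P T" for S T
  proof -
    have "{x \<in> topspace X. r `` {x} \<in> S \<inter> T} =
          {x \<in> topspace X. r `` {x} \<in> S} \<inter> {x \<in> topspace X. r `` {x} \<in> T}"
      by auto
    with that show ?thesis by auto
  qed
  have un: "?P (\<Union>\<K>)" if "\<forall>K\<in>\<K>. ?P K" for \<K>
  proof -
    have "{x \<in> topspace X. r `` {x} \<in> \<Union>\<K>} = (\<Union>K\<in>\<K>. {x \<in> topspace X. r `` {x} \<in> K})"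
      by auto
    with that show ?thesis by auto
  qed
  have "istopology ?P"
    unfolding istopology_def using int un by blast
  then show ?thesis
    by (simp add: quotient_topology_def)
qed

text \<open>
  The join \<open>X \<times> Y \<times> [0, 1]\<close> with \<open>Y\<close> collapsed at \<open>t = 0\<close> and \<open>X\<close> collapsed at \<open>t = 1\<close>; it is
  used for nonempty spaces only.
\<close>

definition join_relation ::
    "'a topology \<Rightarrow> 'b topology \<Rightarrow> (('a \<times> 'b \<times> real) \<times> ('a \<times> 'b \<times> real)) set" where
  "join_relation X Y = {((x, y, t), (x', y', t')).
     x \<in> topspace X \<and> x' \<in> topspace X \<and> y \<in> topspace Y \<and> y' \<in> topspace Y \<and>
     t \<in> {0..1} \<and> t = t' \<and>
     (x = x' \<and> y = y' \<or> t = 0 \<and> x = x' \<or> t = 1 \<and> y = y')}"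

definition topological_join ::
    "'a topology \<Rightarrow> 'b topology \<Rightarrow> ('a \<times> 'b \<times> real) set topology" (infixr \<open>\<star>\<^sub>T\<close> 65) where
  "X \<star>\<^sub>T Y = quotient_topology
     (prod_topology X (prod_topology Y (top_of_set {0..1}))) (join_relation X Y)"

end

theory Submission
  imports Defs
begin

text \<open>
  The edges of a disconnected graph without isolated vertices split into two nonempty vertex-disjoint
  parts, and its matching complex is the join of the matching complexes of the parts. The link of a
  matching is the matching complex of the edges disjoint from it, so the manifold condition
  becomes a condition on disjoint edges. The link of a maximal matching is \<open>{{}}\<close>, hence every maximal
  matching has three edges. The link of a matching with two edges is a set of points, hence at
  most two points. The link of an edge is connected. All this uses only lower bounds for Betti
  numbers in the degrees \<open>- 1\<close> and \<open>0\<close>, which hold over every field.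

  Since no matching has four edges, the edges of one of the parts meet pairwise, and this part
  has at most two edges. On the other part the relation of being disjoint is connected and every
  edge has one or two partners, so by \<open>path_or_cycle\<close> it is a path or a cycle. The graph is recovered
  by adding the edges one at a time in the order of that path: four of them form \<open>P\<^sub>5\<close>
  (\<open>four_path_root\<close>), a fifth one closes it to the banner graph or to \<open>C\<^sub>5\<close>, a sixth one is possible only if
  the path closes to a cycle and then gives \<open>K\<^bsub>3,2\<^esub>\<close>, and a seventh one is impossible
  (\<open>no_induced_six_path\<close>). The shorter paths and the cycle of length four are unions of copies
  of \<open>P\<^sub>2\<close> and \<open>P\<^sub>3\<close>. Finally, the boundary has an edge, whose link is a single point; this excludes
  the suspension of a cycle (\<open>not_cycle\<close>).

  The complex is therefore a cone over a path or a cycle, or a suspension of a path. It is acyclic because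
  coning is a chain homotopy (\<open>boundary_cone_chain\<close>) and because a complex is acyclic as soon as the
  link and the deletion of some vertex are (\<open>acyclic_deletion_link\<close>). Its realization is a topological join,
  since the realization of a simplicial join is a quotient of a product with the interval, by
  exactly the relation that defines the topological join (\<open>geometric_realization_join\<close>); the factors are
  identified by comparing polygons and the standard balls and spheres as quotients of the same interval.
\<close>

section \<open>Chains, cones and acyclic complexes\<close>

lemma chains_alternating:
  "c \<in> chains \<Delta> q \<Longrightarrow> c (xs @ x # y # ys) = - c (xs @ y # x # ys)"
  unfolding chains_def by blast

lemma chains_support:
  assumes "c \<in> chains \<Delta> q" "c xs \<noteq> 0"
  shows "distinct xs" "set xs \<in> \<Delta>" "int (length xs) = q + 1"
  using assms unfolding chains_def by blast+

lemma chainsI: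
  assumes "\<And>xs. c xs \<noteq> 0 \<Longrightarrow> distinct xs \<and> set xs \<in> \<Delta> \<and> int (length xs) = q + 1"
    and "\<And>xs x y ys. c (xs @ x # y # ys) = - c (xs @ y # x # ys)"
  shows "c \<in> chains \<Delta> q"
  using assms unfolding chains_def by blast

lemma chains_mono: "\<Delta> \<subseteq> \<Sigma> \<Longrightarrow> chains \<Delta> q \<subseteq> chains \<Sigma> q"
  unfolding chains_def by blast

lemma chains_zero: "(\<lambda>_. 0) \<in> chains \<Delta> q"
  by (rule chainsI) auto

lemma chains_add:
  assumes "c \<in> chains \<Delta> q" "d \<in> chains \<Delta> q"
  shows "(\<lambda>xs. c xs + d xs) \<in> chains \<Delta> q"
proof (rule chainsI)
  fix xs assume "c xs + d xs \<noteq> 0"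
  then have "c xs \<noteq> 0 \<or> d xs \<noteq> 0" by auto
  then show "distinct xs \<and> set xs \<in> \<Delta> \<and> int (length xs) = q + 1"
    using assms chains_support by blast
next
  fix xs x y ys
  show "c (xs @ x # y # ys) + d (xs @ x # y # ys) = - (c (xs @ y # x # ys) + d (xs @ y # x # ys))"
    by (subst chains_alternating[OF assms(1)], subst chains_alternating[OF assms(2)]) simp
qed

lemma chains_uminus:
  assumes "c \<in> chains \<Delta> q"
  shows "(\<lambda>xs. - c xs) \<in> chains \<Delta> q"
proof (rule chainsI)
  fix xs assume "- c xs \<noteq> 0"
  then show "distinct xs \<and> set xs \<in> \<Delta> \<and> int (length xs) = q + 1"
    using assms chains_support[of c \<Delta> q xs] by simp
next
  fix xs x y ys
  show "- c (xs @ x # y # ys) = - (- c (xs @ y # x # ys))"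
    by (subst chains_alternating[OF assms(1)]) simp
qed

lemma chains_move_front:
  assumes "c \<in> chains \<Delta> q"
  shows "c (us @ v # vs) = (- 1) ^ length us * c (v # us @ vs)"
proof (induction us arbitrary: vs rule: rev_induct)
  case (snoc u us)
  show ?case
    using chains_alternating[OF assms, of us u v vs] snoc[of "u # vs"] by simp
qed simp

lemma finite_vertices: "finite_complex \<Delta> \<Longrightarrow> finite (\<Union>\<Delta>)"
  by (auto simp: finite_complex_def)

text \<open>
  Chains of a subcomplex vanish on lists with other vertices, so the boundary operators of a complex
  and of its subcomplexes agree.
\<close>

lemma chain_boundary_superset:
  assumes c: "c \<in> chains \<Delta> q" and W: "finite W" "\<Union>\<Delta> \<subseteq> W"
  shows "chain_boundary \<Delta> c ys = (\<Sum>v\<in>W. c (v # ys))"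
  unfolding chain_boundary_def
proof (rule sum.mono_neutral_left[OF W])
  show "\<forall>v\<in>W - \<Union>\<Delta>. c (v # ys) = 0"
  proof
    fix v assume "v \<in> W - \<Union>\<Delta>"
    then show "c (v # ys) = 0"
      using chains_support(2)[OF c, of "v # ys"] by auto
  qed
qed

lemma chain_boundary_in_chains:
  assumes c: "c \<in> chains \<Delta> (q + 1)" and \<Delta>: "finite_complex \<Delta>"
  shows "chain_boundary \<Delta> c \<in> chains \<Delta> q"
proof (rule chainsI)
  fix xs assume "chain_boundary \<Delta> c xs \<noteq> 0"
  then obtain v where "c (v # xs) \<noteq> 0"
    unfolding chain_boundary_def by (meson sum.neutral)
  from chains_support[OF c this] \<Delta>
  show "distinct xs \<and> set xs \<in> \<Delta> \<and> int (length xs) = q + 1"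
    unfolding finite_complex_def by (auto 0 4)
next
  fix xs x y ys
  have "c (v # xs @ x # y # ys) = - c (v # xs @ y # x # ys)" for v
    using chains_alternating[OF c, of "v # xs" x y ys] by simp
  then show "chain_boundary \<Delta> c (xs @ x # y # ys) = - chain_boundary \<Delta> c (xs @ y # x # ys)"
    unfolding chain_boundary_def sum_negf[symmetric] by (intro sum.cong refl)
qed

text \<open>
  The chain \<open>v * c\<close>, extended alternatingly: moving \<open>v\<close> to the front of \<open>xs\<close> costs the sign
  and leaves the list on which \<open>c\<close> is read off.
\<close>

definition cone_chain :: "'a \<Rightarrow> ('a list \<Rightarrow> 'k::field) \<Rightarrow> 'a list \<Rightarrow> 'k" where
  "cone_chain v c xs =
     (if distinct xs \<and> v \<in> set xs
      then (- 1) ^ length (takeWhile (\<lambda>x. x \<noteq> v) xs) * c (remove1 v xs) else 0)"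

lemma cone_chain_split:
  assumes "v \<notin> set us"
  shows "cone_chain v c (us @ v # vs) =
     (if distinct (us @ v # vs) then (- 1) ^ length us * c (us @ vs) else 0)"
proof -
  have "takeWhile (\<lambda>x. x \<noteq> v) (us @ v # vs) = us"
    using assms by (subst takeWhile_append2) auto
  then show ?thesis using assms by (simp add: cone_chain_def remove1_append)
qed

lemma cone_chain_in_chains:
  assumes c: "c \<in> chains \<Delta> q"
    and ins: "\<And>\<sigma>. \<sigma> \<in> \<Delta> \<Longrightarrow> insert v \<sigma> \<in> \<Sigma>"
  shows "cone_chain v c \<in> chains \<Sigma> (q + 1)"
proof (rule chainsI)
  fix xs assume nz: "cone_chain v c xs \<noteq> 0"
  then have d: "distinct xs" and v: "v \<in> set xs" and c0: "c (remove1 v xs) \<noteq> 0"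
    by (auto simp: cone_chain_def split: if_splits)
  have "insert v (set (remove1 v xs)) \<in> \<Sigma>"
    using chains_support(2)[OF c c0] ins by blast
  moreover have "insert v (set (remove1 v xs)) = set xs" using d v by auto
  moreover have "int (length xs) = q + 1 + 1"
    using chains_support(3)[OF c c0] v length_pos_if_in_set[OF v]
    by (simp add: length_remove1)
  ultimately show "distinct xs \<and> set xs \<in> \<Sigma> \<and> int (length xs) = q + 1 + 1"
    using d by simp
next
  fix xs ys :: "'a list" and x y :: 'a
  let ?l = "xs @ x # y # ys" and ?r = "xs @ y # x # ys"
  show "cone_chain v c ?l = - cone_chain v c ?r"
  proof (cases "distinct ?l \<and> v \<in> set ?l")
    case False
    then show ?thesis by (auto simp: cone_chain_def)
  next
    case True
    then have dr: "distinct ?r" "distinct ?l" by auto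
    consider "v \<in> set xs" | "v = x" | "v = y" | "v \<in> set ys" "v \<notin> set (xs @ [x, y])"
      using True by auto
    then show ?thesis
    proof cases
      case 1
      then obtain us vs where xs: "xs = us @ v # vs" and us: "v \<notin> set us"
        by (meson split_list_first)
      show ?thesis
        using cone_chain_split[OF us, of c "vs @ x # y # ys"]
          cone_chain_split[OF us, of c "vs @ y # x # ys"] dr
          chains_alternating[OF c, of "us @ vs" x y ys]
        by (simp add: xs)
    next
      case 2
      then have "v \<notin> set xs" "v \<notin> set (xs @ [y])" using dr by auto
      then show ?thesis
        using cone_chain_split[of v xs c "y # ys"] cone_chain_split[of v "xs @ [y]" c ys] dr 2
        by simp
    next
      case 3
      then have "v \<notin> set xs" "v \<notin> set (xs @ [x])" using dr by auto
      then show ?thesis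
        using cone_chain_split[of v xs c "x # ys"] cone_chain_split[of v "xs @ [x]" c ys] dr 3
        by simp
    next
      case 4
      then obtain us vs where ys: "ys = us @ v # vs" and us: "v \<notin> set us"
        by (meson split_list_first)
      show ?thesis
        using cone_chain_split[of v "xs @ x # y # us" c vs]
          cone_chain_split[of v "xs @ y # x # us" c vs] dr us 4
          chains_alternating[OF c, of xs x y "us @ vs"]
        by (simp add: ys)
    qed
  qed
qed

text \<open>
  Coning with apex \<open>v\<close> is a chain homotopy from the identity to zero. On a list without \<open>v\<close> only the
  summand \<open>u = v\<close> survives and gives \<open>c\<close>. On a list with \<open>v\<close> that summand is missing, and the missing
  term is \<open>c\<close> itself, up to moving \<open>v\<close> to the front.
\<close>

lemma boundary_cone_chain:
  fixes c :: "'a list \<Rightarrow> 'k::field"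
  assumes c: "c \<in> chains \<Delta> q" and W: "finite W" "v \<in> W"
  shows "(\<Sum>u\<in>W. cone_chain v c (u # ys)) =
    c ys - cone_chain v (\<lambda>zs. \<Sum>u\<in>W. c (u # zs)) ys"
proof (cases "distinct ys")
  case False
  then have "c ys = 0" using chains_support(1)[OF c] by blast
  with False show ?thesis by (simp add: cone_chain_def)
next
  case d: True
  show ?thesis
  proof (cases "v \<in> set ys")
    case False
    have "cone_chain v c (u # ys) = (if u = v then c ys else 0)" for u
      using False d by (simp add: cone_chain_def)
    then have "(\<Sum>u\<in>W. cone_chain v c (u # ys)) = c ys"
      using W by (simp only: sum.delta') simp
    moreover have "cone_chain v (\<lambda>zs. \<Sum>u\<in>W. c (u # zs)) ys = 0"
      using False by (simp add: cone_chain_def)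
    ultimately show ?thesis by simp
  next
    case True
    then obtain us vs where ys: "ys = us @ v # vs" and us: "v \<notin> set us"
      by (meson split_list_first)
    let ?s = "(- 1) ^ length us :: 'k"
    have s2: "?s * (?s * x) = x" for x
      by (simp add: mult.assoc[symmetric] power_mult_distrib[symmetric])
    have "cone_chain v c (u # ys) = (if u = v then 0 else - ?s * c (u # us @ vs))" for u
    proof (cases "u = v \<or> u \<in> set ys")
      case True
      then have "\<not> distinct (u # us @ vs) \<or> u = v" by (auto simp: ys)
      then have "c (u # us @ vs) = 0 \<or> u = v" using chains_support(1)[OF c] by blast
      then show ?thesis using True \<open>v \<in> set ys\<close> by (auto simp: cone_chain_def)
    next
      case False
      then have "v \<noteq> u" by blast
      with False show ?thesis
        using cone_chain_split[of v "u # us" c vs] d us by (simp add: ys)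
    qed
    then have "(\<Sum>u\<in>W. cone_chain v c (u # ys)) =
        (\<Sum>u\<in>W. (if u = v then ?s * c (v # us @ vs) else 0) - ?s * c (u # us @ vs))"
      by (intro sum.cong) auto
    also have "\<dots> = ?s * c (v # us @ vs) - ?s * (\<Sum>u\<in>W. c (u # us @ vs))"
      using W by (simp add: sum_subtractf sum_distrib_left)
    also have "?s * c (v # us @ vs) = c ys"
      using chains_move_front[OF c, of us v vs] by (simp add: ys)
    also have "?s * (\<Sum>u\<in>W. c (u # us @ vs)) = cone_chain v (\<lambda>zs. \<Sum>u\<in>W. c (u # zs)) ys"
      using cone_chain_split[OF us, of "\<lambda>zs. \<Sum>u\<in>W. c (u # zs)" vs] d by (simp add: ys)
    finally show ?thesis .
  qed
qed

definition acyclic_complex :: "'k::field itself \<Rightarrow> 'a set set \<Rightarrow> bool" where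
  "acyclic_complex _ \<Delta> \<longleftrightarrow> (\<forall>q. (cycles \<Delta> q :: ('a list \<Rightarrow> 'k) set) \<subseteq> boundaries \<Delta> q)"

lemma boundaries_subset_cycles:
  assumes "finite_complex \<Delta>"
  shows "boundaries \<Delta> q \<subseteq> cycles \<Delta> q"
  using assms chain_boundary_in_chains chain_boundary_chain_boundary
  unfolding boundaries_def cycles_def by blast

lemma acyclic_has_homology_of_ball:
  assumes "acyclic_complex TYPE('k::field) \<Delta>" "finite_complex \<Delta>" "0 \<le> m"
  shows "has_homology_of_ball TYPE('k) m \<Delta>"
proof -
  have "(cycles \<Delta> q :: ('a list \<Rightarrow> 'k) set) = boundaries \<Delta> q" for q
    using assms boundaries_subset_cycles unfolding acyclic_complex_def by blast
  then show ?thesis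
    using assms(3) by (simp add: has_homology_of_ball_def reduced_betti_def)
qed

text \<open>
  By \<open>boundary_cone_chain\<close> a cycle is the boundary of its own cone; the cone stays in the complex because
  every face can be enlarged by the apex.
\<close>

lemma acyclic_cone:
  assumes fin: "finite_complex \<Delta>" and apex: "\<And>\<sigma>. \<sigma> \<in> \<Delta> \<Longrightarrow> insert w \<sigma> \<in> \<Delta>"
  shows "acyclic_complex TYPE('k::field) \<Delta>"
  unfolding acyclic_complex_def
proof (intro allI subsetI)
  fix q and c :: "'a list \<Rightarrow> 'k" assume c: "c \<in> cycles \<Delta> q"
  then have ch: "c \<in> chains \<Delta> q" and z: "(\<Sum>u\<in>\<Union>\<Delta>. c (u # ys)) = 0" for ys
    by (auto simp: cycles_def chain_boundary_def dest: fun_cong)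
  have "w \<in> \<Union>\<Delta>" using apex[of "{}"] fin by (auto simp: finite_complex_def)
  then have "chain_boundary \<Delta> (cone_chain w c) = c"
    using boundary_cone_chain[OF ch finite_vertices[OF fin], of w]
    by (intro ext) (simp add: chain_boundary_def z cone_chain_def)
  then show "c \<in> boundaries \<Delta> q"
    unfolding boundaries_def using cone_chain_in_chains[OF ch apex] by force
qed

lemma complex_link_subset: "complex_link \<Delta> \<sigma> \<subseteq> \<Delta>"
  by (auto simp: complex_link_def)

text \<open>
  This is the Mayer--Vietoris argument for the union of the deletion of \<open>v\<close> and its star. The part of a
  cycle at \<open>v\<close> is a cycle of the link; filling it and coning the filling with \<open>v\<close> gives a chain whose
  boundary cancels that part, and what remains is a cycle of the deletion.
\<close>

lemma acyclic_deletion_link: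
  assumes fin: "finite_complex \<Delta>"
    and del: "acyclic_complex TYPE('k::field) {\<sigma> \<in> \<Delta>. v \<notin> \<sigma>}"
    and link: "acyclic_complex TYPE('k) (complex_link \<Delta> {v})"
  shows "acyclic_complex TYPE('k) \<Delta>"
  unfolding acyclic_complex_def
proof (intro allI subsetI)
  fix q and c :: "'a list \<Rightarrow> 'k" assume "c \<in> cycles \<Delta> q"
  then have c: "c \<in> chains \<Delta> q" and z: "(\<Sum>u\<in>\<Union>\<Delta>. c (u # ys)) = 0" for ys
    by (auto simp: cycles_def chain_boundary_def dest: fun_cong)
  let ?V = "\<Union>\<Delta>" and ?L = "complex_link \<Delta> {v}" and ?D = "{\<sigma> \<in> \<Delta>. v \<notin> \<sigma>}"
  have V: "finite ?V" using finite_vertices[OF fin] .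
  show "c \<in> boundaries \<Delta> q"
  proof (cases "v \<in> ?V")
    case False
    then have "?D = \<Delta>" by auto
    with del \<open>c \<in> cycles \<Delta> q\<close> show ?thesis
      unfolding acyclic_complex_def by auto
  next
    case vV: True
    let ?cv = "\<lambda>ys. c (v # ys)"
    have cv: "?cv \<in> chains ?L (q - 1)"
    proof (rule chainsI)
      fix xs assume "c (v # xs) \<noteq> 0"
      from chains_support[OF c this] fin
      show "distinct xs \<and> set xs \<in> ?L \<and> int (length xs) = q - 1 + 1"
        unfolding complex_link_def finite_complex_def by (auto 0 4)
    next
      fix xs x y ys
      show "c (v # xs @ x # y # ys) = - c (v # xs @ y # x # ys)"
        using chains_alternating[OF c, of "v # xs" x y ys] by simp
    qed
    have LV: "\<Union>?L \<subseteq> ?V" using complex_link_subset by blast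
    have "chain_boundary ?L ?cv ys = 0" for ys
    proof -
      have "chain_boundary ?L ?cv ys = (\<Sum>u\<in>?V. c (v # u # ys))"
        using chain_boundary_superset[OF cv V LV] .
      also have "\<dots> = (\<Sum>u\<in>?V. - c (u # v # ys))"
        using chains_alternating[OF c, of "[]" v _ ys] by (intro sum.cong) auto
      also have "\<dots> = 0" using z[of "v # ys"] by (simp add: sum_negf)
      finally show ?thesis .
    qed
    then have "?cv \<in> cycles ?L (q - 1)" using cv by (auto simp: cycles_def)
    then obtain d where d: "d \<in> chains ?L q" and bd: "chain_boundary ?L d = ?cv"
      using link unfolding acyclic_complex_def boundaries_def by force
    have bd': "(\<Sum>u\<in>?V. d (u # ys)) = c (v # ys)" for ys
      using chain_boundary_superset[OF d V LV] bd by metis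
    have ins: "\<sigma> \<in> ?L \<Longrightarrow> insert v \<sigma> \<in> \<Delta>" for \<sigma> by (simp add: complex_link_def)
    have cd: "cone_chain v d \<in> chains \<Delta> (q + 1)"
      using cone_chain_in_chains[OF d ins] .
    \<comment> \<open>Adding the boundary of \<open>v * d\<close> removes the part of \<open>c\<close> at \<open>v\<close>.\<close>
    let ?c' = "\<lambda>ys. c ys + chain_boundary \<Delta> (cone_chain v d) ys"
    have bcd: "chain_boundary \<Delta> (cone_chain v d) ys = d ys - cone_chain v ?cv ys" for ys
      using boundary_cone_chain[OF d V vV, of ys] by (simp add: chain_boundary_def bd')
    have c': "?c' \<in> chains \<Delta> q"
      using chains_add[OF c chain_boundary_in_chains[OF cd fin]] .
    have c'v: "?c' ys = 0" if vy: "v \<in> set ys" for ys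
    proof (cases "distinct ys")
      case False
      then show ?thesis using chains_support(1)[OF c'] by blast
    next
      case True
      obtain us vs where ys: "ys = us @ v # vs" and us: "v \<notin> set us"
        using split_list_first[OF vy] by blast
      have "d ys = 0"
        using chains_support(2)[OF d, of ys] vy by (auto simp: complex_link_def)
      moreover have "cone_chain v ?cv ys = c ys"
        using cone_chain_split[OF us, of ?cv vs] True chains_move_front[OF c, of us v vs]
        by (simp add: ys)
      ultimately show ?thesis by (simp add: bcd)
    qed
    have c'D: "?c' \<in> chains ?D q"
      using chains_support[OF c'] chains_alternating[OF c'] c'v
      by (intro chainsI) blast+
    have DV: "\<Union>?D \<subseteq> ?V" by auto
    have "chain_boundary ?D ?c' ys = 0" for ys
    proof -
      have "chain_boundary ?D ?c' ys = (\<Sum>u\<in>?V. ?c' (u # ys))"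
        using chain_boundary_superset[OF c'D V DV] .
      also have "\<dots> = chain_boundary \<Delta> (chain_boundary \<Delta> (cone_chain v d)) ys"
        by (simp add: sum.distrib z) (simp add: chain_boundary_def)
      also have "\<dots> = 0" using chain_boundary_chain_boundary[OF cd fin] by (rule fun_cong)
      finally show ?thesis .
    qed
    then have "?c' \<in> cycles ?D q" using c'D by (auto simp: cycles_def)
    then obtain e where e: "e \<in> chains ?D (q + 1)" and be: "chain_boundary ?D e = ?c'"
      using del unfolding acyclic_complex_def boundaries_def by force
    have e': "e \<in> chains \<Delta> (q + 1)" using e chains_mono[of ?D \<Delta>] by blast
    have "chain_boundary \<Delta> e ys = ?c' ys" for ys
      using chain_boundary_superset[OF e V DV] be
        chain_boundary_superset[OF e' V order_refl] by metis
    then have "chain_boundary \<Delta> (\<lambda>xs. e xs + - cone_chain v d xs) = c"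
      by (intro ext) (simp add: chain_boundary_def sum_subtractf)
    moreover have "(\<lambda>xs. e xs + - cone_chain v d xs) \<in> chains \<Delta> (q + 1)"
      using chains_add[OF e' chains_uminus[OF cd]] .
    ultimately show ?thesis unfolding boundaries_def by force
  qed
qed

section \<open>Lower bounds for Betti numbers\<close>

text \<open>
  The dimension of a set is the size of a basis, and it is zero if the basis is infinite. A finite
  spanning set is therefore required before dimensions can be compared.
\<close>

lemma (in vector_space) dim_less_dim:
  assumes "B \<subseteq> C" "C \<subseteq> span F" "finite F" "x \<in> C" "x \<notin> span B"
  shows "dim B < dim C"
proof -
  obtain S where S: "S \<subseteq> B" "independent S" "B \<subseteq> span S" "card S = dim B"
    using basis_exists by blast
  obtain T where T: "T \<subseteq> C" "independent T" "C \<subseteq> span T" "card T = dim C"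
    using basis_exists by blast
  have fT: "finite T"
    using independent_span_bound[OF assms(3) T(2)] T(1) assms(2) by blast
  have "x \<notin> span S" using assms(5) span_mono[OF S(1)] by blast
  then have i: "independent (insert x S)" using S(2) by (simp add: independent_insert)
  have "insert x S \<subseteq> span T" using S(1) assms(1,4) T(3) by blast
  then have "finite (insert x S) \<and> card (insert x S) \<le> card T"
    by (rule independent_span_bound[OF fT i])
  moreover have "x \<notin> S" using \<open>x \<notin> span S\<close> span_base[of x S] by blast
  ultimately have "Suc (card S) \<le> card T" by (auto simp: card_insert_if)
  with S(4) T(4) show ?thesis by simp
qed

definition point_mass :: "'b \<Rightarrow> 'b \<Rightarrow> 'k::field" where
  "point_mass x = (\<lambda>y. if y = x then 1 else 0)"

interpretation chain_space: vector_space "chain_scale :: 'k::field \<Rightarrow> ('a list \<Rightarrow> 'k) \<Rightarrow> _"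
  by (rule vector_space_chain_scale)

lemma chains_finitely_spanned:
  assumes "finite_complex \<Delta>"
  obtains F where "finite F" "(chains \<Delta> q :: ('a list \<Rightarrow> 'k::field) set) \<subseteq> chain_space.span F"
proof
  let ?X = "{xs. set xs \<subseteq> \<Union>\<Delta> \<and> distinct xs}"
  let ?F = "point_mass ` ?X :: ('a list \<Rightarrow> 'k) set"
  have X: "finite ?X"
    using finite_subset_distinct[OF finite_vertices[OF assms]] by simp
  then show "finite ?F" by simp
  show "(chains \<Delta> q :: ('a list \<Rightarrow> 'k::field) set) \<subseteq> chain_space.span ?F"
  proof
    fix c :: "'a list \<Rightarrow> 'k" assume c: "c \<in> chains \<Delta> q"
    have "c = (\<Sum>xs\<in>?X. chain_scale (c xs) (point_mass xs))"
    proof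
      fix ys
      have *: "(\<Sum>xs\<in>A. chain_scale (c xs) (point_mass xs)) ys =
          (\<Sum>xs\<in>A. if xs = ys then c ys else 0)" if "finite A" for A
        using that by induction (auto simp: chain_scale_def point_mass_def)
      have "c ys = 0" if "ys \<notin> ?X"
        using chains_support[OF c, of ys] that by blast
      then show "c ys = (\<Sum>xs\<in>?X. chain_scale (c xs) (point_mass xs)) ys"
        using X by (simp only: *[OF X] sum.delta) auto
    qed
    also have "\<dots> \<in> chain_space.span ?F"
      by (intro chain_space.span_sum chain_space.span_scale chain_space.span_base) auto
    finally show "c \<in> chain_space.span ?F" .
  qed
qed

text \<open>
  The Betti number is a truncated difference of dimensions; a single cycle that is independent of the
  boundaries already makes it positive.
\<close>

lemma reduced_betti_pos:
  fixes c :: "'a list \<Rightarrow> 'k::field"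
  assumes fin: "finite_complex \<Delta>" and c: "c \<in> cycles \<Delta> q"
    and nb: "c \<notin> chain_space.span (boundaries \<Delta> q)"
  shows "reduced_betti TYPE('k) \<Delta> q > 0"
proof -
  obtain F where F: "finite F" "(chains \<Delta> q :: ('a list \<Rightarrow> 'k) set) \<subseteq> chain_space.span F"
    using chains_finitely_spanned[OF fin] .
  have "cycles \<Delta> q \<subseteq> chain_space.span F" using F(2) by (auto simp: cycles_def)
  from chain_space.dim_less_dim[OF boundaries_subset_cycles[OF fin] this F(1) c nb]
  show ?thesis by (simp add: reduced_betti_def)
qed

lemma chains_eq_zero:
  assumes "\<And>\<sigma>. \<sigma> \<in> \<Delta> \<Longrightarrow> int (card \<sigma>) \<noteq> q + 1"
  shows "chains \<Delta> q = {\<lambda>_ :: 'a list. 0 :: 'b::field}"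
proof
  show "chains \<Delta> q \<subseteq> {\<lambda>_ :: 'a list. 0 :: 'b}"
  proof
    fix c :: "'a list \<Rightarrow> 'b" assume c: "c \<in> chains \<Delta> q"
    have "c xs = 0" for xs
      using chains_support[OF c, of xs] assms[of "set xs"] distinct_card[of xs] by fastforce
    then show "c \<in> {\<lambda>_. 0}" by auto
  qed
qed (simp add: chains_zero)

lemma boundaries_eq_zero:
  assumes "\<And>\<sigma>. \<sigma> \<in> \<Delta> \<Longrightarrow> int (card \<sigma>) \<noteq> q + 2"
  shows "boundaries \<Delta> q = {0 :: 'a list \<Rightarrow> 'k::field}"
proof -
  have "chains \<Delta> (q + 1) = {\<lambda>_ :: 'a list. 0 :: 'k}"
    by (rule chains_eq_zero) (use assms in force)
  then show ?thesis
    by (simp add: boundaries_def chain_boundary_def zero_fun_def)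
qed

lemma reduced_betti_empty_face:
  "reduced_betti TYPE('k::field) {{}} (- 1) > 0"
proof (rule reduced_betti_pos)
  show "finite_complex {{}}" by (simp add: finite_complex_def)
  show "(point_mass [] :: 'a list \<Rightarrow> 'k) \<in> cycles {{}} (- 1)"
    by (auto simp: cycles_def chain_boundary_def point_mass_def intro!: chainsI split: if_splits)
  have "boundaries {{}} (- 1) = {0 :: 'a list \<Rightarrow> 'k}"
    by (rule boundaries_eq_zero) simp
  moreover have "(point_mass [] :: 'a list \<Rightarrow> 'k) [] \<noteq> 0 []" by (simp add: point_mass_def)
  then have "(point_mass [] :: 'a list \<Rightarrow> 'k) \<noteq> 0" by metis
  ultimately show "(point_mass [] :: 'a list \<Rightarrow> 'k) \<notin> chain_space.span (boundaries {{}} (- 1))"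
    by (simp add: chain_space.span_insert_0)
qed

definition point_difference :: "'a \<Rightarrow> 'a \<Rightarrow> 'a list \<Rightarrow> 'k::field" where
  "point_difference x y = (\<lambda>zs. point_mass [x] zs - point_mass [y] zs)"

lemma point_difference_cycle:
  assumes fin: "finite_complex \<Delta>" and x: "x \<in> \<Union>\<Delta>" and y: "y \<in> \<Union>\<Delta>"
  shows "(point_difference x y :: 'a list \<Rightarrow> 'k::field) \<in> cycles \<Delta> 0"
proof -
  have "{x} \<in> \<Delta>" "{y} \<in> \<Delta>" using fin x y unfolding finite_complex_def by blast+
  then have "(point_difference x y :: 'a list \<Rightarrow> 'k) \<in> chains \<Delta> 0"
    by (intro chainsI) (auto simp: point_difference_def point_mass_def split: if_splits)
  moreover have "chain_boundary \<Delta> (point_difference x y :: 'a list \<Rightarrow> 'k) = (\<lambda>_. 0)"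
  proof
    fix ys
    have "(\<Sum>v\<in>\<Union>\<Delta>. point_mass [z] (v # ys) :: 'k) = (if ys = [] then 1 else 0)"
      if "z \<in> \<Union>\<Delta>" for z
    proof -
      have "(\<Sum>v\<in>\<Union>\<Delta>. point_mass [z] (v # ys) :: 'k) =
          (\<Sum>v\<in>\<Union>\<Delta>. if v = z then (if ys = [] then 1 else 0) else 0)"
        by (intro sum.cong) (auto simp: point_mass_def)
      also have "\<dots> = (if ys = [] then 1 else 0)"
        using that finite_vertices[OF fin] by (simp only: sum.delta' sum.delta if_True)
      finally show ?thesis .
    qed
    then show "chain_boundary \<Delta> (point_difference x y :: 'a list \<Rightarrow> 'k) ys = 0"
      using x y by (simp add: chain_boundary_def point_difference_def sum_subtractf)
  qed
  ultimately show ?thesis by (simp add: cycles_def)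
qed

text \<open>
  The sum of the coefficients over a union of components is a linear functional that kills all
  boundaries, but not the difference of a point inside and a point outside.
\<close>

lemma disconnected_reduced_betti_pos:
  assumes fin: "finite_complex \<Delta>" and x: "x \<in> \<Union>\<Delta>" "x \<in> A" and y: "y \<in> \<Union>\<Delta>" "y \<notin> A"
    and closed: "\<And>u v. {u, v} \<in> \<Delta> \<Longrightarrow> u \<in> A \<Longrightarrow> v \<in> A"
  shows "reduced_betti TYPE('k::field) \<Delta> 0 > 0"
proof (rule reduced_betti_pos[OF fin point_difference_cycle[OF fin x(1) y(1)]])
  let ?V = "\<Union>\<Delta>"
  \<comment> \<open>The sum of the coefficients over the vertices in \<open>A\<close> vanishes on boundaries.\<close>
  define \<phi> where "\<phi> c = (\<Sum>v\<in>?V \<inter> A. c [v])" for c :: "'a list \<Rightarrow> 'k"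
  have V: "finite ?V" using finite_vertices[OF fin] .
  have sub: "chain_space.subspace {c. \<phi> c = 0}"
    unfolding \<phi>_def chain_space.subspace_def
    by (simp add: sum.distrib chain_scale_def sum_distrib_left[symmetric])
  have "boundaries \<Delta> 0 \<subseteq> {c. \<phi> c = 0}"
  proof
    fix b :: "'a list \<Rightarrow> 'k" assume "b \<in> boundaries \<Delta> 0"
    then obtain c where c: "c \<in> chains \<Delta> 1" and b: "b = chain_boundary \<Delta> c"
      by (auto simp: boundaries_def)
    have sw: "c [v, u] = - c [u, v]" for u v
      using chains_alternating[OF c, of "[]" v u "[]"] by simp
    have diag: "c [v, v] = 0" for v
      using chains_support(1)[OF c, of "[v, v]"] by auto
    have off: "c [u, v] = 0" if "v \<in> A" "u \<notin> A" for u v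
    proof (rule ccontr)
      assume "c [u, v] \<noteq> 0"
      then have "{v, u} \<in> \<Delta>" using chains_support(2)[OF c] by (metis empty_set insert_commute list.simps(15))
      then show False using closed that by blast
    qed
    have "(\<Sum>v\<in>W. \<Sum>u\<in>W. c [u, v]) = 0" if "finite W" for W
      using that
    proof induction
      case (insert w W)
      have "(\<Sum>v\<in>W. c [w, v]) = - (\<Sum>v\<in>W. c [v, w])"
        by (subst sw) (simp add: sum_negf)
      with insert show ?case by (simp add: sum.distrib diag)
    qed simp
    then have "(\<Sum>v\<in>?V \<inter> A. \<Sum>u\<in>?V \<inter> A. c [u, v]) = 0" using V by blast
    moreover have "(\<Sum>u\<in>?V. c [u, v]) = (\<Sum>u\<in>?V \<inter> A. c [u, v])" if "v \<in> A" for v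
      using V off[OF that] by (intro sum.mono_neutral_right) auto
    ultimately have "\<phi> b = 0" by (simp add: \<phi>_def b chain_boundary_def)
    then show "b \<in> {c. \<phi> c = 0}" by simp
  qed
  then have "chain_space.span (boundaries \<Delta> 0) \<subseteq> {c. \<phi> c = 0}"
    using sub by (rule chain_space.span_minimal)
  moreover have "\<phi> (point_difference x y) = (\<Sum>v\<in>?V \<inter> A. if v = x then 1 else 0)"
    unfolding \<phi>_def using y by (intro sum.cong) (auto simp: point_difference_def point_mass_def)
  then have "\<phi> (point_difference x y) = 1" using V x by (simp only: sum.delta finite_Int) simp
  ultimately show "(point_difference x y :: 'a list \<Rightarrow> 'k) \<notin> chain_space.span (boundaries \<Delta> 0)"
    by auto
qed

text \<open>
  Without edges there are no boundaries in degree zero, and the two differences with \<open>z\<close> are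
  independent cycles. Independence appears as a chain of three spaces, the middle one being the
  cycles that vanish at \<open>y\<close>.
\<close>

lemma three_points_reduced_betti:
  assumes fin: "finite_complex \<Delta>" and pts: "\<And>\<sigma>. \<sigma> \<in> \<Delta> \<Longrightarrow> card \<sigma> \<le> 1"
    and xyz: "x \<in> \<Union>\<Delta>" "y \<in> \<Union>\<Delta>" "z \<in> \<Union>\<Delta>" "x \<noteq> y" "x \<noteq> z" "y \<noteq> z"
  shows "reduced_betti TYPE('k::field) \<Delta> 0 > 1"
proof -
  let ?Z = "cycles \<Delta> 0 :: ('a list \<Rightarrow> 'k) set"
  let ?C = "{c \<in> ?Z. c [y] = 0}"
  obtain F where F: "finite F" "(chains \<Delta> 0 :: ('a list \<Rightarrow> 'k) set) \<subseteq> chain_space.span F"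
    using chains_finitely_spanned[OF fin] .
  have Z: "?Z \<subseteq> chain_space.span F" using F(2) by (auto simp: cycles_def)
  have B: "boundaries \<Delta> 0 = {0 :: 'a list \<Rightarrow> 'k}"
    by (rule boundaries_eq_zero) (use pts in force)
  have "chain_space.dim {0 :: 'a list \<Rightarrow> 'k} < chain_space.dim ?C"
  proof (rule chain_space.dim_less_dim[OF _ _ F(1)])
    show "{0} \<subseteq> ?C"
      using boundaries_subset_cycles[OF fin, of 0] B by auto
    show "?C \<subseteq> chain_space.span F" using Z by auto
    show "point_difference x z \<in> ?C"
      using point_difference_cycle[OF fin] xyz by (auto simp: point_difference_def point_mass_def)
    have "(point_difference x z :: 'a list \<Rightarrow> 'k) [x] \<noteq> 0 [x]"
      using xyz by (simp add: point_difference_def point_mass_def)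
    then have "(point_difference x z :: 'a list \<Rightarrow> 'k) \<noteq> 0" by metis
    then show "(point_difference x z :: 'a list \<Rightarrow> 'k) \<notin> chain_space.span {0}"
      by (simp add: chain_space.span_insert_0)
  qed
  moreover have "chain_space.dim ?C < chain_space.dim ?Z"
  proof (rule chain_space.dim_less_dim[OF _ Z F(1)])
    show "point_difference y z \<in> ?Z"
      using point_difference_cycle[OF fin] xyz by blast
    have "chain_space.span ?C \<subseteq> {c. c [y] = 0}"
      by (rule chain_space.span_minimal) (auto simp: chain_space.subspace_def chain_scale_def)
    then show "(point_difference y z :: 'a list \<Rightarrow> 'k) \<notin> chain_space.span ?C"
      using xyz by (auto simp: point_difference_def point_mass_def)
  qed auto
  moreover have "chain_space.dim {0 :: 'a list \<Rightarrow> 'k} = 0"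
    using chain_space.dim_span[of "{}"] chain_space.dim_eq_card_independent[of "{}"]
    by (metis card.empty chain_space.independent_empty chain_space.span_empty)
  ultimately show ?thesis by (simp add: reduced_betti_def B)
qed

section \<open>Quotient maps with the same fibres\<close>

text \<open>
  Each of the two quotient maps factors through the other; the factors are mutually inverse.
\<close>

lemma quotient_maps_same_fibres:
  assumes p: "quotient_map X Y p" and q: "quotient_map X Z q"
    and fib: "\<And>x y. \<lbrakk>x \<in> topspace X; y \<in> topspace X\<rbrakk> \<Longrightarrow> p x = p y \<longleftrightarrow> q x = q y"
  shows "Y homeomorphic_space Z"
proof -
  obtain g where g: "continuous_map Y Z g" "\<And>x. x \<in> topspace X \<Longrightarrow> g (p x) = q x"
    using quotient_map_lift_exists[OF p quotient_imp_continuous_map[OF q]] fib by metis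
  obtain h where h: "continuous_map Z Y h" "\<And>x. x \<in> topspace X \<Longrightarrow> h (q x) = p x"
    using quotient_map_lift_exists[OF q quotient_imp_continuous_map[OF p]] fib by metis
  have "h (g y) = y" if "y \<in> topspace Y" for y
    using that quotient_imp_surjective_map[OF p] g(2) h(2) by force
  moreover have "g (h z) = z" if "z \<in> topspace Z" for z
    using that quotient_imp_surjective_map[OF q] g(2) h(2) by force
  ultimately show ?thesis
    using g(1) h(1) unfolding homeomorphic_space_def homeomorphic_maps_def by blast
qed

lemma quotient_topology_homeomorphic_space:
  assumes q: "quotient_map X Z q"
    and r: "r = {(x, y). x \<in> topspace X \<and> y \<in> topspace X \<and> q x = q y}"
  shows "Z homeomorphic_space quotient_topology X r"
proof (rule quotient_maps_same_fibres[OF q])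
  have cl: "r `` {x} = {y \<in> topspace X. q x = q y}" if "x \<in> topspace X" for x
    using that by (auto simp: r)
  have top: "topspace (quotient_topology X r) = topspace X // r"
  proof
    show "topspace (quotient_topology X r) \<subseteq> topspace X // r"
      using openin_quotient_topology[of X r "topspace (quotient_topology X r)"] by simp
    have "{x \<in> topspace X. r `` {x} \<in> topspace X // r} = topspace X"
      by (auto simp: quotientI)
    then show "topspace X // r \<subseteq> topspace (quotient_topology X r)"
      by (intro openin_subset) (simp add: openin_quotient_topology)
  qed
  show "quotient_map X (quotient_topology X r) (\<lambda>x. r `` {x})"
    unfolding quotient_map_def top openin_quotient_topology
    by (auto simp: quotient_def)
  show "q x = q y \<longleftrightarrow> r `` {x} = r `` {y}" if "x \<in> topspace X" "y \<in> topspace X" for x y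
    using that by (auto simp: cl)
qed

section \<open>Geometric realizations and joins\<close>

lemma topspace_geometric_realization:
  "topspace (geometric_realization \<Delta>) =
     {\<alpha>. (\<forall>v. 0 \<le> \<alpha> v) \<and> {v. \<alpha> v \<noteq> 0} \<in> \<Delta> \<and> (\<Sum>v | \<alpha> v \<noteq> 0. \<alpha> v) = 1}"
  by (simp add: geometric_realization_def)

lemma Hausdorff_geometric_realization: "Hausdorff_space (geometric_realization \<Delta>)"
  unfolding geometric_realization_def
  by (rule Hausdorff_space_subtopology) (metis Hausdorff_space_euclidean Hausdorff_space_product_topology)

lemma continuous_map_geometric_realization:
  "continuous_map X (geometric_realization \<Delta>) f \<longleftrightarrow>
     (\<forall>v. continuous_map X euclideanreal (\<lambda>x. f x v)) \<and>
     f \<in> topspace X \<rightarrow> topspace (geometric_realization \<Delta>)"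
  unfolding topspace_geometric_realization
  by (simp add: geometric_realization_def continuous_map_in_subtopology
      continuous_map_componentwise_UNIV)

lemma continuous_map_barycentric_coordinate:
  "continuous_map (geometric_realization \<Delta>) euclideanreal (\<lambda>\<alpha>. \<alpha> v)"
  unfolding geometric_realization_def
  by (intro continuous_map_from_subtopology continuous_map_product_projection) simp

text \<open>
  Summing over a fixed finite vertex set instead of the support makes the third condition linear.
\<close>

lemma geometric_realization_points:
  assumes "finite W" "\<Union>\<Delta> \<subseteq> W"
  shows "\<alpha> \<in> topspace (geometric_realization \<Delta>) \<longleftrightarrow>
    (\<forall>v. 0 \<le> \<alpha> v) \<and> {v. \<alpha> v \<noteq> 0} \<in> \<Delta> \<and> sum \<alpha> W = 1"
proof -
  have "(\<Sum>v | \<alpha> v \<noteq> 0. \<alpha> v) = sum \<alpha> W" if "{v. \<alpha> v \<noteq> 0} \<in> \<Delta>"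
    using that assms by (intro sum.mono_neutral_left) auto
  then show ?thesis by (auto simp: topspace_geometric_realization)
qed

lemma geometric_realization_complex_iso:
  assumes iso: "\<Delta> \<cong>\<^sub>C \<Sigma>" and fin: "finite_complex \<Delta>"
  shows "geometric_realization \<Delta> homeomorphic_space geometric_realization \<Sigma>"
proof -
  obtain f where bij: "bij_betw f (\<Union>\<Delta>) (\<Union>\<Sigma>)" and im: "(image f) ` \<Delta> = \<Sigma>"
    using iso unfolding complex_iso_def by blast
  define g where "g = inv_into (\<Union>\<Delta>) f"
  have V: "finite (\<Union>\<Delta>)" using fin by (auto simp: finite_complex_def)
  then have W: "finite (\<Union>\<Sigma>)" using bij bij_betw_finite by blast
  have gf: "g (f v) = v" if "v \<in> \<Union>\<Delta>" for v
    using that bij by (simp add: g_def bij_betw_inv_into_left)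
  have fg: "f (g w) = w" if "w \<in> \<Union>\<Sigma>" for w
    using that bij by (simp add: g_def bij_betw_inv_into_right)
  have gb: "bij_betw g (\<Union>\<Sigma>) (\<Union>\<Delta>)"
    using bij by (simp add: g_def bij_betw_inv_into)
  have fS: "f v \<in> \<Union>\<Sigma>" if "v \<in> \<Union>\<Delta>" for v using that bij by (auto simp: bij_betw_def)
  have gS: "g v \<in> \<Union>\<Delta>" if "v \<in> \<Union>\<Sigma>" for v using that gb by (auto simp: bij_betw_def)
  define \<phi> where "\<phi> \<alpha> = (\<lambda>w. if w \<in> \<Union>\<Sigma> then \<alpha> (g w) else 0)" for \<alpha> :: "'a \<Rightarrow> real"
  define \<psi> where "\<psi> \<beta> = (\<lambda>v. if v \<in> \<Union>\<Delta> then \<beta> (f v) else 0)" for \<beta> :: "'b \<Rightarrow> real"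
  have \<phi>: "\<phi> \<alpha> \<in> topspace (geometric_realization \<Sigma>)"
    if \<alpha>: "\<alpha> \<in> topspace (geometric_realization \<Delta>)" for \<alpha>
  proof -
    have a: "\<forall>v. 0 \<le> \<alpha> v" "{v. \<alpha> v \<noteq> 0} \<in> \<Delta>" "sum \<alpha> (\<Union>\<Delta>) = 1"
      using \<alpha> geometric_realization_points[OF V order_refl] by blast+
    have "{w. \<phi> \<alpha> w \<noteq> 0} = f ` {v. \<alpha> v \<noteq> 0}"
    proof safe
      fix w assume "\<phi> \<alpha> w \<noteq> 0"
      then have "w \<in> \<Union>\<Sigma>" "\<alpha> (g w) \<noteq> 0" by (auto simp: \<phi>_def split: if_splits)
      then show "w \<in> f ` {v. \<alpha> v \<noteq> 0}" using fg by force
    next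
      fix v assume v: "\<alpha> v \<noteq> 0" "\<phi> \<alpha> (f v) = 0"
      then have "v \<in> \<Union>\<Delta>" using a(2) by blast
      with v show False using gf[of v] fS[of v] by (simp add: \<phi>_def)
    qed
    then have "{w. \<phi> \<alpha> w \<noteq> 0} \<in> \<Sigma>" using a(2) im by blast
    moreover have "sum (\<phi> \<alpha>) (\<Union>\<Sigma>) = sum \<alpha> (\<Union>\<Delta>)"
      unfolding sum.reindex_bij_betw[OF gb, of \<alpha>, symmetric] by (simp add: \<phi>_def)
    ultimately show ?thesis
      using a by (subst geometric_realization_points[OF W order_refl]) (auto simp: \<phi>_def)
  qed
  have \<psi>: "\<psi> \<beta> \<in> topspace (geometric_realization \<Delta>)"
    if \<beta>: "\<beta> \<in> topspace (geometric_realization \<Sigma>)" for \<beta>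
  proof -
    have b: "\<forall>v. 0 \<le> \<beta> v" "{v. \<beta> v \<noteq> 0} \<in> \<Sigma>" "sum \<beta> (\<Union>\<Sigma>) = 1"
      using \<beta> geometric_realization_points[OF W order_refl] by blast+
    obtain \<sigma> where \<sigma>: "\<sigma> \<in> \<Delta>" "{v. \<beta> v \<noteq> 0} = f ` \<sigma>" using b(2) im by blast
    have "{v. \<psi> \<beta> v \<noteq> 0} = \<sigma>"
    proof safe
      fix v assume "\<psi> \<beta> v \<noteq> 0"
      then have v: "v \<in> \<Union>\<Delta>" "\<beta> (f v) \<noteq> 0" by (auto simp: \<psi>_def split: if_splits)
      then obtain u where u: "u \<in> \<sigma>" "f v = f u" using \<sigma>(2) by blast
      then have "u = v" using gf[of u] gf[of v] v(1) \<sigma>(1) by (metis UnionI)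
      with u show "v \<in> \<sigma>" by simp
    next
      fix v assume v: "v \<in> \<sigma>" "\<psi> \<beta> v = 0"
      then have "v \<in> \<Union>\<Delta>" "\<beta> (f v) \<noteq> 0" using \<sigma> by blast+
      with v show False by (simp add: \<psi>_def)
    qed
    moreover have "sum (\<psi> \<beta>) (\<Union>\<Delta>) = sum \<beta> (\<Union>\<Sigma>)"
      unfolding sum.reindex_bij_betw[OF bij, of \<beta>, symmetric] by (simp add: \<psi>_def)
    ultimately show ?thesis
      using b \<sigma>(1) by (subst geometric_realization_points[OF V order_refl]) (auto simp: \<psi>_def)
  qed
  have "homeomorphic_maps (geometric_realization \<Delta>) (geometric_realization \<Sigma>) \<phi> \<psi>"
    unfolding homeomorphic_maps_def continuous_map_geometric_realization
  proof (intro conjI allI ballI)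
    show "continuous_map (geometric_realization \<Delta>) euclideanreal (\<lambda>\<alpha>. \<phi> \<alpha> w)" for w
      unfolding \<phi>_def by (cases "w \<in> \<Union>\<Sigma>") (simp_all add: continuous_map_barycentric_coordinate)
    show "continuous_map (geometric_realization \<Sigma>) euclideanreal (\<lambda>\<alpha>. \<psi> \<alpha> v)" for v
      unfolding \<psi>_def by (cases "v \<in> \<Union>\<Delta>") (simp_all add: continuous_map_barycentric_coordinate)
    show "\<psi> (\<phi> \<alpha>) = \<alpha>" if "\<alpha> \<in> topspace (geometric_realization \<Delta>)" for \<alpha>
    proof
      fix v
      have "\<alpha> v = 0" if "v \<notin> \<Union>\<Delta>"
        using \<open>\<alpha> \<in> _\<close> that geometric_realization_points[OF V order_refl, of \<alpha>] by blast
      then show "\<psi> (\<phi> \<alpha>) v = \<alpha> v"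
        using gf[of v] fS[of v] by (auto simp: \<phi>_def \<psi>_def)
    qed
    show "\<phi> (\<psi> \<beta>) = \<beta>" if "\<beta> \<in> topspace (geometric_realization \<Sigma>)" for \<beta>
    proof
      fix w
      have "\<beta> w = 0" if "w \<notin> \<Union>\<Sigma>"
        using \<open>\<beta> \<in> _\<close> that geometric_realization_points[OF W order_refl, of \<beta>] by blast
      then show "\<phi> (\<psi> \<beta>) w = \<beta> w"
        using fg[of w] gS[of w] by (auto simp: \<phi>_def \<psi>_def)
    qed
  qed (use \<phi> \<psi> in auto)
  then show ?thesis unfolding homeomorphic_space_def by blast
qed

lemma Union_complex_join:
  assumes "finite_complex \<Delta>" "finite_complex \<Sigma>"
  shows "\<Union>(\<Delta> \<star>\<^sub>C \<Sigma>) = \<Union>\<Delta> <+> \<Union>\<Sigma>"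
proof -
  have e: "{} \<in> \<Delta>" "{} \<in> \<Sigma>" using assms by (auto simp: finite_complex_def)
  show ?thesis
  proof
    show "\<Union>(\<Delta> \<star>\<^sub>C \<Sigma>) \<subseteq> \<Union>\<Delta> <+> \<Union>\<Sigma>"
      unfolding complex_join_def by auto
    have "Inl v \<in> \<Union>(\<Delta> \<star>\<^sub>C \<Sigma>)" if "v \<in> \<sigma>" "\<sigma> \<in> \<Delta>" for v \<sigma>
      unfolding complex_join_def by (rule UnionI[of "\<sigma> <+> {}"]) (use that e in auto)
    moreover have "Inr v \<in> \<Union>(\<Delta> \<star>\<^sub>C \<Sigma>)" if "v \<in> \<sigma>" "\<sigma> \<in> \<Sigma>" for v \<sigma>
      unfolding complex_join_def by (rule UnionI[of "{} <+> \<sigma>"]) (use that e in auto)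
    ultimately show "\<Union>\<Delta> <+> \<Union>\<Sigma> \<subseteq> \<Union>(\<Delta> \<star>\<^sub>C \<Sigma>)"
      by (intro subsetI) (elim PlusE UnionE, simp_all)
  qed
qed

text \<open>
  The map \<open>(x, y, t) \<mapsto> (1 - t) x + t y\<close> is a continuous surjection from a compact space to a Hausdorff
  space, so it is a quotient map. The weight on the vertices of \<open>\<Sigma>\<close> recovers \<open>t\<close>, and \<open>x\<close> and \<open>y\<close> are
  recovered unless their weight is zero; hence its fibres are the classes of the join relation.
\<close>

lemma geometric_realization_join:
  assumes fin: "finite_complex \<Delta>" "finite_complex \<Sigma>"
    and X: "X homeomorphic_space geometric_realization \<Delta>" "compact_space X" "topspace X \<noteq> {}"
    and Y: "Y homeomorphic_space geometric_realization \<Sigma>" "compact_space Y" "topspace Y \<noteq> {}"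
  shows "geometric_realization (\<Delta> \<star>\<^sub>C \<Sigma>) homeomorphic_space X \<star>\<^sub>T Y"
proof -
  obtain f where f: "homeomorphic_map X (geometric_realization \<Delta>) f"
    using X(1) homeomorphic_space by blast
  obtain g where g: "homeomorphic_map Y (geometric_realization \<Sigma>) g"
    using Y(1) homeomorphic_space by blast
  have fc: "continuous_map X (geometric_realization \<Delta>) f"
    and fs: "f ` topspace X = topspace (geometric_realization \<Delta>)" and fi: "inj_on f (topspace X)"
    using f by (auto simp: homeomorphic_eq_everything_map)
  have gc: "continuous_map Y (geometric_realization \<Sigma>) g"
    and gs: "g ` topspace Y = topspace (geometric_realization \<Sigma>)" and gi: "inj_on g (topspace Y)"
    using g by (auto simp: homeomorphic_eq_everything_map)
  define V where "V = \<Union>\<Delta>"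
  define W where "W = \<Union>\<Sigma>"
  have finV: "finite V" and finW: "finite W"
    using fin by (auto simp: finite_complex_def V_def W_def)
  have VW: "finite (V <+> W)" "\<Union>(\<Delta> \<star>\<^sub>C \<Sigma>) \<subseteq> V <+> W"
    using finV finW Union_complex_join[OF fin] by (auto simp: V_def W_def)
  note ptsD = geometric_realization_points[OF finV, of \<Delta>, unfolded V_def, OF order_refl, folded V_def]
  note ptsS = geometric_realization_points[OF finW, of \<Sigma>, unfolded W_def, OF order_refl, folded W_def]
  note ptsJ = geometric_realization_points[OF VW]
  have sumJ: "sum \<gamma> (V <+> W) = (\<Sum>v\<in>V. \<gamma> (Inl v)) + (\<Sum>w\<in>W. \<gamma> (Inr w))"
    for \<gamma> :: "'a + 'b \<Rightarrow> real"
    using finV finW by (simp add: sum.Plus o_def)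
  have e: "{} \<in> \<Delta>" "{} \<in> \<Sigma>" using fin by (auto simp: finite_complex_def)
  let ?P = "prod_topology X (prod_topology Y (top_of_set {0..1::real}))"
  let ?J = "geometric_realization (\<Delta> \<star>\<^sub>C \<Sigma>)"
  define q where "q = (\<lambda>(x, y, t). case_sum (\<lambda>v. (1 - t) * f x v) (\<lambda>w. t * g y w))"
  have fD: "(\<forall>v. 0 \<le> f x v) \<and> {v. f x v \<noteq> 0} \<in> \<Delta> \<and> sum (f x) V = 1" if "x \<in> topspace X" for x
    using that fs ptsD by blast
  have gD: "(\<forall>v. 0 \<le> g x v) \<and> {v. g x v \<noteq> 0} \<in> \<Sigma> \<and> sum (g x) W = 1" if "x \<in> topspace Y" for x
    using that gs ptsS by blast
  have q_into: "q (x, y, t) \<in> topspace ?J"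
    if x: "x \<in> topspace X" and y: "y \<in> topspace Y" and t: "0 \<le> t" "t \<le> 1" for x y t
  proof -
    note fx = fD[OF x] and gy = gD[OF y]
    have "{z. q (x, y, t) z \<noteq> 0} =
        (if t = 1 then {} else {v. f x v \<noteq> 0}) <+> (if t = 0 then {} else {w. g y w \<noteq> 0})"
      by (rule set_eqI, rename_tac z, case_tac z) (auto simp: q_def)
    then have "{z. q (x, y, t) z \<noteq> 0} \<in> \<Delta> \<star>\<^sub>C \<Sigma>"
      unfolding complex_join_def using fx gy e by auto
    moreover have "0 \<le> q (x, y, t) z" for z
      using fx gy t by (cases z) (auto simp: q_def)
    moreover have "sum (q (x, y, t)) (V <+> W) = 1"
      using fx gy by (simp add: sumJ q_def sum_distrib_left[symmetric])
    ultimately show ?thesis by (simp add: ptsJ)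
  qed
  have qc: "continuous_map ?P ?J q"
    unfolding continuous_map_geometric_realization
  proof (intro conjI allI)
    have t: "continuous_map ?P euclideanreal (\<lambda>z. snd (snd z))"
      using continuous_map_compose[OF continuous_map_snd continuous_map_snd, of X Y "top_of_set {0..1::real}"]
      by (simp add: o_def continuous_map_in_subtopology)
    have fx: "continuous_map ?P euclideanreal (\<lambda>z. f (fst z) v)" for v
      using continuous_map_compose[OF continuous_map_compose[OF continuous_map_fst fc]
          continuous_map_barycentric_coordinate] by (simp add: o_def)
    have gy: "continuous_map ?P euclideanreal (\<lambda>z. g (fst (snd z)) v)" for v
      using continuous_map_compose[OF continuous_map_compose[OF continuous_map_compose[OF
            continuous_map_snd continuous_map_fst] gc]
          continuous_map_barycentric_coordinate] by (simp add: o_def)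
    show "continuous_map ?P euclideanreal (\<lambda>z. q z u)" for u
    proof (cases u)
      case (Inl v)
      have "continuous_map ?P euclideanreal (\<lambda>z. (1 - snd (snd z)) * f (fst z) v)"
        by (intro continuous_intros t fx)
      then show ?thesis by (simp add: Inl q_def case_prod_beta)
    next
      case (Inr w)
      have "continuous_map ?P euclideanreal (\<lambda>z. snd (snd z) * g (fst (snd z)) w)"
        by (intro continuous_intros t gy)
      then show ?thesis by (simp add: Inr q_def case_prod_beta)
    qed
    show "q \<in> topspace ?P \<rightarrow> topspace ?J" using q_into by auto
  qed
  have q_onto: "\<exists>z \<in> topspace ?P. q z = \<gamma>" if \<gamma>: "\<gamma> \<in> topspace ?J" for \<gamma>
  proof -
    have pos: "\<And>z. 0 \<le> \<gamma> z" and su: "{z. \<gamma> z \<noteq> 0} \<in> \<Delta> \<star>\<^sub>C \<Sigma>" and one: "sum \<gamma> (V <+> W) = 1"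
      using \<gamma> ptsJ by blast+
    obtain \<tau> \<sigma> where \<tau>\<sigma>: "\<tau> \<in> \<Delta>" "\<sigma> \<in> \<Sigma>" "{z. \<gamma> z \<noteq> 0} = \<tau> <+> \<sigma>"
      using su unfolding complex_join_def by blast
    have sl: "{v. \<gamma> (Inl v) \<noteq> 0} = \<tau>" and sr: "{w. \<gamma> (Inr w) \<noteq> 0} = \<sigma>"
      using \<tau>\<sigma>(3) by auto
    define a where "a = (\<Sum>v\<in>V. \<gamma> (Inl v))"
    define b where "b = (\<Sum>w\<in>W. \<gamma> (Inr w))"
    have ab: "a + b = 1" "0 \<le> a" "0 \<le> b"
      using one pos by (auto simp: a_def b_def sumJ intro: sum_nonneg)
    have a0: "\<gamma> (Inl v) = 0" if "a = 0" for v
    proof (cases "v \<in> V")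
      case True
      then show ?thesis using that pos finV unfolding a_def by (simp add: sum_nonneg_eq_0_iff)
    next
      case False
      then show ?thesis using sl \<tau>\<sigma>(1) unfolding V_def by blast
    qed
    have b0: "\<gamma> (Inr v) = 0" if "b = 0" for v
    proof (cases "v \<in> W")
      case True
      then show ?thesis using that pos finW unfolding b_def by (simp add: sum_nonneg_eq_0_iff)
    next
      case False
      then show ?thesis using sr \<tau>\<sigma>(2) unfolding W_def by blast
    qed
    obtain x where x: "x \<in> topspace X" "\<And>v. a * f x v = \<gamma> (Inl v)"
    proof (cases "a = 0")
      case True
      obtain x0 where "x0 \<in> topspace X" using X(3) by (metis ex_in_conv)
      then show thesis using that[of x0] a0 True by simp
    next
      case False
      have "(\<lambda>v. \<gamma> (Inl v) / a) \<in> topspace (geometric_realization \<Delta>)"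
        using False ab pos sl \<tau>\<sigma>(1)
        by (simp add: ptsD sum_divide_distrib[symmetric] a_def[symmetric])
      then obtain x where "x \<in> topspace X" "f x = (\<lambda>v. \<gamma> (Inl v) / a)" using fs by (metis imageE)
      then show thesis using that False by simp
    qed
    obtain y where y: "y \<in> topspace Y" "\<And>w. b * g y w = \<gamma> (Inr w)"
    proof (cases "b = 0")
      case True
      obtain y0 where "y0 \<in> topspace Y" using Y(3) by (metis ex_in_conv)
      then show thesis using that[of y0] b0 True by simp
    next
      case False
      have "(\<lambda>v. \<gamma> (Inr v) / b) \<in> topspace (geometric_realization \<Sigma>)"
        using False ab pos sr \<tau>\<sigma>(2)
        by (simp add: ptsS sum_divide_distrib[symmetric] b_def[symmetric])
      then obtain x where "x \<in> topspace Y" "g x = (\<lambda>v. \<gamma> (Inr v) / b)" using gs by (metis imageE)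
      then show thesis using that False by simp
    qed
    have "1 - b = a" using ab by simp
    then have "q (x, y, b) = \<gamma>"
      by (intro ext) (auto simp: q_def x y split: sum.split)
    moreover have "(x, y, b) \<in> topspace ?P" using x y ab by auto
    ultimately show ?thesis by blast
  qed
  have qq: "quotient_map ?P ?J q"
  proof (rule T1_Spaces.continuous_imp_quotient_map[OF qc])
    show "compact_space ?P"
      using X(2) Y(2) by (simp add: compact_space_prod_topology compact_space_subtopology)
    show "q ` topspace ?P = topspace ?J"
      using q_onto continuous_map_image_subset_topspace[OF qc] by blast
  qed (rule Hausdorff_geometric_realization)
  have fibre: "q (x, y, t) = q (x', y', t') \<longleftrightarrow>
      t = t' \<and> (x = x' \<and> y = y' \<or> t = 0 \<and> x = x' \<or> t = 1 \<and> y = y')"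
    (is "?l \<longleftrightarrow> ?r")
    if x: "x \<in> topspace X" "x' \<in> topspace X" and y: "y \<in> topspace Y" "y' \<in> topspace Y"
    for x y t x' y' t'
  proof
    assume eq: ?l
    have l: "(1 - t) * f x v = (1 - t') * f x' v" for v
      using fun_cong[OF eq, of "Inl v"] by (simp add: q_def)
    have r: "t * g y w = t' * g y' w" for w
      using fun_cong[OF eq, of "Inr w"] by (simp add: q_def)
    have "t * sum (g y) W = t' * sum (g y') W" by (simp add: sum_distrib_left r)
    then have t: "t = t'" using gD y by simp
    have "x = x'" if "t \<noteq> 1"
    proof -
      have "f x = f x'" using l that t by auto
      then show ?thesis using fi x by (simp add: inj_on_def)
    qed
    moreover have "y = y'" if "t \<noteq> 0"
    proof -
      have "g y = g y'" using r that t by auto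
      then show ?thesis using gi y by (simp add: inj_on_def)
    qed
    ultimately show ?r using t by force
  next
    assume ?r
    then show ?l by (auto simp: q_def)
  qed
  have "join_relation X Y = {(z, z'). z \<in> topspace ?P \<and> z' \<in> topspace ?P \<and> q z = q z'}"
    unfolding join_relation_def using fibre by auto
  then show ?thesis
    unfolding topological_join_def by (rule quotient_topology_homeomorphic_space[OF qq])
qed

section \<open>Realizations of points, paths and cycles\<close>

lemma finite_complex_graph_complex:
  assumes "finite_simple_graph G"
  shows "finite_complex (graph_complex G)"
proof -
  have fin: "finite (verts G)" and sub: "\<And>e. e \<in> edges G \<Longrightarrow> e \<subseteq> verts G \<and> card e = 2"
    using assms by (auto simp: finite_simple_graph_def)
  have fe: "finite (edges G)"
    using sub fin by (intro finite_subset[OF _ finite_Pow_iff[THEN iffD2, OF fin]]) auto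
  have "\<tau> \<in> graph_complex G" if e: "e \<in> edges G" and \<tau>: "\<tau> \<subseteq> e" for e \<tau>
  proof -
    obtain u v where uv: "e = {u, v}" using sub[OF e] by (auto simp: card_2_iff)
    then have "\<tau> = {} \<or> \<tau> = {u} \<or> \<tau> = {v} \<or> \<tau> = e" using \<tau> by auto
    then show ?thesis using e sub[OF e] uv by (auto simp: graph_complex_def)
  qed
  moreover have "\<tau> \<in> graph_complex G" if "v \<in> verts G" "\<tau> \<subseteq> {v}" for v \<tau>
    using that by (auto simp: graph_complex_def subset_singleton_iff)
  ultimately show ?thesis
    using fin fe sub finite_subset[OF _ fin]
    unfolding finite_complex_def by (auto simp: graph_complex_def)
qed

lemma Union_graph_complex:
  assumes "finite_simple_graph G"
  shows "\<Union>(graph_complex G) = verts G"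
  using assms unfolding graph_complex_def finite_simple_graph_def by blast

text \<open>
  The point that divides the edge from \<open>u\<close> to \<open>v\<close> in the ratio \<open>s : 1 - s\<close>.
\<close>

definition edge_point :: "'a \<Rightarrow> 'a \<Rightarrow> real \<Rightarrow> 'a \<Rightarrow> real" where
  "edge_point u v s = (\<lambda>w. if w = u then 1 - s else if w = v then s else 0)"

lemma edge_point_commute: "u \<noteq> v \<Longrightarrow> edge_point u v s = edge_point v u (1 - s)"
  by (auto simp: edge_point_def)

lemma topspace_realization_graph:
  assumes G: "finite_simple_graph G" "no_isolated_vertices G"
  shows "topspace (geometric_realization (graph_complex G)) =
    {edge_point u v s | u v s. {u, v} \<in> edges G \<and> 0 \<le> s \<and> s \<le> 1}" (is "?T = ?E")
proof
  have sub: "e \<subseteq> verts G" "card e = 2" if "e \<in> edges G" for e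
    using that G(1) by (auto simp: finite_simple_graph_def)
  show "?T \<subseteq> ?E"
  proof
    fix \<alpha> assume "\<alpha> \<in> ?T"
    then have pos: "\<And>v. 0 \<le> \<alpha> v" and su: "{v. \<alpha> v \<noteq> 0} \<in> graph_complex G"
      and one: "(\<Sum>v | \<alpha> v \<noteq> 0. \<alpha> v) = 1"
      by (auto simp: topspace_geometric_realization)
    from su consider "{v. \<alpha> v \<noteq> 0} = {}" | v where "{v. \<alpha> v \<noteq> 0} = {v}" "v \<in> verts G"
      | "{v. \<alpha> v \<noteq> 0} \<in> edges G"
      unfolding graph_complex_def by blast
    then show "\<alpha> \<in> ?E"
    proof cases
      case 1
      with one show ?thesis by simp
    next
      case (2 v)
      then obtain e where e: "e \<in> edges G" "v \<in> e"
        using G(2) by (auto simp: no_isolated_vertices_def)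
      then obtain w where w: "e = {v, w}" "v \<noteq> w"
        using sub(2)[OF e(1)] by (auto simp: card_2_iff)
      have "\<alpha> v = 1" using one 2(1) by simp
      moreover have "\<alpha> u = 0" if "u \<noteq> v" for u using 2(1) that by blast
      ultimately have "\<alpha> = edge_point v w 0" by (auto simp: edge_point_def)
      then show ?thesis using e w by force
    next
      case 3
      then obtain u v where uv: "{v. \<alpha> v \<noteq> 0} = {u, v}" "u \<noteq> v"
        using sub(2)[OF 3] by (auto simp: card_2_iff)
      have *: "\<alpha> u + \<alpha> v = 1" using one uv by simp
      moreover have "\<alpha> w = 0" if "w \<noteq> u" "w \<noteq> v" for w using uv(1) that by blast
      ultimately have "\<alpha> = edge_point u v (\<alpha> v)" by (auto simp: edge_point_def)
      moreover have "0 \<le> \<alpha> v \<and> \<alpha> v \<le> 1" using * pos[of u] pos[of v] by simp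
      ultimately show ?thesis using 3 uv by auto
    qed
  qed
  show "?E \<subseteq> ?T"
  proof
    fix \<alpha> assume "\<alpha> \<in> ?E"
    then obtain u v s where a: "\<alpha> = edge_point u v s" and e: "{u, v} \<in> edges G"
      and s: "0 \<le> s" "s \<le> 1" by blast
    have uv: "u \<noteq> v" "u \<in> verts G" "v \<in> verts G" using sub[OF e] by auto
    have supp: "{w. \<alpha> w \<noteq> 0} = (if s = 0 then {u} else if s = 1 then {v} else {u, v})"
      using uv by (auto simp: a edge_point_def)
    then have "{w. \<alpha> w \<noteq> 0} \<in> graph_complex G"
      using uv e by (auto simp: graph_complex_def)
    moreover have "(\<Sum>w | \<alpha> w \<noteq> 0. \<alpha> w) = 1"
      unfolding supp using uv by (auto simp: a edge_point_def)
    moreover have "\<forall>w. 0 \<le> \<alpha> w" using s by (auto simp: a edge_point_def)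
    ultimately show "\<alpha> \<in> ?T" by (simp add: topspace_geometric_realization)
  qed
qed

text \<open>
  The barycentric coordinate at the vertex \<open>i\<close> of the real line, subdivided at the integers.
\<close>

definition hat :: "nat \<Rightarrow> real \<Rightarrow> real" where
  "hat i t = max 0 (1 - \<bar>t - real i\<bar>)"

lemma continuous_map_hat: "continuous_map (top_of_set S) euclideanreal (hat i)"
  unfolding hat_def by (auto intro!: continuous_intros)

lemma hat_cell:
  assumes "0 \<le> s" "s \<le> 1"
  shows "hat i (real k + s) = (if i = k then 1 - s else if i = k + 1 then s else 0)"
proof -
  consider "i = k" | "i = k + 1" | "i < k" | "i > k + 1" by linarith
  then show ?thesis
  proof cases
    case 3
    then have "real i + 1 \<le> real k" by linarith
    with 3 assms show ?thesis by (simp add: hat_def)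
  next
    case 4
    then have "real i \<ge> real k + 2" by linarith
    with 4 assms show ?thesis by (simp add: hat_def)
  qed (use assms in \<open>auto simp: hat_def\<close>)
qed

lemma obtain_cell:
  fixes t :: real
  assumes "0 \<le> t" "t \<le> real N" "0 < N"
  obtains k s where "t = real k + s" "k < N" "0 \<le> s" "s \<le> 1"
proof (cases "t = real N")
  case True
  then show thesis using that[of "N - 1" 1] assms by (simp add: of_nat_diff)
next
  case False
  define k where "k = nat \<lfloor>t\<rfloor>"
  have k: "real k \<le> t" "t < real k + 1" using assms(1) by (simp_all add: k_def)
  moreover have "k < N" using k(1) assms(2) False by linarith
  ultimately show thesis using that[of k "t - real k"] by simp
qed

text \<open>
  The hats at \<open>\<lfloor>t\<rfloor>\<close> and at the next integer suffice: the first gives the distance to \<open>\<lfloor>t\<rfloor>\<close>, the second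
  the side on which the point lies.
\<close>

lemma hats_determine_point:
  assumes eq: "\<And>i. a \<le> i \<Longrightarrow> i \<le> b \<Longrightarrow> hat i t = hat i t'"
    and t: "real a \<le> t" "t \<le> real b"
  shows "t = t'"
proof -
  define k where "k = nat \<lfloor>t\<rfloor>"
  have k: "real k \<le> t" "t < real k + 1" using t(1) by (simp_all add: k_def)
  then have ab: "a \<le> k" "k \<le> b" using t by linarith+
  have "hat k t = hat k t'" using eq ab by blast
  then have 1: "\<bar>t' - real k\<bar> = t - real k" using k by (simp add: hat_def max_def split: if_splits)
  show ?thesis
  proof (rule ccontr)
    assume ne: "t \<noteq> t'"
    with 1 have lt: "real k < t" "t' \<le> real k" by (auto simp: abs_if split: if_splits)
    then have "k + 1 \<le> b" using t by linarith
    then have "hat (k + 1) t = hat (k + 1) t'" using eq ab by simp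
    with lt k show False by (simp add: hat_def max_def split: if_splits)
  qed
qed

lemma nball_alt:
  "nball n = subtopology (powertop_real UNIV) {x. (\<forall>i\<ge>n. x i = 0) \<and> (\<Sum>i<n. x i ^ 2) \<le> 1}"
  by (simp add: nball_def Euclidean_space_def subtopology_subtopology Collect_conj_eq)

lemma Hausdorff_nball: "Hausdorff_space (nball n)"
  unfolding nball_def by (intro Hausdorff_space_subtopology Hausdorff_Euclidean_space)

lemma Hausdorff_nsphere: "Hausdorff_space (nsphere n)"
  unfolding nsphere_def by (intro Hausdorff_space_subtopology Hausdorff_Euclidean_space)

lemma continuous_map_nball:
  "continuous_map X (nball n) f \<longleftrightarrow>
     (\<forall>i. continuous_map X euclideanreal (\<lambda>x. f x i)) \<and> f \<in> topspace X \<rightarrow> topspace (nball n)"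
  by (simp add: nball_alt continuous_map_in_subtopology continuous_map_componentwise_UNIV)

lemma continuous_map_nsphere:
  "continuous_map X (nsphere n) f \<longleftrightarrow>
     (\<forall>i. continuous_map X euclideanreal (\<lambda>x. f x i)) \<and> f \<in> topspace X \<rightarrow> topspace (nsphere n)"
  by (simp add: nsphere continuous_map_in_subtopology continuous_map_componentwise_UNIV)

lemma compact_space_quotient_image:
  assumes "quotient_map X Y f" "compact_space X"
  shows "compact_space Y"
  using assms image_compactin[of X "topspace X" Y f]
  by (simp add: compact_space_def quotient_imp_continuous_map quotient_imp_surjective_map)

lemma interval_onto_nball_1:
  fixes r :: real
  assumes r: "0 < r"
  obtains b where "quotient_map (top_of_set {0..r}) (nball 1) b" "inj_on b {0..r}"
proof
  let ?I = "top_of_set {0..r}"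
  let ?b = "\<lambda>t i. if i = (0::nat) then 2 * t / r - 1 else 0"
  have onto_b: "?b ` topspace ?I = topspace (nball 1)"
  proof safe
    fix t assume "t \<in> topspace ?I"
    then have "0 \<le> t" "t \<le> r" by auto
    then have "\<bar>2 * t / r - 1\<bar> \<le> 1" using r by (simp add: field_simps abs_le_iff)
    then show "?b t \<in> topspace (nball 1)" by (simp add: nball_alt abs_square_le_1)
  next
    fix x assume "x \<in> topspace (nball 1)"
    then have x: "\<And>i. 1 \<le> i \<Longrightarrow> x i = 0" "\<bar>x 0\<bar> \<le> 1" by (auto simp: nball_alt abs_square_le_1)
    let ?t = "(x 0 + 1) * r / 2"
    have "x = ?b ?t" using x(1) r by (intro ext) auto
    moreover have "0 \<le> (x 0 + 1) * r" "(x 0 + 1) * r \<le> 2 * r"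
      using x(2) r by (auto intro!: mult_nonneg_nonneg mult_right_mono)
    then have "?t \<in> topspace ?I" by simp
    ultimately show "x \<in> ?b ` topspace ?I" by blast
  qed
  have "continuous_map ?I euclideanreal (\<lambda>t. ?b t i)" for i
    using r by (cases "i = 0") (auto intro!: continuous_intros)
  then have "continuous_map ?I (nball 1) ?b"
    unfolding continuous_map_nball using onto_b by auto
  then show "quotient_map ?I (nball 1) ?b"
    by (rule T1_Spaces.continuous_imp_quotient_map)
      (use onto_b in \<open>auto simp: compact_space_subtopology Hausdorff_nball\<close>)
  show "inj_on ?b {0..r}"
  proof (rule inj_onI)
    fix t t' assume "?b t = ?b t'"
    then show "t = t'" using r fun_cong[of "?b t" "?b t'" 0] by simp
  qed
qed

lemma interval_onto_nsphere_1:
  fixes r :: real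
  assumes r: "0 < r"
  obtains c where "quotient_map (top_of_set {0..r}) (nsphere 1) c"
    "\<And>t t'. t \<in> {0..r} \<Longrightarrow> t' \<in> {0..r} \<Longrightarrow>
       c t = c t' \<longleftrightarrow> t = t' \<or> t = 0 \<and> t' = r \<or> t' = 0 \<and> t = r"
proof
  let ?I = "top_of_set {0..r}"
  define c where "c t i = (if i = 0 then cos (2 * pi * t / r) else if i = 1 then sin (2 * pi * t / r) else 0)"
    for t and i :: nat
  have tops: "topspace (nsphere 1) = {x. (\<forall>i\<ge>2. x i = 0) \<and> x 0 ^ 2 + x 1 ^ 2 = 1}"
    by (auto simp: nsphere numeral_2_eq_2 Suc_le_eq)
  have onto_c: "c ` topspace ?I = topspace (nsphere 1)"
  proof safe
    fix t assume "t \<in> topspace ?I"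
    show "c t \<in> topspace (nsphere 1)" unfolding tops by (simp add: c_def)
  next
    fix x assume "x \<in> topspace (nsphere 1)"
    then have x: "\<And>i. 2 \<le> i \<Longrightarrow> x i = 0" "x 0 ^ 2 + x 1 ^ 2 = 1" unfolding tops by auto
    then obtain \<theta> where \<theta>: "0 \<le> \<theta>" "\<theta> < 2 * pi" "x 0 = cos \<theta>" "x 1 = sin \<theta>"
      using sincos_total_2pi by metis
    let ?t = "\<theta> * r / (2 * pi)"
    have "2 * pi * ?t / r = \<theta>" using r by simp
    then have "x = c ?t" using x(1) \<theta> by (intro ext) (auto simp: c_def)
    moreover have "?t \<in> topspace ?I" using \<theta> r by (auto simp: field_simps)
    ultimately show "x \<in> c ` topspace ?I" by blast
  qed
  have "continuous_map ?I euclideanreal (\<lambda>t. c t i)" for i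
    unfolding c_def using r by (cases "i = 0"; cases "i = 1") (auto intro!: continuous_intros)
  then have "continuous_map ?I (nsphere 1) c"
    unfolding continuous_map_nsphere using onto_c by auto
  then show "quotient_map ?I (nsphere 1) c"
    by (rule T1_Spaces.continuous_imp_quotient_map)
      (use onto_c in \<open>auto simp: compact_space_subtopology Hausdorff_nsphere\<close>)
  fix t t' assume t: "t \<in> {0..r}" "t' \<in> {0..r}"
  have "c 0 = c r" using r by (intro ext) (auto simp: c_def)
  moreover have "t = t' \<or> t = 0 \<and> t' = r \<or> t' = 0 \<and> t = r" if eq: "c t = c t'"
  proof -
    have "cos (2 * pi * t / r) = cos (2 * pi * t' / r)" "sin (2 * pi * t / r) = sin (2 * pi * t' / r)"
      using fun_cong[OF eq, of 0] fun_cong[OF eq, of 1] by (auto simp: c_def)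
    then obtain k :: int where "2 * pi * t / r = 2 * pi * t' / r + 2 * pi * k"
      using sin_cos_eq_iff by metis
    then have "2 * pi * t = 2 * pi * (t' + k * r)" using r by (simp add: field_simps)
    then have k: "t = t' + k * r" by simp
    have "\<bar>real_of_int k * r\<bar> \<le> 1 * r" using k t by auto
    then have "\<bar>real_of_int k\<bar> \<le> 1" using r by (simp add: abs_mult)
    then have "k = 0 \<or> k = 1 \<or> k = - 1" by linarith
    then show ?thesis using k t by auto
  qed
  ultimately show "c t = c t' \<longleftrightarrow> t = t' \<or> t = 0 \<and> t' = r \<or> t' = 0 \<and> t = r" by metis
qed

lemma path_graph_simple:
  "finite_simple_graph (path_graph n)" "2 \<le> n \<Longrightarrow> no_isolated_vertices (path_graph n)"
proof -
  show "finite_simple_graph (path_graph n)"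
    by (auto simp: finite_simple_graph_def path_graph_def)
  show "no_isolated_vertices (path_graph n)" if "2 \<le> n"
    unfolding no_isolated_vertices_def
  proof
    fix v assume "v \<in> verts (path_graph n)"
    then have "v < n" by (simp add: path_graph_def)
    show "\<exists>e\<in>edges (path_graph n). v \<in> e"
    proof (cases "v + 1 < n")
      case True
      then have "{v, v + 1} \<in> edges (path_graph n)" unfolding path_graph_def by auto
      then show ?thesis by blast
    next
      case False
      then have v: "0 < v" "v - 1 + 1 < n" using \<open>v < n\<close> that by auto
      then have "{v - 1, v - 1 + 1} \<in> edges (path_graph n)" unfolding path_graph_def by auto
      moreover have "v \<in> {v - 1, v - 1 + 1}" using v(1) by simp
      ultimately show ?thesis by (rule rev_bexI)
    qed
  qed
qed

lemma cycle_graph_simple: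
  assumes "3 \<le> n"
  shows "finite_simple_graph (cycle_graph n)" "no_isolated_vertices (cycle_graph n)"
proof -
  have step: "(i + 1) mod n < n" "(i + 1) mod n \<noteq> i" if "i < n" for i
  proof -
    have "(i + 1) mod n = (if i + 1 = n then 0 else i + 1)" using that by simp
    then show "(i + 1) mod n < n" "(i + 1) mod n \<noteq> i" using that assms by (auto split: if_splits)
  qed
  show "finite_simple_graph (cycle_graph n)"
    unfolding finite_simple_graph_def
  proof (intro conjI ballI)
    fix e assume "e \<in> edges (cycle_graph n)"
    then obtain i where i: "i < n" "e = {i, (i + 1) mod n}" by (auto simp: cycle_graph_def)
    show "e \<subseteq> verts (cycle_graph n)" "card e = 2"
      using i(1) step[OF i(1)] unfolding i(2) cycle_graph_def by (simp_all add: card_insert_if)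
  qed (simp add: cycle_graph_def)
  show "no_isolated_vertices (cycle_graph n)"
    unfolding no_isolated_vertices_def
  proof
    fix v assume "v \<in> verts (cycle_graph n)"
    then have "{v, (v + 1) mod n} \<in> edges (cycle_graph n)" unfolding cycle_graph_def by auto
    then show "\<exists>e\<in>edges (cycle_graph n). v \<in> e" by blast
  qed
qed

text \<open>
  The realization and the ball are compared as quotients of the interval \<open>[0, n - 1]\<close>, the former by its
  hat functions. This avoids writing down an inverse map.
\<close>

lemma realization_path_graph:
  assumes "2 \<le> n"
  shows "geometric_realization (graph_complex (path_graph n)) homeomorphic_space nball 1"
proof -
  define N where "N = n - 1"
  have N: "0 < N" "n = N + 1" using assms by (auto simp: N_def)
  let ?R = "geometric_realization (graph_complex (path_graph n))"
  let ?I = "top_of_set {0..real N}"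
  define p where "p t i = (if i \<le> N then hat i t else 0)" for t i
  have cell: "p (real k + s) = edge_point k (k + 1) s" if "k < N" "0 \<le> s" "s \<le> 1" for k s
    using that by (auto simp: p_def hat_cell edge_point_def)
  have R: "topspace ?R = {edge_point u v s | u v s. {u, v} \<in> edges (path_graph n) \<and> 0 \<le> s \<and> s \<le> 1}"
    using topspace_realization_graph path_graph_simple assms by blast
  have onto: "p ` topspace ?I = topspace ?R"
  proof safe
    fix t assume "t \<in> topspace ?I"
    then obtain k s where "t = real k + s" "k < N" "0 \<le> s" "s \<le> 1"
      using obtain_cell[of t N] N by auto
    then show "p t \<in> topspace ?R"
      unfolding R using cell[of k s] N by (force simp: path_graph_def)
  next
    fix \<alpha> assume "\<alpha> \<in> topspace ?R"
    then obtain u v s where a: "\<alpha> = edge_point u v s" "{u, v} \<in> edges (path_graph n)" "0 \<le> s" "s \<le> 1"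
      unfolding R by blast
    then obtain k where "{u, v} = {k, k + 1}" "k < N" using N by (auto simp: path_graph_def)
    then have "k < N" "\<alpha> = edge_point k (k + 1) s \<or> \<alpha> = edge_point k (k + 1) (1 - s)"
      using a edge_point_commute[of u v s] by (auto simp: doubleton_eq_iff)
    then have "\<alpha> = p (real k + s) \<or> \<alpha> = p (real k + (1 - s))"
      using cell[of k s] cell[of k "1 - s"] a(3,4) by auto
    then obtain s' where s': "\<alpha> = p (real k + s')" "0 \<le> s'" "s' \<le> 1" "k < N"
      using a(3,4) \<open>k < N\<close> by force
    moreover have "real k + s' \<in> {0..real N}" using s' by auto
    ultimately show "\<alpha> \<in> p ` topspace ?I" by auto
  qed
  have "continuous_map ?I ?R p"
    unfolding continuous_map_geometric_realization
    using onto continuous_map_hat[of "{0..real N}"] by (auto simp: p_def)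
  then have p: "quotient_map ?I ?R p"
    by (rule T1_Spaces.continuous_imp_quotient_map)
      (auto simp: compact_space_subtopology Hausdorff_geometric_realization onto[simplified])
  obtain b where b: "quotient_map ?I (nball 1) b" "inj_on b {0..real N}"
    using interval_onto_nball_1[of "real N"] N by auto
  show ?thesis
  proof (rule quotient_maps_same_fibres[OF p b(1)])
    fix t t' assume t: "t \<in> topspace ?I" "t' \<in> topspace ?I"
    have "t = t'" if "p t = p t'"
    proof (rule hats_determine_point[of 0 N])
      show "hat i t = hat i t'" if "i \<le> N" for i
        using fun_cong[OF \<open>p t = p t'\<close>, of i] that by (simp add: p_def)
    qed (use t in auto)
    moreover have "t = t'" if "b t = b t'"
      using that t b(2) by (auto dest: inj_onD)
    ultimately show "p t = p t' \<longleftrightarrow> b t = b t'" by blast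
  qed
qed

text \<open>
  Both spaces arise from the interval \<open>[0, n]\<close> by gluing its end points: the polygon by walking once
  around it, the circle by \<open>t \<mapsto> (cos (2 \<pi> t / n), sin (2 \<pi> t / n))\<close>.
\<close>

lemma realization_cycle_graph:
  assumes "3 \<le> n"
  shows "geometric_realization (graph_complex (cycle_graph n)) homeomorphic_space nsphere 1"
proof -
  let ?R = "geometric_realization (graph_complex (cycle_graph n))"
  let ?I = "top_of_set {0..real n}"
  \<comment> \<open>Going once around the polygon; the end point \<open>n\<close> is the start \<open>0\<close>, so its hat is added to that of \<open>0\<close>.\<close>
  define p where "p t i = (if i = 0 then hat 0 t + hat n t else if i < n then hat i t else 0)" for t i
  have cell: "p (real k + s) = edge_point k ((k + 1) mod n) s" if "k < n" "0 \<le> s" "s \<le> 1" for k s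
  proof (cases "k + 1 = n")
    case True
    then have "(k + 1) mod n = 0" by simp
    then show ?thesis
      unfolding p_def hat_cell[OF that(2,3)] edge_point_def using that assms True by auto
  next
    case False
    then have "(k + 1) mod n = k + 1" using that by simp
    then show ?thesis
      unfolding p_def hat_cell[OF that(2,3)] edge_point_def using that assms False by auto
  qed
  have R: "topspace ?R = {edge_point u v s | u v s. {u, v} \<in> edges (cycle_graph n) \<and> 0 \<le> s \<and> s \<le> 1}"
    using topspace_realization_graph cycle_graph_simple[OF assms] by blast
  have onto: "p ` topspace ?I = topspace ?R"
  proof safe
    fix t assume "t \<in> topspace ?I"
    then obtain k s where "t = real k + s" "k < n" "0 \<le> s" "s \<le> 1"
      using obtain_cell[of t n] assms by auto
    then show "p t \<in> topspace ?R"
      unfolding R using cell[of k s] by (force simp: cycle_graph_def)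
  next
    fix \<alpha> assume "\<alpha> \<in> topspace ?R"
    then obtain u v s where a: "\<alpha> = edge_point u v s" "{u, v} \<in> edges (cycle_graph n)" "0 \<le> s" "s \<le> 1"
      unfolding R by blast
    then obtain k where k: "{u, v} = {k, (k + 1) mod n}" "k < n" by (auto simp: cycle_graph_def)
    have "u \<noteq> v" using cycle_graph_simple[OF assms] a(2) by (auto simp: finite_simple_graph_def)
    then have "\<alpha> = edge_point k ((k + 1) mod n) s \<or> \<alpha> = edge_point k ((k + 1) mod n) (1 - s)"
      using a k edge_point_commute[of u v s] by (auto simp: doubleton_eq_iff)
    then have "\<alpha> = p (real k + s) \<or> \<alpha> = p (real k + (1 - s))"
      using cell[of k s] cell[of k "1 - s"] a(3,4) k(2) by auto
    then obtain s' where s': "\<alpha> = p (real k + s')" "0 \<le> s'" "s' \<le> 1"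
      using a(3,4) by force
    moreover have "real k + s' \<in> {0..real n}" using s' k by auto
    ultimately show "\<alpha> \<in> p ` topspace ?I" by auto
  qed
  have "continuous_map ?I euclideanreal (\<lambda>t. p t i)" for i
    unfolding p_def using continuous_map_hat[of "{0..real n}"]
    by (cases "i = 0"; cases "i < n") (auto intro!: continuous_on_add)
  then have "continuous_map ?I ?R p"
    unfolding continuous_map_geometric_realization using onto by auto
  then have p: "quotient_map ?I ?R p"
    by (rule T1_Spaces.continuous_imp_quotient_map)
      (auto simp: compact_space_subtopology Hausdorff_geometric_realization onto[simplified])
  have n: "real n > 0" using assms by simp
  obtain c where c: "quotient_map ?I (nsphere 1) c"
    "\<And>t t'. t \<in> {0..real n} \<Longrightarrow> t' \<in> {0..real n} \<Longrightarrow>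
       c t = c t' \<longleftrightarrow> t = t' \<or> t = 0 \<and> t' = real n \<or> t' = 0 \<and> t = real n"
    using interval_onto_nsphere_1[OF n] by metis
  let ?ends = "\<lambda>t t'. t = 0 \<and> t' = real n"
  have pn: "p 0 = p (real n)"
    using assms by (intro ext) (auto simp: p_def hat_def)
  have pinj: "t = t' \<or> ?ends t t' \<or> ?ends t' t"
    if eq: "p t = p t'" and t: "0 \<le> t" "t \<le> n" "0 \<le> t'" "t' \<le> n" for t t'
  proof -
    have h: "hat i t = hat i t'" if "1 \<le> i" "i \<le> n - 1" for i
      using fun_cong[OF eq, of i] that by (auto simp: p_def split: if_splits)
    have n1: "real (n - 1) = real n - 1" using assms by (simp add: of_nat_diff)
    show ?thesis
    proof (cases "(1 \<le> t \<and> t \<le> real n - 1) \<or> (1 \<le> t' \<and> t' \<le> real n - 1)")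
      case True
      then show ?thesis
        using hats_determine_point[of 1 "n - 1" t t'] hats_determine_point[of 1 "n - 1" t' t] h n1
        by fastforce
    next
      case False
      have 0: "hat 0 t + hat n t = hat 0 t' + hat n t'"
        using fun_cong[OF eq, of 0] by (simp add: p_def)
      have 1: "hat 1 t = hat 1 t'" using h[of 1] assms by simp
      have n3: "real n \<ge> 3" using assms by simp
      show ?thesis
        using False 0 1 t n3 by (auto simp: hat_def max_def not_le split: if_splits)
    qed
  qed
  show ?thesis
  proof (rule quotient_maps_same_fibres[OF p c(1)])
    fix t t' assume t: "t \<in> topspace ?I" "t' \<in> topspace ?I"
    then have "0 \<le> t" "t \<le> n" "0 \<le> t'" "t' \<le> n" by auto
    then have "p t = p t' \<longleftrightarrow> t = t' \<or> ?ends t t' \<or> ?ends t' t"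
      using pinj[of t t'] pn by metis
    then show "p t = p t' \<longleftrightarrow> c t = c t'"
      using c(2)[of t t'] t by simp
  qed
qed

lemma topspace_realization_discrete:
  assumes \<Delta>: "\<Delta> = insert {} ((\<lambda>v. {v}) ` V)"
  shows "topspace (geometric_realization \<Delta>) = (\<lambda>v w. if w = v then 1 else 0) ` V"
proof safe
  fix \<alpha> assume "\<alpha> \<in> topspace (geometric_realization \<Delta>)"
  then have su: "{v. \<alpha> v \<noteq> 0} \<in> \<Delta>" and one: "(\<Sum>v | \<alpha> v \<noteq> 0. \<alpha> v) = 1"
    unfolding topspace_geometric_realization by blast+
  have "{v. \<alpha> v \<noteq> 0} \<noteq> {}" using one by (metis sum.empty zero_neq_one)
  then obtain v where v: "v \<in> V" "{v. \<alpha> v \<noteq> 0} = {v}" using su \<Delta> by blast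
  have "\<alpha> v = 1" using one unfolding v(2) by simp
  moreover have "\<alpha> w = 0" if "w \<noteq> v" for w using v(2) that by blast
  ultimately have "\<alpha> = (\<lambda>w. if w = v then 1 else 0)" by (intro ext) simp
  then show "\<alpha> \<in> (\<lambda>v w. if w = v then 1 else 0) ` V" using v(1) by blast
next
  fix v assume v: "v \<in> V"
  have supp: "{w. (if w = v then 1 else 0) \<noteq> (0::real)} = {v}" by auto
  show "(\<lambda>w. if w = v then 1 else 0) \<in> topspace (geometric_realization \<Delta>)"
    unfolding topspace_geometric_realization mem_Collect_eq supp using v \<Delta> by simp
qed

lemma realization_point:
  "geometric_realization (graph_complex (path_graph 1)) homeomorphic_space nball 0"
proof -
  let ?R = "geometric_realization (graph_complex (path_graph 1))"
  let ?I = "top_of_set {0::real}"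
  have "graph_complex (path_graph 1) = insert {} ((\<lambda>v. {v}) ` {0})"
    by (auto simp: graph_complex_def path_graph_def)
  then have R: "topspace ?R = {\<lambda>i. if i = 0 then 1 else 0}"
    using topspace_realization_discrete by force
  have B: "topspace (nball 0) = {\<lambda>_. 0}" by (auto simp: nball_alt)
  have p: "quotient_map ?I ?R (\<lambda>_ i. if i = 0 then 1 else 0)"
    by (rule T1_Spaces.continuous_imp_quotient_map)
      (auto simp: compact_space_subtopology Hausdorff_geometric_realization
        continuous_map_geometric_realization R simp del: One_nat_def)
  have b: "quotient_map ?I (nball 0) (\<lambda>_ _. 0)"
    by (rule T1_Spaces.continuous_imp_quotient_map)
      (auto simp: compact_space_subtopology Hausdorff_nball continuous_map_nball B)
  show ?thesis by (rule quotient_maps_same_fibres[OF p b]) auto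
qed

text \<open>
  The parameter \<open>- 1\<close> or \<open>1\<close> is the coordinate of the point on the sphere.
\<close>

lemma realization_two_points:
  "geometric_realization (graph_complex (graph_copies 2 (path_graph 1))) homeomorphic_space nsphere 0"
proof -
  let ?G = "graph_copies 2 (path_graph 1)"
  let ?R = "geometric_realization (graph_complex ?G)"
  let ?I = "top_of_set {- 1, 1::real}"
  define p where "p t v = (if v = (0::nat, 0::nat) then (1 - t) / 2
    else if v = (1, 0) then (1 + t) / 2 else 0)" for t :: real and v
  define b where "b t i = (if i = (0::nat) then t else 0)" for t :: real and i
  have "verts ?G = {(0, 0), (1, 0)}" "edges ?G = {}"
    by (auto simp: graph_copies_def path_graph_def)
  then have "graph_complex ?G = insert {} ((\<lambda>v. {v}) ` {(0, 0), (1, 0)})"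
    by (auto simp: graph_complex_def)
  from topspace_realization_discrete[OF this]
  have "topspace ?R = {\<lambda>w. if w = (0, 0) then 1 else 0, \<lambda>w. if w = (1, 0) then 1 else 0}"
    by simp
  also have "(\<lambda>w. if w = (0, 0) then 1 else 0) = p (- 1)" by (intro ext) (simp add: p_def)
  also have "(\<lambda>w. if w = (1, 0) then 1 else 0) = p 1" by (intro ext) (simp add: p_def)
  finally have R: "topspace ?R = {p (- 1), p 1}" .
  have B: "topspace (nsphere 0) = {b (- 1), b 1}"
  proof -
    have "x \<in> topspace (nsphere 0) \<longleftrightarrow> x = b (- 1) \<or> x = b 1" for x
    proof
      assume "x \<in> topspace (nsphere 0)"
      then have "x 0 = 1 \<or> x 0 = - 1" "\<And>i. i \<noteq> 0 \<Longrightarrow> x i = 0"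
        by (auto simp: nsphere power2_eq_1_iff)
      then show "x = b (- 1) \<or> x = b 1" unfolding b_def fun_eq_iff by auto
    qed (auto simp: nsphere b_def)
    then show ?thesis by blast
  qed
  have "continuous_on {- 1, 1} (\<lambda>t. p t v)" "continuous_on {- 1, 1} (\<lambda>t. b t i)" for v i
    by (auto intro: continuous_on_finite)
  then have p: "quotient_map ?I ?R p" and b: "quotient_map ?I (nsphere 0) b"
    by (auto intro!: T1_Spaces.continuous_imp_quotient_map simp: compact_space_subtopology
        Hausdorff_geometric_realization Hausdorff_nsphere
        continuous_map_geometric_realization continuous_map_nsphere R B simp del: One_nat_def)
  show ?thesis
  proof (rule quotient_maps_same_fibres[OF p b])
    fix x y
    have "x = y" if "p x = p y" using fun_cong[OF that, of "(0, 0)"] by (simp add: p_def)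
    moreover have "x = y" if "b x = b y" using fun_cong[OF that, of 0] by (simp add: b_def)
    ultimately show "p x = p y \<longleftrightarrow> b x = b y" by blast
  qed
qed

lemma compact_space_low_dim:
  "compact_space (nball 0)" "compact_space (nball 1)" "compact_space (nsphere 0)" "compact_space (nsphere 1)"
proof -
  have "topspace (nball 0) = {\<lambda>_. 0}" by (auto simp: nball_alt)
  then show "compact_space (nball 0)"
    by (simp add: compact_space_def finite_imp_compactin)
  have I: "compact_space (top_of_set {0..1::real})" by (simp add: compact_space_subtopology)
  obtain b where "quotient_map (top_of_set {0..1::real}) (nball 1) b"
    using interval_onto_nball_1[of 1] by auto
  then show "compact_space (nball 1)" using I by (rule compact_space_quotient_image)
  obtain c where "quotient_map (top_of_set {0..1::real}) (nsphere 1) c"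
    using interval_onto_nsphere_1[OF zero_less_one] by metis
  then show "compact_space (nsphere 1)" using I by (rule compact_space_quotient_image)
  have "topspace (nsphere 0) \<subseteq> {\<lambda>i. if i = 0 then 1 else 0, \<lambda>i. if i = 0 then - 1 else 0}"
  proof
    fix x assume "x \<in> topspace (nsphere 0)"
    then have "x 0 = 1 \<or> x 0 = - 1" "\<And>i. i \<noteq> 0 \<Longrightarrow> x i = 0"
      by (auto simp: nsphere power2_eq_1_iff)
    then show "x \<in> {\<lambda>i. if i = 0 then 1 else 0, \<lambda>i. if i = 0 then - 1 else 0}"
      unfolding insert_iff fun_eq_iff by auto
  qed
  then have "finite (topspace (nsphere 0))" by (rule finite_subset) simp
  then show "compact_space (nsphere 0)"
    by (simp add: compact_space_def finite_imp_compactin)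
qed

lemma nonempty_low_dim: "topspace (nball n) \<noteq> {}" "topspace (nsphere n) \<noteq> {}"
proof -
  have "(\<lambda>_. 0) \<in> topspace (nball n)" by (simp add: nball_alt)
  then show "topspace (nball n) \<noteq> {}" by blast
  show "topspace (nsphere n) \<noteq> {}" using in_topspace_nsphere by blast
qed

lemma finite_complex_graphs:
  "finite_complex (graph_complex (path_graph n))"
  "3 \<le> n \<Longrightarrow> finite_complex (graph_complex (cycle_graph n))"
  "finite_complex (graph_complex (graph_copies 2 (path_graph 1)))"
proof -
  show "finite_complex (graph_complex (path_graph n))"
    by (simp add: finite_complex_graph_complex path_graph_simple)
  show "3 \<le> n \<Longrightarrow> finite_complex (graph_complex (cycle_graph n))"
    by (simp add: finite_complex_graph_complex cycle_graph_simple)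
  show "finite_complex (graph_complex (graph_copies 2 (path_graph 1)))"
    by (rule finite_complex_graph_complex)
      (auto simp: finite_simple_graph_def graph_copies_def path_graph_def)
qed

lemma realization_of_join:
  assumes M: "finite_complex M" "M \<cong>\<^sub>C \<Delta> \<star>\<^sub>C \<Sigma>" and fin: "finite_complex \<Delta>" "finite_complex \<Sigma>"
    and X: "geometric_realization \<Delta> homeomorphic_space X" "compact_space X" "topspace X \<noteq> {}"
    and Y: "geometric_realization \<Sigma> homeomorphic_space Y" "compact_space Y" "topspace Y \<noteq> {}"
  shows "geometric_realization M homeomorphic_space X \<star>\<^sub>T Y"
proof -
  have X': "X homeomorphic_space geometric_realization \<Delta>"
    by (rule iffD1[OF homeomorphic_space_sym X(1)])
  have Y': "Y homeomorphic_space geometric_realization \<Sigma>"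
    by (rule iffD1[OF homeomorphic_space_sym Y(1)])
  show ?thesis
    by (rule homeomorphic_space_trans[OF geometric_realization_complex_iso[OF M(2,1)]
      geometric_realization_join[OF fin X' X(2,3) Y' Y(2,3)]])
qed

section \<open>Matchings of a set of edges\<close>

definition matchings :: "'v set set \<Rightarrow> 'v set set set" where
  "matchings E = {m. m \<subseteq> E \<and> pairwise disjnt m}"

definition disjoint_edges :: "'v set set \<Rightarrow> 'v set set \<Rightarrow> 'v set set" where
  "disjoint_edges E m = {e \<in> E. \<forall>f\<in>m. disjnt e f}"

lemma matching_complex_eq: "matching_complex G = matchings (edges G)"
  by (auto simp: matching_complex_def matchings_def pairwise_def disjnt_def)

lemma finite_complex_matchings: "finite E \<Longrightarrow> finite_complex (matchings E)"
  unfolding finite_complex_def matchings_def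
  by (auto intro: finite_subset pairwise_subset)

lemma Union_matchings: "\<Union>(matchings E) = E"
proof
  show "E \<subseteq> \<Union>(matchings E)"
  proof
    fix e assume "e \<in> E"
    then have "{e} \<in> matchings E" by (simp add: matchings_def)
    then show "e \<in> \<Union>(matchings E)" by blast
  qed
qed (auto simp: matchings_def)

lemma matchings_empty: "matchings {} = {{}}"
  by (auto simp: matchings_def)

lemma empty_in_matchings: "{} \<in> matchings E"
  by (simp add: matchings_def)

lemma insert_in_matchings:
  "insert e m \<in> matchings E \<longleftrightarrow> e \<in> E \<and> m \<in> matchings E \<and> (\<forall>f\<in>m. f \<noteq> e \<longrightarrow> disjnt e f)"
  by (auto simp: matchings_def pairwise_insert disjnt_sym)

text \<open>
  The members of \<open>m\<close> are not disjoint from themselves, as they are nonempty; so the edges disjoint from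
  \<open>m\<close> are automatically outside \<open>m\<close>.
\<close>

lemma link_matchings:
  assumes m: "m \<in> matchings E" and ne: "{} \<notin> E"
  shows "complex_link (matchings E) m = matchings (disjoint_edges E m)"
proof -
  have "\<tau> \<union> m \<in> matchings E \<and> \<tau> \<inter> m = {} \<longleftrightarrow> \<tau> \<subseteq> disjoint_edges E m"
    if \<tau>: "\<tau> \<in> matchings E" for \<tau>
  proof
    assume \<tau>m: "\<tau> \<union> m \<in> matchings E \<and> \<tau> \<inter> m = {}"
    have "disjnt e f" if "e \<in> \<tau>" "f \<in> m" for e f
    proof -
      have "e \<noteq> f" using that \<tau>m by blast
      then show ?thesis using that \<tau>m unfolding matchings_def pairwise_def by blast
    qed
    then show "\<tau> \<subseteq> disjoint_edges E m" using \<tau> by (auto simp: disjoint_edges_def matchings_def)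
  next
    assume d: "\<tau> \<subseteq> disjoint_edges E m"
    have "e \<notin> m" if "e \<in> \<tau>" for e
    proof
      assume "e \<in> m"
      then have "disjnt e e" using d that unfolding disjoint_edges_def by blast
      moreover have "e \<noteq> {}" using \<tau> that ne by (auto simp: matchings_def)
      ultimately show False by simp
    qed
    moreover have "\<tau> \<union> m \<in> matchings E"
      using \<tau> m d unfolding matchings_def disjoint_edges_def pairwise_def
      by (auto simp: disjnt_sym)
    ultimately show "\<tau> \<union> m \<in> matchings E \<and> \<tau> \<inter> m = {}" by blast
  qed
  moreover have "\<tau> \<in> matchings (disjoint_edges E m) \<longleftrightarrow> \<tau> \<in> matchings E \<and> \<tau> \<subseteq> disjoint_edges E m" for \<tau>
    by (auto simp: matchings_def disjoint_edges_def)
  ultimately show ?thesis unfolding complex_link_def by (intro set_eqI) (simp cong: conj_cong)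
qed

lemma acyclic_matchings_cone:
  assumes "finite E" "e \<in> E" "\<And>f. f \<in> E \<Longrightarrow> f \<noteq> e \<Longrightarrow> disjnt e f"
  shows "acyclic_complex TYPE('k::field) (matchings E)"
proof (rule acyclic_cone[OF finite_complex_matchings[OF assms(1)]])
  fix \<sigma> assume "\<sigma> \<in> matchings E"
  then show "insert e \<sigma> \<in> matchings E"
    using assms(2,3) unfolding insert_in_matchings by (auto simp: matchings_def)
qed

lemma acyclic_matchings_delete:
  assumes "finite E" "{} \<notin> E" "e \<in> E"
    and "acyclic_complex TYPE('k::field) (matchings (E - {e}))"
    and "acyclic_complex TYPE('k) (matchings {f \<in> E. disjnt f e})"
  shows "acyclic_complex TYPE('k) (matchings E)"
proof (rule acyclic_deletion_link[OF finite_complex_matchings[OF assms(1)]])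
  have "{\<sigma> \<in> matchings E. e \<notin> \<sigma>} = matchings (E - {e})" by (auto simp: matchings_def)
  with assms(4) show "acyclic_complex TYPE('k) {\<sigma> \<in> matchings E. e \<notin> \<sigma>}" by simp
  have "{e} \<in> matchings E" using assms(3) by (simp add: matchings_def)
  from link_matchings[OF this assms(2)] assms(5)
  show "acyclic_complex TYPE('k) (complex_link (matchings E) {e})"
    by (simp add: disjoint_edges_def)
qed

text \<open>
  Induction on the path: the first edge is disjoint from the second only, so its link is a point, and
  its deletion is a shorter path.
\<close>

lemma acyclic_matchings_path:
  assumes "distinct xs" "xs \<noteq> []" "{} \<notin> set xs"
    and "\<And>i j. i < j \<Longrightarrow> j < length xs \<Longrightarrow> disjnt (xs ! i) (xs ! j) \<longleftrightarrow> j = i + 1"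
  shows "acyclic_complex TYPE('k::field) (matchings (set xs))"
  using assms
proof (induction xs)
  case (Cons x ys)
  show ?case
  proof (cases ys)
    case Nil
    then show ?thesis by (intro acyclic_matchings_cone[of _ x]) auto
  next
    case ys: (Cons y zs)
    have "disjnt x y" using Cons.prems(4)[of 0 1] ys by simp
    have nd: "\<not> disjnt x z" if z: "z \<in> set zs" for z
    proof -
      obtain i where "i < length zs" "z = zs ! i" using z by (auto simp: in_set_conv_nth)
      then show ?thesis using Cons.prems(4)[of 0 "i + 2"] ys by simp
    qed
    have link: "{f \<in> set (x # ys). disjnt f x} = {y}"
    proof -
      have "x \<noteq> {}" using Cons.prems(3) by auto
      then have "\<not> disjnt z x" if "z \<in> insert x (set zs)" for z
        using that nd disjnt_sym disjnt_self_iff_empty by blast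
      moreover have "disjnt y x" using \<open>disjnt x y\<close> by (rule disjnt_sym)
      ultimately show ?thesis unfolding ys by auto
    qed
    have del: "set (x # ys) - {x} = set ys" using Cons.prems(1) by auto
    have "acyclic_complex TYPE('k) (matchings (set ys))"
    proof (rule Cons.IH)
      show "disjnt (ys ! i) (ys ! j) \<longleftrightarrow> j = i + 1" if "i < j" "j < length ys" for i j
        using Cons.prems(4)[of "Suc i" "Suc j"] that by simp
    qed (use Cons.prems ys in auto)
    moreover have "acyclic_complex TYPE('k) (matchings {y})"
      by (rule acyclic_matchings_cone[of _ y]) auto
    ultimately show ?thesis
      using acyclic_matchings_delete[of "set (x # ys)" x] Cons.prems(3) unfolding link del by simp
  qed
qed simp

section \<open>Matching complexes that are surfaces\<close>

text \<open>
  The parameter \<open>K\<close> names the field of coefficients.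
\<close>

locale surface_matchings =
  fixes E :: "'v set set" and K :: "'k::field itself"
  assumes finE: "finite E" and neE: "{} \<notin> E"
    and manifold: "homology_manifold_with_boundary TYPE('k) 2 (matchings E)"
begin

lemma link_homology:
  assumes "m \<in> matchings E" "m \<noteq> {}"
  shows "has_homology_of_sphere TYPE('k) (2 - int (card m)) (matchings (disjoint_edges E m)) \<or>
    has_homology_of_ball TYPE('k) (2 - int (card m)) (matchings (disjoint_edges E m))"
  using manifold assms unfolding homology_manifold_with_boundary_def
  by (simp add: link_matchings[OF _ neE])

lemma card_matching_le_3: "m \<in> matchings E \<Longrightarrow> card m \<le> 3"
proof -
  assume m: "m \<in> matchings E"
  have "finite (matchings E)" using finite_complex_matchings[OF finE] by (simp add: finite_complex_def)
  then have "int (card m) - 1 \<le> complex_dim (matchings E)"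
    using m unfolding complex_dim_def by simp
  then show ?thesis using manifold by (simp add: homology_manifold_with_boundary_def)
qed

lemma finite_disjoint_edges: "finite (disjoint_edges E m)"
  using finE by (simp add: disjoint_edges_def)

text \<open>
  The link of a maximal matching is the complex \<open>{{}}\<close>, which has the homology of the sphere of dimension
  \<open>- 1\<close> only.
\<close>

lemma maximal_matching_card:
  assumes m: "m \<in> matchings E" "m \<noteq> {}" and max: "disjoint_edges E m = {}"
  shows "card m = 3"
proof -
  have b: "reduced_betti TYPE('k) (matchings (disjoint_edges E m)) (- 1) > 0"
    unfolding max matchings_empty by (rule reduced_betti_empty_face)
  then have "has_homology_of_sphere TYPE('k) (2 - int (card m)) (matchings (disjoint_edges E m))"
    using link_homology[OF m] by (auto simp: has_homology_of_ball_def)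
  with b show ?thesis by (auto simp: has_homology_of_sphere_def split: if_splits)
qed

lemma disjoint_edges_intersect:
  assumes m: "m \<in> matchings E" "card m = 2"
    and xy: "x \<in> disjoint_edges E m" "y \<in> disjoint_edges E m" "x \<noteq> y"
  shows "\<not> disjnt x y"
proof
  assume d: "disjnt x y"
  have "x \<notin> m" "y \<notin> m"
    using xy neE by (auto simp: disjoint_edges_def)
  moreover have "insert x (insert y m) \<in> matchings E"
    using m xy d by (auto simp: insert_in_matchings disjoint_edges_def disjnt_sym)
  moreover have "finite m" using m(2) by (metis card.infinite zero_neq_numeral)
  ultimately show False using card_matching_le_3[of "insert x (insert y m)"] m(2) xy(3) by simp
qed

lemma card_le_1_link:
  assumes m: "m \<in> matchings E" "card m = 2" and \<sigma>: "\<sigma> \<in> matchings (disjoint_edges E m)"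
  shows "card \<sigma> \<le> 1"
proof (rule ccontr)
  assume "\<not> card \<sigma> \<le> 1"
  then obtain x y where xy: "x \<in> \<sigma>" "y \<in> \<sigma>" "x \<noteq> y"
    by (metis One_nat_def card_le_Suc0_iff_eq card.infinite le_SucI le_zero_eq nle_le)
  then have "disjnt x y" "x \<in> disjoint_edges E m" "y \<in> disjoint_edges E m"
    using \<sigma> unfolding matchings_def pairwise_def by blast+
  with disjoint_edges_intersect[OF m] xy(3) show False by blast
qed

text \<open>
  The link of a matching with two edges is a set of points, and the homology of the sphere or ball of
  dimension zero is that of two points or one.
\<close>

lemma card_disjoint_edges_le_2:
  assumes m: "m \<in> matchings E" "card m = 2"
  shows "card (disjoint_edges E m) \<le> 2"
proof (rule ccontr)
  let ?L = "disjoint_edges E m"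
  assume "\<not> card ?L \<le> 2"
  then have "3 \<le> card ?L" by simp
  then obtain T where "T \<subseteq> ?L" "card T = 3" by (meson obtain_subset_with_card_n)
  then obtain x y z where xyz: "{x, y, z} \<subseteq> ?L" "x \<noteq> y" "x \<noteq> z" "y \<noteq> z"
    by (auto simp: card_3_iff)
  have "reduced_betti TYPE('k) (matchings ?L) 0 > 1"
    using xyz card_le_1_link[OF m]
    by (intro three_points_reduced_betti[OF finite_complex_matchings[OF finite_disjoint_edges], of _ x y z])
      (auto simp: Union_matchings)
  moreover have "m \<noteq> {}" using m(2) by auto
  ultimately show False
    using link_homology[OF m(1)] m(2)
    by (auto simp: has_homology_of_sphere_def has_homology_of_ball_def split: if_splits)
qed

text \<open>
  The link of a single edge has the homology of a circle or an arc, hence no homology in degree zero.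
\<close>

lemma link_of_edge_connected:
  assumes a: "a \<in> E" and A: "x \<in> A" "x \<in> disjoint_edges E {a}" "y \<notin> A" "y \<in> disjoint_edges E {a}"
  obtains u v where "u \<in> A" "v \<notin> A" "u \<in> disjoint_edges E {a}" "v \<in> disjoint_edges E {a}" "disjnt u v"
proof (rule ccontr)
  assume no: "\<not> thesis"
  let ?L = "disjoint_edges E {a}"
  have "reduced_betti TYPE('k) (matchings ?L) 0 > 0"
  proof (rule disconnected_reduced_betti_pos[OF finite_complex_matchings[OF finite_disjoint_edges], of x _ A y])
    fix u v assume uv: "{u, v} \<in> matchings ?L" "u \<in> A"
    show "v \<in> A"
    proof (rule ccontr)
      assume "v \<notin> A"
      then have "u \<noteq> v" using uv(2) by blast
      then have "disjnt u v" "u \<in> ?L" "v \<in> ?L"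
        using uv(1) by (auto simp: matchings_def pairwise_def)
      then show False using no that[of u v] uv(2) \<open>v \<notin> A\<close> by blast
    qed
  qed (use A in \<open>auto simp: Union_matchings\<close>)
  moreover have "{a} \<in> matchings E" using a by (simp add: matchings_def)
  ultimately show False
    using link_homology[of "{a}"]
    by (auto simp: has_homology_of_sphere_def has_homology_of_ball_def dest: spec[of _ "0::int"])
qed

text \<open>
  The boundary of a surface is one-dimensional, so it has an edge, and the link of that edge is a
  ball of dimension zero: a point.
\<close>

lemma boundary_edge:
  obtains m where "m \<in> matchings E" "card m = 2" "card (disjoint_edges E m) \<le> 1"
proof -
  let ?B = "manifold_boundary TYPE('k) 2 (matchings E)"
  have "finite_complex ?B" and dim: "complex_dim ?B = 1"
    using manifold by (auto simp: homology_manifold_with_boundary_def homology_manifold_def)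
  then have B: "finite ?B" "?B \<noteq> {}" by (auto simp: finite_complex_def)
  then have "complex_dim ?B \<in> (\<lambda>\<sigma>. int (card \<sigma>) - 1) ` ?B"
    unfolding complex_dim_def by (intro Max_in) auto
  then obtain m where m: "m \<in> ?B" "card m = 2" using dim by auto
  then have "m \<noteq> {}" by auto
  with m have M: "m \<in> matchings E" and ball: "has_homology_of_ball TYPE('k) 0 (complex_link (matchings E) m)"
    by (auto simp: manifold_boundary_def)
  let ?L = "disjoint_edges E m"
  have b: "reduced_betti TYPE('k) (matchings ?L) 0 = 0"
    using ball by (simp add: link_matchings[OF M neE] has_homology_of_ball_def)
  have "card ?L \<le> 1"
  proof (rule ccontr)
    assume "\<not> card ?L \<le> 1"
    then obtain x y where xy: "x \<in> ?L" "y \<in> ?L" "x \<noteq> y"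
      using finite_disjoint_edges by (metis One_nat_def card_le_Suc0_iff_eq)
    have "reduced_betti TYPE('k) (matchings ?L) 0 > 0"
    proof (rule disconnected_reduced_betti_pos[OF finite_complex_matchings[OF finite_disjoint_edges], of x _ "{x}" y])
      fix u v assume uv: "{u, v} \<in> matchings ?L" "u \<in> {x}"
      show "v \<in> {x}" using card_le_1_link[OF M m(2) uv(1)] uv(2) by (cases "u = v") auto
    qed (use xy in \<open>auto simp: Union_matchings\<close>)
    with b show False by simp
  qed
  with that M m(2) show thesis by blast
qed

end

section \<open>Connected relations of degree at most two\<close>

text \<open>
  A longest path works. An edge that leaves it would prolong it at an end, or give an inner vertex
  degree three; since the relation is connected, the path visits every vertex. For the same reason the
  only further edge that can occur joins its two ends.
\<close>

lemma path_or_cycle: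
  assumes fin: "finite V" and ne: "V \<noteq> {}"
    and sym: "\<And>x y. R x y \<Longrightarrow> R y x"
    and deg: "\<And>x. x \<in> V \<Longrightarrow> card {y \<in> V. R x y} \<le> 2"
    and conn: "\<And>A. A \<subset> V \<Longrightarrow> A \<noteq> {} \<Longrightarrow> \<exists>u\<in>A. \<exists>v\<in>V - A. R u v"
  obtains xs c where "distinct xs" "set xs = V"
    "\<And>i j. i < j \<Longrightarrow> j < length xs \<Longrightarrow>
       R (xs ! i) (xs ! j) \<longleftrightarrow> j = i + 1 \<or> c \<and> i = 0 \<and> j = length xs - 1"
proof -
  define path where "path xs \<longleftrightarrow> xs \<noteq> [] \<and> distinct xs \<and> set xs \<subseteq> V \<and>
    (\<forall>i. i + 1 < length xs \<longrightarrow> R (xs ! i) (xs ! (i + 1)))" for xs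
  have no3: False if "x \<in> V" "{a, b, d} \<subseteq> V" "a \<noteq> b" "a \<noteq> d" "b \<noteq> d" "R x a" "R x b" "R x d" for x a b d
  proof -
    have "card {a, b, d} \<le> card {y \<in> V. R x y}"
      using that fin by (intro card_mono) auto
    then show False using deg[OF that(1)] that by simp
  qed
  obtain x0 where "x0 \<in> V" using ne by blast
  then have "path [x0]" by (simp add: path_def)
  moreover have "\<forall>ys. path ys \<longrightarrow> length ys < Suc (card V)"
    using fin by (metis path_def card_mono distinct_card less_Suc_eq_le)
  ultimately obtain xs where xs: "path xs" and max: "\<And>ys. path ys \<Longrightarrow> length ys \<le> length xs"
    using ex_has_greatest_nat[of path "[x0]" length "Suc (card V)"] by blast
  let ?n = "length xs"
  have n: "?n > 0" and dist: "distinct xs" and sub: "set xs \<subseteq> V"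
    and step: "\<And>i. i + 1 < ?n \<Longrightarrow> R (xs ! i) (xs ! (i + 1))"
    using xs by (auto simp: path_def)
  have inV: "xs ! i \<in> V" if "i < ?n" for i using that sub by auto
  have neq: "xs ! i \<noteq> xs ! j" if "i < ?n" "j < ?n" "i \<noteq> j" for i j
    using that dist by (simp add: nth_eq_iff_index_eq)
  \<comment> \<open>No edge leaves a longest path.\<close>
  have closed: "v \<in> set xs" if uv: "u \<in> set xs" "v \<in> V" "R u v" for u v
  proof (rule ccontr)
    assume v: "v \<notin> set xs"
    obtain i where i: "i < ?n" "u = xs ! i" using uv(1) by (auto simp: in_set_conv_nth)
    consider "i = 0" | "i = ?n - 1" | "0 < i" "i + 1 < ?n" using i(1) by linarith
    then show False
    proof cases
      case 1
      have "R ((v # xs) ! k) ((v # xs) ! (k + 1))" if "k + 1 < length (v # xs)" for k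
        using that step[of "k - 1"] sym[OF \<open>R u v\<close>] i(2) 1 by (cases k) auto
      then have "path (v # xs)" using v dist sub \<open>v \<in> V\<close> unfolding path_def by simp
      then show False using max by fastforce
    next
      case 2
      have "R ((xs @ [v]) ! k) ((xs @ [v]) ! (k + 1))" if "k + 1 < length (xs @ [v])" for k
      proof (cases "k + 1 < ?n")
        case True
        then show ?thesis using step[of k] by (simp add: nth_append)
      next
        case False
        then have "k = ?n - 1" using that by simp
        then show ?thesis using \<open>R u v\<close> i(2) 2 n by (simp add: nth_append)
      qed
      then have "path (xs @ [v])" using v dist sub \<open>v \<in> V\<close> unfolding path_def by simp
      then show False using max by fastforce
    next
      case 3
      have "xs ! k \<noteq> v" if "k < ?n" for k using v nth_mem[OF that] by metis
      then show False
        using no3[of u "xs ! (i - 1)" "xs ! (i + 1)" v] 3 i inV neq step[of i] sym[OF step[of "i - 1"]] uv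
        by simp
    qed
  qed
  have setV: "set xs = V"
  proof (rule ccontr)
    assume "set xs \<noteq> V"
    then have "set xs \<subset> V" "set xs \<noteq> {}" using sub n by auto
    from conn[OF this] closed show False by blast
  qed
  have chord: "i = 0 \<and> j = ?n - 1" if ij: "i < j" "j < ?n" "R (xs ! i) (xs ! j)" "j \<noteq> i + 1" for i j
  proof (rule ccontr)
    assume no: "\<not> (i = 0 \<and> j = ?n - 1)"
    show False
    proof (cases "i = 0")
      case False
      then show False
        using no3[of "xs ! i" "xs ! (i - 1)" "xs ! (i + 1)" "xs ! j"] ij inV neq step[of i]
          sym[OF step[of "i - 1"]] by simp
    next
      case True
      then have "j + 1 < ?n" "1 < j" using no ij by auto
      moreover from this have "xs ! (j - 1) \<noteq> xs ! 0" "xs ! (j + 1) \<noteq> xs ! 0"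
        using neq[of "j - 1" 0] neq[of "j + 1" 0] n by auto
      moreover have "xs ! 0 \<in> V" using inV n by blast
      ultimately show False
        using no3[of "xs ! j" "xs ! (j - 1)" "xs ! (j + 1)" "xs ! i"] ij inV neq step[of j]
          sym[OF step[of "j - 1"]] sym[OF ij(3)] True by simp
    qed
  qed
  show thesis
  proof (rule that[OF dist setV])
    fix i j assume ij: "i < j" "j < ?n"
    show "R (xs ! i) (xs ! j) \<longleftrightarrow> j = i + 1 \<or> R (xs ! 0) (xs ! (?n - 1)) \<and> i = 0 \<and> j = ?n - 1"
      using chord[OF ij] step[of i] ij by metis
  qed
qed

section \<open>Edges located by the edges that they meet\<close>

lemma doubleton_containing:
  assumes "card e = 2" "x \<in> e"
  obtains y where "e = {x, y}" "x \<noteq> y"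
  using assms by (auto simp: card_2_iff)

lemma doubleton_eqI:
  assumes "card e = 2" "x \<in> e" "y \<in> e" "x \<noteq> y"
  shows "e = {x, y}"
  using assms by (auto simp: card_2_iff)

lemma intersecting_edges_path:
  assumes "card e = 2" "card f = 2" "e \<noteq> f" "\<not> disjnt e f"
  obtains x y z where "e = {x, y}" "f = {y, z}" "distinct [x, y, z]"
proof -
  obtain y where y: "y \<in> e" "y \<in> f" using assms(4) by (auto simp: disjnt_def)
  obtain x z where "e = {y, x}" "y \<noteq> x" "f = {y, z}" "y \<noteq> z"
    using doubleton_containing[OF assms(1) y(1)] doubleton_containing[OF assms(2) y(2)] by metis
  with assms(3) that[of x y z] show thesis by auto
qed

text \<open>
  The edge \<open>e3\<close> meets the disjoint edges \<open>e0\<close> and \<open>e1\<close> and so connects them; \<open>e2\<close> meets \<open>e0\<close>, but not in the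
  end point used by \<open>e3\<close>, and is therefore attached at the other end.
\<close>

lemma four_path_root:
  assumes card: "card e0 = 2" "card e1 = 2" "card e2 = 2" "card e3 = 2"
    and dj: "disjnt e0 e1" "disjnt e1 e2" "disjnt e2 e3"
    and meet: "\<not> disjnt e0 e2" "\<not> disjnt e0 e3" "\<not> disjnt e1 e3"
  obtains p0 p1 p2 p3 p4 where "distinct [p0, p1, p2, p3, p4]"
    "e1 = {p0, p1}" "e3 = {p1, p2}" "e0 = {p2, p3}" "e2 = {p3, p4}"
proof -
  obtain p1 where p1: "p1 \<in> e1" "p1 \<in> e3" using meet(3) by (auto simp: disjnt_def)
  obtain p2 where p2: "p2 \<in> e0" "p2 \<in> e3" using meet(2) by (auto simp: disjnt_def)
  have "p1 \<noteq> p2" using p1 p2 dj(1) by (auto simp: disjnt_iff)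
  then have e3: "e3 = {p1, p2}" using doubleton_eqI[OF card(4)] p1 p2 by blast
  obtain p0 where e1: "e1 = {p1, p0}" "p1 \<noteq> p0" using doubleton_containing[OF card(2) p1(1)] .
  obtain p3 where e0: "e0 = {p2, p3}" "p2 \<noteq> p3" using doubleton_containing[OF card(1) p2(1)] .
  have "p3 \<in> e2" using meet(1) dj(3) by (auto simp: e0 e3 disjnt_iff)
  then obtain p4 where e2: "e2 = {p3, p4}" "p3 \<noteq> p4" using doubleton_containing[OF card(3)] by blast
  have "distinct [p0, p1, p2, p3, p4]"
    using dj e0(2) e1(2) e2(2) \<open>p1 \<noteq> p2\<close> unfolding e0(1) e1(1) e2(1) e3 by (auto simp: disjnt_iff)
  with that e0 e1 e2 e3 show thesis by (metis insert_commute)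
qed

text \<open>
  The four edges \<open>{p0, p1}\<close>, \<open>{p1, p2}\<close>, \<open>{p2, p3}\<close>, \<open>{p3, p4}\<close> form a path on five vertices. This and the next
  two lemmas locate a further edge from the edges that it meets and avoids: here it closes the path
  to a banner.
\<close>

lemma five_path_edge:
  assumes p: "distinct [p0, p1, p2, p3, p4]" and "card e4 = 2"
    and "disjnt {p1, p2} e4" "\<not> disjnt {p2, p3} e4" "\<not> disjnt {p0, p1} e4"
  shows "e4 = {p0, p3}"
  using assms(3-5) p by (intro doubleton_eqI[OF assms(2)]) (auto simp: disjnt_iff)

lemma five_cycle_edge:
  assumes p: "distinct [p0, p1, p2, p3, p4]" and "card e4 = 2"
    and "disjnt {p1, p2} e4" "disjnt {p2, p3} e4" "\<not> disjnt {p0, p1} e4" "\<not> disjnt {p3, p4} e4"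
  shows "e4 = {p0, p4}"
  using assms(3-6) p by (intro doubleton_eqI[OF assms(2)]) (auto simp: disjnt_iff)

lemma sixth_edge:
  assumes p: "distinct [p0, p1, p2, p3, p4]" and "card e5 = 2"
    and "disjnt {p0, p3} e5" "\<not> disjnt {p0, p1} e5" "\<not> disjnt {p3, p4} e5"
  shows "e5 = {p1, p4}"
  using assms(3-5) p by (intro doubleton_eqI[OF assms(2)]) (auto simp: disjnt_iff)

section \<open>Edge sets that realize a graph\<close>

text \<open>
  The last conjunct says that \<open>H\<close> has no isolated vertices, so that a set of edges determines the graph.
\<close>

definition realizes :: "('w \<Rightarrow> 'v) \<Rightarrow> 'w graph \<Rightarrow> 'v set set \<Rightarrow> bool" where
  "realizes f H E \<longleftrightarrow> inj_on f (verts H) \<and> (image f) ` edges H = E \<and> \<Union>(edges H) = verts H"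

lemma realizes_vertices:
  assumes "realizes f H E"
  shows "f ` verts H = \<Union>E"
proof -
  have "f ` \<Union>(edges H) = \<Union>((image f) ` edges H)" by (rule image_Union)
  with assms show ?thesis by (simp add: realizes_def)
qed

text \<open>
  In a graph without isolated vertices the edges determine the vertices, so it suffices to match the
  edges.
\<close>

lemma realizes_graph_iso:
  assumes G: "finite_simple_graph G" "no_isolated_vertices G" and f: "realizes f H (edges G)"
  shows "G \<cong>\<^sub>G H"
proof -
  have V: "\<Union>(edges G) = verts G"
    using G unfolding finite_simple_graph_def no_isolated_vertices_def by blast
  have inj: "inj_on f (verts H)" and E: "(image f) ` edges H = edges G" and W: "\<Union>(edges H) = verts H"
    using f by (auto simp: realizes_def)
  have "f ` verts H = verts G" using realizes_vertices[OF f] V by simp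
  then have bij: "bij_betw f (verts H) (verts G)" using inj by (simp add: bij_betw_def)
  let ?g = "inv_into (verts H) f"
  have "?g ` f ` e = e" if "e \<in> edges H" for e
  proof -
    have "e \<subseteq> verts H" using that W by blast
    then show ?thesis using inj by (simp add: inv_into_image_cancel)
  qed
  then have "(image ?g) ` edges G = edges H" unfolding E[symmetric] image_image by simp
  then show ?thesis
    using bij_betw_inv_into[OF bij] unfolding graph_iso_def by blast
qed

lemma realizes_disjoint_union:
  assumes f: "realizes f H E" and g: "realizes g H' E'"
    and dj: "\<And>e e'. e \<in> E \<Longrightarrow> e' \<in> E' \<Longrightarrow> disjnt e e'"
  shows "realizes (case_sum f g) (H \<squnion>\<^sub>G H') (E \<union> E')"
proof -
  have ne: "f u \<noteq> g v" if uv: "u \<in> verts H" "v \<in> verts H'" for u v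
  proof -
    obtain e where e: "e \<in> E" "f u \<in> e"
      using uv(1) realizes_vertices[OF f] by (metis UnionE imageI)
    obtain e' where e': "e' \<in> E'" "g v \<in> e'"
      using uv(2) realizes_vertices[OF g] by (metis UnionE imageI)
    show ?thesis using dj[OF e(1) e'(1)] e(2) e'(2) by (auto simp: disjnt_iff)
  qed
  have "inj_on (case_sum f g) (verts H <+> verts H')"
  proof (rule inj_onI)
    fix x y assume "x \<in> verts H <+> verts H'" "y \<in> verts H <+> verts H'"
      "case_sum f g x = case_sum f g y"
    then show "x = y"
      using f g ne not_sym[OF ne] by (cases x; cases y) (auto simp: realizes_def dest: inj_onD)
  qed
  moreover have "\<Union>(edges (H \<squnion>\<^sub>G H')) = verts H <+> verts H'"
  proof -
    have "\<Union>(edges (H \<squnion>\<^sub>G H')) = Inl ` \<Union>(edges H) \<union> Inr ` \<Union>(edges H')"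
      by (simp add: disjoint_graph_union_def image_Union)
    then show ?thesis using f g by (simp add: realizes_def Plus_def)
  qed
  ultimately show ?thesis
    using f g unfolding realizes_def
    by (simp add: disjoint_graph_union_def image_Un image_image)
qed

lemma realizes_copies:
  assumes f: "\<And>i. i < n \<Longrightarrow> realizes (f i) H (E i)"
    and dj: "\<And>i j e e'. i < n \<Longrightarrow> j < n \<Longrightarrow> i \<noteq> j \<Longrightarrow> e \<in> E i \<Longrightarrow> e' \<in> E j \<Longrightarrow> disjnt e e'"
  shows "realizes (\<lambda>(i, v). f i v) (graph_copies n H) (\<Union>i<n. E i)"
proof -
  have ne: "f i u \<noteq> f j v" if ij: "i < n" "j < n" "i \<noteq> j" and uv: "u \<in> verts H" "v \<in> verts H" for i j u v
  proof -
    obtain e where e: "e \<in> E i" "f i u \<in> e"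
      using uv(1) realizes_vertices[OF f[OF ij(1)]] by (metis UnionE imageI)
    obtain e' where e': "e' \<in> E j" "f j v \<in> e'"
      using uv(2) realizes_vertices[OF f[OF ij(2)]] by (metis UnionE imageI)
    show ?thesis using dj[OF ij e(1) e'(1)] e(2) e'(2) by (auto simp: disjnt_iff)
  qed
  have "inj_on (\<lambda>(i, v). f i v) ({..<n} \<times> verts H)"
  proof (rule inj_onI)
    fix x y assume xy: "x \<in> {..<n} \<times> verts H" "y \<in> {..<n} \<times> verts H"
      "(case x of (i, v) \<Rightarrow> f i v) = (case y of (i, v) \<Rightarrow> f i v)"
    obtain i u j v where ij: "x = (i, u)" "y = (j, v)" by (cases x, cases y)
    then have "i = j" using xy ne[of i j u v] by auto
    then show "x = y" using xy f[of i] ij by (auto simp: realizes_def dest: inj_onD)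
  qed
  moreover have "(image (\<lambda>(i, v). f i v)) ` edges (graph_copies n H) = (\<Union>i<n. E i)"
  proof -
    have "edges (graph_copies n H) = (\<Union>i<n. (image (Pair i)) ` edges H)"
      by (auto simp: graph_copies_def)
    moreover have "(image (\<lambda>(i, v). f i v)) ` (image (Pair i)) ` edges H = E i" if "i < n" for i
      using f[OF that] unfolding realizes_def by (simp add: image_image)
    ultimately show ?thesis by (simp add: image_UN)
  qed
  moreover have "\<Union>(edges (graph_copies n H)) = {..<n} \<times> verts H"
  proof -
    have "\<Union>(edges (graph_copies n H)) = {..<n} \<times> \<Union>(edges H)"
      by (auto simp: graph_copies_def)
    then show ?thesis using f unfolding realizes_def by (cases "n = 0") auto
  qed
  ultimately show ?thesis unfolding realizes_def by (simp add: graph_copies_def)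
qed

lemma edges_path_graph: "edges (path_graph n) = (\<lambda>i. {i, i + 1}) ` {..<n - 1}"
  by (auto simp: path_graph_def)

lemma edges_cycle_graph: "edges (cycle_graph n) = (\<lambda>i. {i, (i + 1) mod n}) ` {..<n}"
  by (auto simp: cycle_graph_def)

lemma realizes_nth:
  assumes "distinct vs" "verts H = {..<length vs}" "(image ((!) vs)) ` edges H = E"
    "\<Union>(edges H) = verts H"
  shows "realizes ((!) vs) H E"
  using assms by (simp add: realizes_def inj_on_nth)

lemma realizes_path_2:
  "x \<noteq> y \<Longrightarrow> realizes ((!) [x, y]) (path_graph 2) {{x, y}}"
  by (rule realizes_nth; simp add: edges_path_graph lessThan_Suc)
    (auto simp: path_graph_def)

lemma realizes_path_3:
  "distinct [x, y, z] \<Longrightarrow> realizes ((!) [x, y, z]) (path_graph 3) {{x, y}, {y, z}}"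
  by (rule realizes_nth; simp add: edges_path_graph lessThan_Suc numeral_3_eq_3) (auto simp: path_graph_def)

section \<open>Patterns of disjoint edges and their complexes\<close>

text \<open>
  The disjointness relation on \<open>xs\<close> is a path in the order of the list, which \<open>c\<close> closes to a cycle.
\<close>

definition disjointness_pattern :: "bool \<Rightarrow> 'v set list \<Rightarrow> bool" where
  "disjointness_pattern c xs \<longleftrightarrow> (\<forall>i j. i < j \<longrightarrow> j < length xs \<longrightarrow>
     (disjnt (xs ! i) (xs ! j) \<longleftrightarrow> j = i + 1 \<or> c \<and> i = 0 \<and> j = length xs - 1))"

lemma disjointness_patternD:
  assumes "disjointness_pattern c xs" "i < j" "j < length xs"
  shows "disjnt (xs ! i) (xs ! j) \<longleftrightarrow> j = i + 1 \<or> c \<and> i = 0 \<and> j = length xs - 1"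
  using assms by (simp add: disjointness_pattern_def)

lemma complex_isoI:
  assumes bij: "bij_betw f (\<Union>\<Sigma>) (\<Union>\<Delta>)" and im: "(image f) ` \<Sigma> = \<Delta>"
  shows "\<Delta> \<cong>\<^sub>C \<Sigma>"
proof -
  let ?g = "inv_into (\<Union>\<Sigma>) f"
  have "?g ` f ` \<sigma> = \<sigma>" if "\<sigma> \<in> \<Sigma>" for \<sigma>
    using that bij by (intro inv_into_image_cancel) (auto simp: bij_betw_def)
  then have "(image ?g) ` \<Delta> = \<Sigma>" unfolding im[symmetric] image_image by simp
  then show ?thesis using bij_betw_inv_into[OF bij] unfolding complex_iso_def by blast
qed

text \<open>
  Without three pairwise disjoint edges the matchings have at most two edges, so their complex is
  the graph of the disjointness relation.
\<close>

lemma matchings_iso_graph_complex: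
  assumes H: "finite_simple_graph H" and bij: "bij_betw f (verts H) E"
    and no3: "\<And>x y z. \<lbrakk>x \<in> E; y \<in> E; z \<in> E; x \<noteq> y; x \<noteq> z; y \<noteq> z; disjnt x y; disjnt x z; disjnt y z\<rbrakk> \<Longrightarrow> False"
    and adj: "\<And>u v. \<lbrakk>u \<in> verts H; v \<in> verts H; u \<noteq> v\<rbrakk> \<Longrightarrow> disjnt (f u) (f v) \<longleftrightarrow> {u, v} \<in> edges H"
  shows "matchings E \<cong>\<^sub>C graph_complex H"
proof (rule complex_isoI)
  show "bij_betw f (\<Union>(graph_complex H)) (\<Union>(matchings E))"
    using bij by (simp add: Union_graph_complex[OF H] Union_matchings)
  have inj: "inj_on f (verts H)" and im: "f ` verts H = E" using bij by (auto simp: bij_betw_def)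
  show "(image f) ` graph_complex H = matchings E"
  proof
    show "(image f) ` graph_complex H \<subseteq> matchings E"
    proof
      fix m assume "m \<in> (image f) ` graph_complex H"
      then obtain \<sigma> where \<sigma>: "\<sigma> \<in> graph_complex H" "m = f ` \<sigma>" by blast
      then consider "\<sigma> = {}" | v where "\<sigma> = {v}" "v \<in> verts H" | "\<sigma> \<in> edges H"
        unfolding graph_complex_def by blast
      then show "m \<in> matchings E"
      proof cases
        case 3
        then obtain u v where uv: "\<sigma> = {u, v}" "u \<noteq> v" "u \<in> verts H" "v \<in> verts H"
          using H unfolding finite_simple_graph_def card_2_iff by fast
        then have "disjnt (f u) (f v)" using adj 3 by simp
        moreover have "f u \<in> E" "f v \<in> E" using im uv by auto
        ultimately show ?thesis
          using \<sigma>(2) uv(1) by (simp add: insert_in_matchings empty_in_matchings)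
      qed (use \<sigma>(2) im in \<open>auto simp: insert_in_matchings empty_in_matchings\<close>)
    qed
    show "matchings E \<subseteq> (image f) ` graph_complex H"
    proof
      fix m assume m: "m \<in> matchings E"
      then have sub: "m \<subseteq> E" and dj: "\<And>x y. x \<in> m \<Longrightarrow> y \<in> m \<Longrightarrow> x \<noteq> y \<Longrightarrow> disjnt x y"
        unfolding matchings_def pairwise_def by blast+
      consider "m = {}" | x where "m = {x}" | x y where "x \<in> m" "y \<in> m" "x \<noteq> y" by blast
      then show "m \<in> (image f) ` graph_complex H"
      proof cases
        case 1
        then show ?thesis by (auto simp: graph_complex_def)
      next
        case (2 x)
        then obtain u where "u \<in> verts H" "x = f u" using sub im by blast
        then show ?thesis using 2 by (intro image_eqI[of _ _ "{u}"]) (auto simp: graph_complex_def)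
      next
        case (3 x y)
        then obtain u v where uv: "u \<in> verts H" "x = f u" "v \<in> verts H" "y = f v"
          using sub im by blast
        have "m = {x, y}"
        proof (rule ccontr)
          assume "m \<noteq> {x, y}"
          then obtain z where "z \<in> m" "z \<noteq> x" "z \<noteq> y" using 3 by blast
          then show False using no3[of x y z] dj sub 3 by blast
        qed
        moreover have "{u, v} \<in> edges H" using adj[of u v] dj 3 uv by blast
        ultimately show ?thesis using uv
          by (intro image_eqI[of _ _ "{u, v}"]) (auto simp: graph_complex_def)
      qed
    qed
  qed
qed

lemma bij_betw_nth_set: "distinct xs \<Longrightarrow> bij_betw ((!) xs) {..<length xs} (set xs)"
  by (rule bij_betw_nth) auto

lemma path_matchings:
  assumes xs: "distinct xs" "disjointness_pattern False xs"
    and no3: "\<And>x y z. \<lbrakk>x \<in> set xs; y \<in> set xs; z \<in> set xs; x \<noteq> y; x \<noteq> z; y \<noteq> z;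
      disjnt x y; disjnt x z; disjnt y z\<rbrakk> \<Longrightarrow> False"
  shows "matchings (set xs) \<cong>\<^sub>C graph_complex (path_graph (length xs))"
proof (rule matchings_iso_graph_complex[where f = "(!) xs"])
  show "bij_betw ((!) xs) (verts (path_graph (length xs))) (set xs)"
    using bij_betw_nth_set[OF xs(1)] by (simp add: path_graph_def)
  fix u v assume uv: "u \<in> verts (path_graph (length xs))" "v \<in> verts (path_graph (length xs))" "u \<noteq> v"
  have *: "{u, v} \<in> edges (path_graph (length xs)) \<longleftrightarrow> u + 1 = v \<or> v + 1 = u"
    using uv unfolding path_graph_def by (auto simp: doubleton_eq_iff)
  have sym: "disjnt (xs ! u) (xs ! v) \<longleftrightarrow> disjnt (xs ! v) (xs ! u)" by (metis disjnt_sym)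
  have uv': "u < length xs" "v < length xs" "u \<noteq> v" using uv by (simp_all add: path_graph_def cycle_graph_def)
  show "disjnt (xs ! u) (xs ! v) \<longleftrightarrow> {u, v} \<in> edges (path_graph (length xs))"
  proof (cases "u < v")
    case True
    then show ?thesis using uv' disjointness_patternD[OF xs(2) True] unfolding * by auto
  next
    case False
    then have "v < u" using uv' by simp
    then show ?thesis
      using uv' disjointness_patternD[OF xs(2) \<open>v < u\<close>] unfolding * sym by auto
  qed
qed (use path_graph_simple no3 in blast)+

lemma cycle_matchings:
  assumes xs: "distinct xs" "disjointness_pattern True xs" "4 \<le> length xs"
    and no3: "\<And>x y z. \<lbrakk>x \<in> set xs; y \<in> set xs; z \<in> set xs; x \<noteq> y; x \<noteq> z; y \<noteq> z;
      disjnt x y; disjnt x z; disjnt y z\<rbrakk> \<Longrightarrow> False"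
  shows "matchings (set xs) \<cong>\<^sub>C graph_complex (cycle_graph (length xs))"
proof (rule matchings_iso_graph_complex[where f = "(!) xs"])
  let ?n = "length xs"
  show "bij_betw ((!) xs) (verts (cycle_graph ?n)) (set xs)"
    using bij_betw_nth_set[OF xs(1)] by (simp add: cycle_graph_def)
  fix u v assume uv: "u \<in> verts (cycle_graph ?n)" "v \<in> verts (cycle_graph ?n)" "u \<noteq> v"
  have *: "{u, v} \<in> edges (cycle_graph ?n) \<longleftrightarrow>
      u + 1 = v \<or> v + 1 = u \<or> u = 0 \<and> v = ?n - 1 \<or> v = 0 \<and> u = ?n - 1"
  proof -
    have "{u, v} \<in> edges (cycle_graph ?n) \<longleftrightarrow> v = (u + 1) mod ?n \<or> u = (v + 1) mod ?n"
      using uv unfolding cycle_graph_def by (auto simp: doubleton_eq_iff)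
    moreover have "(w + 1) mod ?n = (if w = ?n - 1 then 0 else w + 1)" if "w < ?n" for w
    proof (cases "w = ?n - 1")
      case True
      then have "w + 1 = ?n" using that by simp
      then show ?thesis using True by simp
    next
      case False
      then show ?thesis using that by simp
    qed
    moreover have "u < ?n" "v < ?n" using uv by (simp_all add: cycle_graph_def)
    ultimately have "{u, v} \<in> edges (cycle_graph ?n) \<longleftrightarrow>
        v = (if u = ?n - 1 then 0 else u + 1) \<or> u = (if v = ?n - 1 then 0 else v + 1)"
      by metis
    then show ?thesis using \<open>u < ?n\<close> \<open>v < ?n\<close> by (auto split: if_splits)
  qed
  have sym: "disjnt (xs ! u) (xs ! v) \<longleftrightarrow> disjnt (xs ! v) (xs ! u)" by (metis disjnt_sym)
  have uv': "u < length xs" "v < length xs" "u \<noteq> v" using uv by (simp_all add: path_graph_def cycle_graph_def)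
  show "disjnt (xs ! u) (xs ! v) \<longleftrightarrow> {u, v} \<in> edges (cycle_graph ?n)"
  proof (cases "u < v")
    case True
    then show ?thesis using uv' disjointness_patternD[OF xs(2) True] unfolding * by auto
  next
    case False
    then have "v < u" using uv' by simp
    then show ?thesis
      using uv' disjointness_patternD[OF xs(2) \<open>v < u\<close>] unfolding * sym by auto
  qed
qed (use cycle_graph_simple[of "length xs"] xs(3) no3 in auto)

lemma single_edge_matchings: "matchings {a} \<cong>\<^sub>C graph_complex (path_graph 1)"
  using path_matchings[of "[a]"] by (simp add: disjointness_pattern_def)

lemma two_edges_matchings:
  assumes "a \<noteq> b" "\<not> disjnt a b"
  shows "matchings {a, b} \<cong>\<^sub>C graph_complex (graph_copies 2 (path_graph 1))"
proof (rule matchings_iso_graph_complex[where f = "\<lambda>(i, _). if i = 0 then a else b"])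
  have G: "verts (graph_copies 2 (path_graph 1)) = {(0, 0), (1, 0)}"
    "edges (graph_copies 2 (path_graph 1)) = {}"
    by (auto simp: graph_copies_def path_graph_def)
  then show "finite_simple_graph (graph_copies 2 (path_graph 1))"
    by (simp add: finite_simple_graph_def)
  show "bij_betw (\<lambda>(i, _). if i = 0 then a else b) (verts (graph_copies 2 (path_graph 1))) {a, b}"
    unfolding G using assms by (auto simp: bij_betw_def)
  have "\<not> disjnt b a" using assms disjnt_sym by blast
  then show "\<And>u v. \<lbrakk>u \<in> verts (graph_copies 2 (path_graph 1)); v \<in> verts (graph_copies 2 (path_graph 1)); u \<noteq> v\<rbrakk>
    \<Longrightarrow> disjnt (case u of (i, _) \<Rightarrow> if i = 0 then a else b) (case v of (i, _) \<Rightarrow> if i = 0 then a else b)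
      \<longleftrightarrow> {u, v} \<in> edges (graph_copies 2 (path_graph 1))"
    unfolding G using assms by auto
qed (use assms in auto)

text \<open>
  A matching of two vertex-disjoint sets of edges is a matching of each of them.
\<close>

lemma matchings_join:
  assumes cross: "\<And>e f. e \<in> E1 \<Longrightarrow> f \<in> E2 \<Longrightarrow> disjnt e f" and ne: "{} \<notin> E1"
    and iso: "matchings E1 \<cong>\<^sub>C \<Delta>" "matchings E2 \<cong>\<^sub>C \<Sigma>"
    and fin: "finite_complex \<Delta>" "finite_complex \<Sigma>"
  shows "matchings (E1 \<union> E2) \<cong>\<^sub>C \<Delta> \<star>\<^sub>C \<Sigma>"
proof -
  obtain f where f: "bij_betw f E1 (\<Union>\<Delta>)" "(image f) ` matchings E1 = \<Delta>"
    using iso(1) by (auto simp: complex_iso_def Union_matchings)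
  obtain g where g: "bij_betw g E2 (\<Union>\<Sigma>)" "(image g) ` matchings E2 = \<Sigma>"
    using iso(2) by (auto simp: complex_iso_def Union_matchings)
  have dj: "E1 \<inter> E2 = {}" using cross ne by (metis disjoint_iff disjnt_self_iff_empty)
  define h where "h e = (if e \<in> E1 then Inl (f e) else Inr (g e))" for e
  have h1: "h e = Inl (f e)" if "e \<in> E1" for e using that by (simp add: h_def)
  have h2: "h e = Inr (g e)" if "e \<in> E2" for e using that dj by (auto simp: h_def)
  have him: "h ` (m1 \<union> m2) = f ` m1 <+> g ` m2" if "m1 \<subseteq> E1" "m2 \<subseteq> E2" for m1 m2
  proof -
    have "h ` m1 = Inl ` f ` m1" "h ` m2 = Inr ` g ` m2"
      unfolding image_image using that by (auto intro!: image_cong simp: h1 h2 subset_iff)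
    then show ?thesis by (simp add: image_Un Plus_def)
  qed
  have M: "matchings (E1 \<union> E2) = {m1 \<union> m2 | m1 m2. m1 \<in> matchings E1 \<and> m2 \<in> matchings E2}"
  proof safe
    fix m assume m: "m \<in> matchings (E1 \<union> E2)"
    then have "m = (m \<inter> E1) \<union> (m \<inter> E2)" "m \<inter> E1 \<in> matchings E1" "m \<inter> E2 \<in> matchings E2"
      unfolding matchings_def by (auto intro: pairwise_subset)
    then show "\<exists>m1 m2. m = m1 \<union> m2 \<and> m1 \<in> matchings E1 \<and> m2 \<in> matchings E2" by blast
  next
    fix m1 m2 assume m: "m1 \<in> matchings E1" "m2 \<in> matchings E2"
    then have sub: "m1 \<subseteq> E1" "m2 \<subseteq> E2" and pw: "pairwise disjnt m1" "pairwise disjnt m2"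
      by (auto simp: matchings_def)
    have x: "disjnt e e'" "disjnt e' e" if "e \<in> m1" "e' \<in> m2" for e e'
      using that sub cross[of e e'] by (auto intro: disjnt_sym)
    have "pairwise disjnt (m1 \<union> m2)"
      by (rule pairwiseI) (metis UnE pairwiseD pw x)
    then show "m1 \<union> m2 \<in> matchings (E1 \<union> E2)"
      using sub by (auto simp: matchings_def)
  qed
  have "h ` (E1 \<union> E2) = \<Union>\<Delta> <+> \<Union>\<Sigma>"
    using him[of E1 E2] f(1) g(1) by (simp add: bij_betw_def)
  moreover have "inj_on h (E1 \<union> E2)"
    using f(1) g(1) unfolding bij_betw_def inj_on_def h_def by auto
  ultimately have "bij_betw h (\<Union>(matchings (E1 \<union> E2))) (\<Union>(\<Delta> \<star>\<^sub>C \<Sigma>))"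
    by (simp add: bij_betw_def Union_matchings Union_complex_join[OF fin])
  moreover have "(image h) ` matchings (E1 \<union> E2) = \<Delta> \<star>\<^sub>C \<Sigma>"
  proof
    show "(image h) ` matchings (E1 \<union> E2) \<subseteq> \<Delta> \<star>\<^sub>C \<Sigma>"
    proof
      fix \<sigma> assume "\<sigma> \<in> (image h) ` matchings (E1 \<union> E2)"
      then obtain m1 m2 where m: "m1 \<in> matchings E1" "m2 \<in> matchings E2" "\<sigma> = h ` (m1 \<union> m2)"
        unfolding M by blast
      then have "\<sigma> = f ` m1 <+> g ` m2" using him by (simp add: matchings_def)
      moreover have "f ` m1 \<in> \<Delta>" "g ` m2 \<in> \<Sigma>" using m f(2) g(2) by blast+
      ultimately show "\<sigma> \<in> \<Delta> \<star>\<^sub>C \<Sigma>" unfolding complex_join_def by blast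
    qed
    show "\<Delta> \<star>\<^sub>C \<Sigma> \<subseteq> (image h) ` matchings (E1 \<union> E2)"
    proof
      fix \<sigma> assume "\<sigma> \<in> \<Delta> \<star>\<^sub>C \<Sigma>"
      then obtain m1 m2 where m: "m1 \<in> matchings E1" "m2 \<in> matchings E2" "\<sigma> = f ` m1 <+> g ` m2"
        using f(2) g(2) unfolding complex_join_def by blast
      then have "\<sigma> = h ` (m1 \<union> m2)" using him by (simp add: matchings_def)
      then show "\<sigma> \<in> (image h) ` matchings (E1 \<union> E2)" unfolding M using m by blast
    qed
  qed
  ultimately show ?thesis unfolding complex_iso_def by blast
qed

section \<open>The graphs with a given pattern\<close>

context
  fixes xs :: "'v set list" and c :: bool
  assumes pat: "disjointness_pattern c xs" and card2: "\<And>e. e \<in> set xs \<Longrightarrow> card e = 2"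
begin

text \<open>
  An initial segment of a closed or open pattern is an open path, unless it is the whole closed one.
\<close>

lemma pattern_initial:
  assumes "i < j" "j < n" "n < length xs \<or> n = length xs \<and> \<not> c"
  shows "disjnt (xs ! i) (xs ! j) \<longleftrightarrow> j = i + 1"
  using disjointness_patternD[OF pat, of i j] assms by auto

lemma pattern_card: "i < length xs \<Longrightarrow> card (xs ! i) = 2"
  using card2 nth_mem by blast

lemma pattern_four_root:
  assumes n: "4 < length xs \<or> 4 = length xs \<and> \<not> c"
  obtains p0 p1 p2 p3 p4 where "distinct [p0, p1, p2, p3, p4]"
    "xs ! 1 = {p0, p1}" "xs ! 3 = {p1, p2}" "xs ! 0 = {p2, p3}" "xs ! 2 = {p3, p4}"
proof (rule four_path_root[of "xs ! 0" "xs ! 1" "xs ! 2" "xs ! 3"])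
  show "card (xs ! 0) = 2" "card (xs ! 1) = 2" "card (xs ! 2) = 2" "card (xs ! 3) = 2"
    using n by (auto intro!: pattern_card)
  show "disjnt (xs ! 0) (xs ! 1)" "disjnt (xs ! 1) (xs ! 2)" "disjnt (xs ! 2) (xs ! 3)"
    "\<not> disjnt (xs ! 0) (xs ! 2)" "\<not> disjnt (xs ! 0) (xs ! 3)" "\<not> disjnt (xs ! 1) (xs ! 3)"
    using pattern_initial[OF _ _ n, of 0 1] pattern_initial[OF _ _ n, of 1 2]
      pattern_initial[OF _ _ n, of 2 3] pattern_initial[OF _ _ n, of 0 2]
      pattern_initial[OF _ _ n, of 0 3] pattern_initial[OF _ _ n, of 1 3] by simp_all
qed (rule that)

lemma pattern_fifth_edge:
  assumes p: "distinct [p0, p1, p2, p3, p4]"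
    "xs ! 1 = {p0, p1}" "xs ! 3 = {p1, p2}" "xs ! 0 = {p2, p3}" "xs ! 2 = {p3, p4}"
    and n: "5 < length xs \<or> 5 = length xs \<and> \<not> c"
  shows "xs ! 4 = {p0, p3}"
proof (rule five_path_edge[OF p(1)])
  show "card (xs ! 4) = 2" using n by (auto intro!: pattern_card)
  show "disjnt {p1, p2} (xs ! 4)" "\<not> disjnt {p2, p3} (xs ! 4)" "\<not> disjnt {p0, p1} (xs ! 4)"
    using pattern_initial[OF _ _ n, of 3 4] pattern_initial[OF _ _ n, of 0 4]
      pattern_initial[OF _ _ n, of 1 4] unfolding p(2-) by simp_all
qed

text \<open>
  The first five edges form a banner. The sixth avoids \<open>{p0, p3}\<close> and meets \<open>{p0, p1}\<close> and \<open>{p3, p4}\<close>, so it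
  is \<open>{p1, p4}\<close>, but then it misses \<open>{p2, p3}\<close>.
\<close>

lemma no_induced_six_path: "\<not> (6 < length xs \<or> 6 = length xs \<and> \<not> c)"
proof
  assume n: "6 < length xs \<or> 6 = length xs \<and> \<not> c"
  then have n5: "5 < length xs \<or> 5 = length xs \<and> \<not> c" and n4: "4 < length xs \<or> 4 = length xs \<and> \<not> c"
    by auto
  obtain p0 p1 p2 p3 p4 where p: "distinct [p0, p1, p2, p3, p4]"
    "xs ! 1 = {p0, p1}" "xs ! 3 = {p1, p2}" "xs ! 0 = {p2, p3}" "xs ! 2 = {p3, p4}"
    using pattern_four_root[OF n4] .
  have e4: "xs ! 4 = {p0, p3}" using pattern_fifth_edge[OF p n5] .
  have "xs ! 5 = {p1, p4}"
  proof (rule sixth_edge[OF p(1)])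
    show "card (xs ! 5) = 2" using n by (auto intro!: pattern_card)
    show "disjnt {p0, p3} (xs ! 5)" "\<not> disjnt {p0, p1} (xs ! 5)" "\<not> disjnt {p3, p4} (xs ! 5)"
      using pattern_initial[OF _ _ n, of 4 5] pattern_initial[OF _ _ n, of 1 5]
        pattern_initial[OF _ _ n, of 2 5] unfolding p(2-) e4 by simp_all
  qed
  moreover have "\<not> disjnt (xs ! 0) (xs ! 5)"
    using pattern_initial[OF _ _ n, of 0 5] by simp
  ultimately show False using p(1,4) by (auto simp: disjnt_iff)
qed

lemma set_of_length_4: "length xs = 4 \<Longrightarrow> set xs = {xs ! 0, xs ! 1, xs ! 2, xs ! 3}"
  and set_of_length_5: "length xs = 5 \<Longrightarrow> set xs = {xs ! 0, xs ! 1, xs ! 2, xs ! 3, xs ! 4}"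
  and set_of_length_6: "length xs = 6 \<Longrightarrow> set xs = {xs ! 0, xs ! 1, xs ! 2, xs ! 3, xs ! 4, xs ! 5}"
  by (auto simp: length_Suc_conv numeral_eq_Suc)

lemma realizes_path_5:
  assumes n: "4 = length xs" "\<not> c"
  shows "\<exists>f. realizes f (path_graph 5) (set xs)"
proof -
  obtain p0 p1 p2 p3 p4 where p: "distinct [p0, p1, p2, p3, p4]"
    "xs ! 1 = {p0, p1}" "xs ! 3 = {p1, p2}" "xs ! 0 = {p2, p3}" "xs ! 2 = {p3, p4}"
    using pattern_four_root n by blast
  have "edges (path_graph 5) = {{0, 1}, {1, 2}, {2, 3}, {3, 4}}"
    unfolding edges_path_graph by (auto simp: lessThan_Suc numeral_eq_Suc)
  moreover have "verts (path_graph 5) = {0, 1, 2, 3, 4}" by (auto simp: path_graph_def)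
  ultimately have "realizes ((!) [p0, p1, p2, p3, p4]) (path_graph 5) (set xs)"
    using p(1) unfolding realizes_def set_of_length_4[OF n(1)[symmetric]] p(2-)
    by (auto simp: insert_commute)
  then show ?thesis by blast
qed

text \<open>
  The edges \<open>{p0, p1}\<close>, \<open>{p1, p2}\<close>, \<open>{p2, p3}\<close>, \<open>{p3, p0}\<close> form the square; \<open>p3\<close> carries the pendant edge.
\<close>

lemma realizes_banner:
  assumes n: "5 = length xs" "\<not> c"
  shows "\<exists>f. realizes f banner_graph (set xs)"
proof -
  have n4: "4 < length xs \<or> 4 = length xs \<and> \<not> c" and n5: "5 < length xs \<or> 5 = length xs \<and> \<not> c"
    using n by auto
  obtain p0 p1 p2 p3 p4 where p: "distinct [p0, p1, p2, p3, p4]"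
    "xs ! 1 = {p0, p1}" "xs ! 3 = {p1, p2}" "xs ! 0 = {p2, p3}" "xs ! 2 = {p3, p4}"
    using pattern_four_root[OF n4] .
  have e4: "xs ! 4 = {p0, p3}" using pattern_fifth_edge[OF p n5] .
  have "realizes ((!) [p3, p0, p1, p2, p4]) banner_graph (set xs)"
    using p(1) unfolding realizes_def set_of_length_5[OF n(1)[symmetric]] p(2-) e4
    by (auto simp: insert_commute banner_graph_def)
  then show ?thesis by blast
qed

lemma realizes_cycle_5:
  assumes n: "5 = length xs" and c: c
  shows "\<exists>f. realizes f (cycle_graph 5) (set xs)"
proof -
  have n4: "4 < length xs \<or> 4 = length xs \<and> \<not> c" using n by auto
  obtain p0 p1 p2 p3 p4 where p: "distinct [p0, p1, p2, p3, p4]"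
    "xs ! 1 = {p0, p1}" "xs ! 3 = {p1, p2}" "xs ! 0 = {p2, p3}" "xs ! 2 = {p3, p4}"
    using pattern_four_root[OF n4] .
  have e4: "xs ! 4 = {p0, p4}"
  proof (rule five_cycle_edge[OF p(1)])
    show "card (xs ! 4) = 2" using n by (auto intro!: pattern_card)
    show "disjnt {p1, p2} (xs ! 4)" "disjnt {p2, p3} (xs ! 4)" "\<not> disjnt {p0, p1} (xs ! 4)"
      "\<not> disjnt {p3, p4} (xs ! 4)"
      using disjointness_patternD[OF pat, of 3 4] disjointness_patternD[OF pat, of 0 4]
        disjointness_patternD[OF pat, of 1 4] disjointness_patternD[OF pat, of 2 4] n c
      unfolding p(2-) by simp_all
  qed
  have E: "edges (cycle_graph 5) = {{0, 1}, {1, 2}, {2, 3}, {3, 4}, {4, 0}}"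
  proof -
    have "{..<5::nat} = {0, 1, 2, 3, 4}" by auto
    then show ?thesis unfolding edges_cycle_graph by (simp add: numeral_2_eq_2)
  qed
  have "realizes ((!) [p0, p1, p2, p3, p4]) (cycle_graph 5) (set xs)"
  proof (rule realizes_nth[OF p(1)])
    show "verts (cycle_graph 5) = {..<length [p0, p1, p2, p3, p4]}" by (simp add: cycle_graph_def)
    show "image ((!) [p0, p1, p2, p3, p4]) ` edges (cycle_graph 5) = set xs"
      unfolding E set_of_length_5[OF n(1)[symmetric]] p(2-) e4 by (simp add: insert_commute)
    show "\<Union>(edges (cycle_graph 5)) = verts (cycle_graph 5)"
      unfolding E by (auto simp: cycle_graph_def)
  qed
  then show ?thesis by blast
qed

text \<open>
  The sides of the bipartite graph are \<open>{p0, p2, p4}\<close> and \<open>{p1, p3}\<close>.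
\<close>

lemma realizes_complete_bipartite:
  assumes n: "6 = length xs" and c: c
  shows "\<exists>f. realizes f (complete_bipartite 3 2) (set xs)"
proof -
  have n4: "4 < length xs \<or> 4 = length xs \<and> \<not> c" and n5: "5 < length xs \<or> 5 = length xs \<and> \<not> c"
    using n by auto
  obtain p0 p1 p2 p3 p4 where p: "distinct [p0, p1, p2, p3, p4]"
    "xs ! 1 = {p0, p1}" "xs ! 3 = {p1, p2}" "xs ! 0 = {p2, p3}" "xs ! 2 = {p3, p4}"
    using pattern_four_root[OF n4] .
  have e4: "xs ! 4 = {p0, p3}" using pattern_fifth_edge[OF p n5] .
  have e5: "xs ! 5 = {p1, p4}"
  proof (rule sixth_edge[OF p(1)])
    show "card (xs ! 5) = 2" using n by (auto intro!: pattern_card)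
    show "disjnt {p0, p3} (xs ! 5)" "\<not> disjnt {p0, p1} (xs ! 5)" "\<not> disjnt {p3, p4} (xs ! 5)"
      using disjointness_patternD[OF pat, of 4 5] disjointness_patternD[OF pat, of 1 5]
        disjointness_patternD[OF pat, of 2 5] n
      unfolding p(2-) e4 by simp_all
  qed
  have E: "edges (complete_bipartite 3 2) =
      {{Inl 0, Inr 0}, {Inl 1, Inr 0}, {Inl 2, Inr 0}, {Inl 0, Inr 1}, {Inl 1, Inr 1}, {Inl 2, Inr 1}}"
    (is "_ = ?E")
  proof -
    have "edges (complete_bipartite 3 2) = (\<lambda>(i, j). {Inl i, Inr j}) ` ({..<3} \<times> {..<2})"
      by (auto simp: complete_bipartite_def)
    also have "{..<3::nat} = {0, 1, 2}" by auto
    also have "{..<2::nat} = {0, 1}" by auto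
    finally show ?thesis by auto
  qed
  have V: "verts (complete_bipartite 3 2) = {Inl 0, Inl 1, Inl 2, Inr 0, Inr 1}"
    by (auto simp: complete_bipartite_def)
  have "realizes (case_sum ((!) [p0, p2, p4]) ((!) [p1, p3])) (complete_bipartite 3 2) (set xs)"
    using p(1) unfolding realizes_def set_of_length_6[OF n(1)[symmetric]] p(2-) e4 e5 E V
    by (auto simp: insert_commute)
  then show ?thesis by blast
qed

lemma realizes_two_paths_3:
  assumes n: "4 = length xs" and c: c and d: "distinct xs"
  shows "\<exists>f. realizes f (graph_copies 2 (path_graph 3)) (set xs)"
proof -
  have 1: "\<not> disjnt (xs ! 0) (xs ! 2)" "\<not> disjnt (xs ! 1) (xs ! 3)"
    and 2: "disjnt (xs ! 0) (xs ! 1)" "disjnt (xs ! 0) (xs ! 3)" "disjnt (xs ! 1) (xs ! 2)" "disjnt (xs ! 2) (xs ! 3)"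
    using disjointness_patternD[OF pat, of 0 2] disjointness_patternD[OF pat, of 1 3]
      disjointness_patternD[OF pat, of 0 1] disjointness_patternD[OF pat, of 0 3]
      disjointness_patternD[OF pat, of 1 2] disjointness_patternD[OF pat, of 2 3] n c by simp_all
  have ne: "xs ! 0 \<noteq> xs ! 2" "xs ! 1 \<noteq> xs ! 3" using d n by (simp_all add: nth_eq_iff_index_eq)
  have k: "card (xs ! 0) = 2" "card (xs ! 1) = 2" "card (xs ! 2) = 2" "card (xs ! 3) = 2"
    using n by (auto intro!: pattern_card)
  obtain x y z where x: "xs ! 0 = {x, y}" "xs ! 2 = {y, z}" "distinct [x, y, z]"
    using intersecting_edges_path[OF k(1,3) ne(1) 1(1)] .
  obtain u v w where u: "xs ! 1 = {u, v}" "xs ! 3 = {v, w}" "distinct [u, v, w]"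
    using intersecting_edges_path[OF k(2,4) ne(2) 1(2)] .
  define f where "f i = (!) (if i = (0::nat) then [x, y, z] else [u, v, w])" for i
  define E where "E i = (if i = (0::nat) then {xs ! 0, xs ! 2} else {xs ! 1, xs ! 3})" for i
  have "realizes (\<lambda>(i, v). f i v) (graph_copies 2 (path_graph 3)) (\<Union>i<2. E i)"
  proof (rule realizes_copies)
    show "realizes (f i) (path_graph 3) (E i)" for i
      using realizes_path_3[OF x(3)] realizes_path_3[OF u(3)] by (simp add: f_def E_def x u del: One_nat_def)
    show "disjnt e e'" if "i < 2" "j < 2" "i \<noteq> j" "e \<in> E i" "e' \<in> E j" for i j e e'
      using that 2 2[THEN disjnt_sym] by (auto simp: E_def split: if_splits)
  qed
  moreover have "(\<Union>i<2. E i) = set xs"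
    unfolding set_of_length_4[OF n(1)[symmetric]] by (auto simp: E_def lessThan_Suc numeral_2_eq_2)
  ultimately show ?thesis by auto
qed

end

section \<open>A pair of vertex-disjoint parts\<close>

text \<open>
  The first part has no two disjoint edges; it contributes the apex of a cone or the two apices of a
  suspension, and the second part contributes the base.
\<close>

locale split_surface = surface_matchings E K
  for E :: "'v set set" and K :: "'k::field itself" +
  fixes E1 E2 :: "'v set set"
  assumes E: "E = E1 \<union> E2" and ne1: "E1 \<noteq> {}" and ne2: "E2 \<noteq> {}"
    and cross: "\<And>e f. e \<in> E1 \<Longrightarrow> f \<in> E2 \<Longrightarrow> disjnt e f"
    and meet1: "\<And>e f. e \<in> E1 \<Longrightarrow> f \<in> E1 \<Longrightarrow> e \<noteq> f \<Longrightarrow> \<not> disjnt e f"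
begin

lemma irrefl: "e \<in> E \<Longrightarrow> \<not> disjnt e e"
  using neE by auto

lemma cross': "f \<in> E2 \<Longrightarrow> e \<in> E1 \<Longrightarrow> disjnt f e"
  using cross disjnt_sym by blast

lemma meet1': "e \<in> E1 \<Longrightarrow> f \<in> E1 \<Longrightarrow> \<not> disjnt e f"
  using meet1 irrefl E by (cases "e = f") auto

lemma disjoint_edges_single: "a \<in> E1 \<Longrightarrow> disjoint_edges E {a} = E2"
  using cross' meet1' E by (auto simp: disjoint_edges_def)

lemma disjoint_edges_mixed:
  assumes "a \<in> E1" "f \<in> E2"
  shows "disjoint_edges E {a, f} = {g \<in> E2. disjnt f g}"
  using cross'[OF _ assms(1)] meet1'[OF _ assms(1)] E disjnt_sym[of f] disjnt_sym[of _ f]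
  unfolding disjoint_edges_def by blast

lemma mixed_matching:
  assumes "a \<in> E1" "f \<in> E2"
  shows "{a, f} \<in> matchings E" "card {a, f} = 2"
proof -
  have "disjnt a f" using cross assms by blast
  then show "{a, f} \<in> matchings E"
    using assms E by (simp add: insert_in_matchings empty_in_matchings)
  have "a \<noteq> f" using \<open>disjnt a f\<close> irrefl assms E by auto
  then show "card {a, f} = 2" by simp
qed

text \<open>
  An edge of the first part would complete them to a matching with four edges.
\<close>

lemma no_three_disjoint:
  assumes "x \<in> E2" "y \<in> E2" "z \<in> E2" "disjnt x y" "disjnt x z" "disjnt y z"
  shows False
proof -
  obtain a where a: "a \<in> E1" using ne1 by blast
  have d: "disjnt a x" "disjnt a y" "disjnt a z" using cross a assms(1-3) by blast+
  have "{a, x, y, z} \<in> matchings E"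
    using a assms d E by (simp add: insert_in_matchings empty_in_matchings)
  then have "card {a, x, y, z} \<le> 3" by (rule card_matching_le_3)
  moreover have "u \<noteq> v" if "u \<in> E" "disjnt u v" for u v using irrefl that by auto
  then have "a \<noteq> x" "a \<noteq> y" "a \<noteq> z" "x \<noteq> y" "x \<noteq> z" "y \<noteq> z"
    using a assms d E by blast+
  then have "card {a, x, y, z} = 4" by simp
  ultimately show False by simp
qed

text \<open>
  Two edges, one of each part, do not form a maximal matching, and the third edge must come from the
  second part.
\<close>

lemma disjoint_partner:
  assumes "f \<in> E2"
  obtains g where "g \<in> E2" "disjnt f g"
proof -
  obtain a where a: "a \<in> E1" using ne1 by blast
  have "disjoint_edges E {a, f} \<noteq> {}"
    using maximal_matching_card[of "{a, f}"] mixed_matching[OF a assms] by auto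
  then show thesis using that unfolding disjoint_edges_mixed[OF a assms] by blast
qed

lemma card_partners_le_2:
  assumes "f \<in> E2"
  shows "card {g \<in> E2. disjnt f g} \<le> 2"
proof -
  obtain a where a: "a \<in> E1" using ne1 by blast
  show ?thesis
    using card_disjoint_edges_le_2[OF mixed_matching[OF a assms]]
    unfolding disjoint_edges_mixed[OF a assms] .
qed

lemma disjoint_edges_pair:
  assumes "f \<in> E2" "g \<in> E2" "disjnt f g"
  shows "disjoint_edges E {f, g} = E1"
proof -
  have "\<not> (disjnt h f \<and> disjnt h g)" if "h \<in> E2" for h
    using no_three_disjoint[of h f g] that assms by blast
  then show ?thesis using cross assms(1,2) E unfolding disjoint_edges_def by blast
qed

text \<open>
  The first part is the link of a matching with two edges in the second part.
\<close>

lemma card_E1_le_2: "card E1 \<le> 2"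
proof -
  obtain f where f: "f \<in> E2" using ne2 by blast
  obtain g where g: "g \<in> E2" "disjnt f g" using disjoint_partner[OF f] .
  have "f \<noteq> g" using g irrefl E by auto
  then have "{f, g} \<in> matchings E" "card {f, g} = 2"
    using f g E by (simp_all add: insert_in_matchings empty_in_matchings)
  from card_disjoint_edges_le_2[OF this] show ?thesis
    using disjoint_edges_pair[OF f g] by simp
qed

lemma finite_E2: "finite E2"
  using finE E by simp

text \<open>
  The second part is the link of an edge of the first part, so its disjointness relation is connected
  of degree at most two. A cycle of length three is excluded by \<open>no_three_disjoint\<close>, and long paths
  and cycles by \<open>no_induced_six_path\<close>.
\<close>

lemma pattern_exists:
  assumes card2: "\<And>e. e \<in> E2 \<Longrightarrow> card e = 2"
  obtains xs where "distinct xs" "set xs = E2" "2 \<le> length xs" "length xs \<le> 5"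
      "disjointness_pattern False xs"
    | xs where "distinct xs" "set xs = E2" "4 \<le> length xs" "length xs \<le> 6"
      "disjointness_pattern True xs"
proof -
  obtain a where a: "a \<in> E1" using ne1 by blast
  then have aE: "a \<in> E" using E by blast
  have conn: "\<exists>u\<in>A. \<exists>v\<in>E2 - A. disjnt u v" if A: "A \<subset> E2" "A \<noteq> {}" for A
  proof -
    obtain x y where xy: "x \<in> A" "x \<in> E2" "y \<notin> A" "y \<in> E2" using A by blast
    from link_of_edge_connected[OF aE, of x A y] xy show ?thesis
      unfolding disjoint_edges_single[OF a] by blast
  qed
  obtain xs c where xs: "distinct xs" "set xs = E2"
    and pat: "\<And>i j. i < j \<Longrightarrow> j < length xs \<Longrightarrow>
       disjnt (xs ! i) (xs ! j) \<longleftrightarrow> j = i + 1 \<or> c \<and> i = 0 \<and> j = length xs - 1"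
    using path_or_cycle[OF finite_E2 ne2 disjnt_sym card_partners_le_2 conn] by metis
  have P: "disjointness_pattern c xs" using pat by (simp add: disjointness_pattern_def)
  have c2: "card e = 2" if "e \<in> set xs" for e using that card2 xs by simp
  have six: "\<not> (6 < length xs \<or> 6 = length xs \<and> \<not> c)"
    using no_induced_six_path[OF P c2] .
  have n2: "2 \<le> length xs"
  proof -
    obtain f where f: "f \<in> E2" using ne2 by blast
    obtain g where g: "g \<in> E2" "disjnt f g" using disjoint_partner[OF f] .
    have "f \<noteq> g" using g irrefl E by auto
    then have "card {f, g} \<le> card E2" using f g finite_E2 by (intro card_mono) auto
    then show ?thesis using \<open>f \<noteq> g\<close> distinct_card[OF xs(1)] xs(2) by simp
  qed
  show thesis
  proof (cases "c \<and> length xs \<noteq> 2")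
    case True
    have "length xs \<noteq> 3"
    proof
      assume n: "length xs = 3"
      have "xs ! 0 \<in> E2" "xs ! 1 \<in> E2" "xs ! 2 \<in> E2"
        using n xs(2) by (auto intro: nth_mem)
      then show False
        using no_three_disjoint[of "xs ! 0" "xs ! 1" "xs ! 2"] pat[of 0 1] pat[of 0 2] pat[of 1 2] n True
        by simp
    qed
    then show thesis using that(2)[OF xs] n2 six P True by simp
  next
    case False
    then have "disjointness_pattern False xs"
      using pat n2 unfolding disjointness_pattern_def by auto
    then show thesis using that(1)[OF xs] n2 six False by auto
  qed
qed

text \<open>
  The boundary edge cannot lie in the second part, since its link, the first part, has two points.
\<close>

lemma few_partners:
  assumes "card E1 = 2"
  obtains y where "y \<in> E2" "card {g \<in> E2. disjnt y g} \<le> 1"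
proof -
  obtain m where m: "m \<in> matchings E" "card m = 2" "card (disjoint_edges E m) \<le> 1"
    using boundary_edge .
  then obtain x y where xy: "m = {x, y}" "x \<noteq> y" by (auto simp: card_2_iff)
  then have "disjnt x y" "x \<in> E" "y \<in> E"
    using m(1) by (auto simp: insert_in_matchings)
  then consider "x \<in> E1" "y \<in> E2" | "y \<in> E1" "x \<in> E2" | "x \<in> E2" "y \<in> E2"
    using E meet1' by blast
  then show thesis
  proof cases
    case 1
    then show thesis using that m(3) disjoint_edges_mixed xy(1) by metis
  next
    case 2
    then show thesis using that m(3) disjoint_edges_mixed xy(1) by (metis insert_commute)
  next
    case 3
    then show thesis using m(3) disjoint_edges_pair[OF _ _ \<open>disjnt x y\<close>] xy(1) assms by simp
  qed
qed

text \<open>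
  The suspension of a circle is a sphere without boundary: on a cycle every edge has two partners,
  contrary to \<open>few_partners\<close>.
\<close>

lemma not_cycle:
  assumes card: "card E1 = 2" and xs: "distinct xs" "set xs = E2" "4 \<le> length xs"
  shows "\<not> disjointness_pattern True xs"
proof
  assume pat: "disjointness_pattern True xs"
  obtain y where y: "y \<in> E2" "card {g \<in> E2. disjnt y g} \<le> 1" using few_partners[OF card] .
  let ?n = "length xs"
  obtain i where i: "i < ?n" "y = xs ! i" using y(1) xs(2) by (auto simp: in_set_conv_nth)
  \<comment> \<open>The two neighbours of \<open>y\<close> on the cycle.\<close>
  define j where "j = (if i = 0 then ?n - 1 else i - 1)"
  define k where "k = (if i = ?n - 1 then 0 else i + 1)"
  have jk: "j < ?n" "k < ?n" "j \<noteq> k" "j \<noteq> i" "k \<noteq> i"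
    using i(1) xs(3) by (auto simp: j_def k_def)
  have n0: "?n - 1 < ?n" "0 < ?n - 1" using xs(3) by auto
  have sym: "disjnt (xs ! u) (xs ! v) \<longleftrightarrow> disjnt (xs ! v) (xs ! u)" for u v by (metis disjnt_sym)
  have "disjnt (xs ! i) (xs ! j)"
  proof (cases "i = 0")
    case True
    then show ?thesis using disjointness_patternD[OF pat n0(2,1)] by (simp add: j_def)
  next
    case False
    then show ?thesis using disjointness_patternD[OF pat, of "i - 1" i] i(1) sym[of i] by (simp add: j_def)
  qed
  moreover have "disjnt (xs ! i) (xs ! k)"
  proof (cases "i = ?n - 1")
    case True
    then show ?thesis using disjointness_patternD[OF pat n0(2,1)] sym[of i] by (simp add: k_def)
  next
    case False
    then show ?thesis using disjointness_patternD[OF pat, of i "i + 1"] i(1) by (simp add: k_def)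
  qed
  ultimately have "{xs ! j, xs ! k} \<subseteq> {g \<in> E2. disjnt y g}"
    using jk(1,2) xs(2) i(2) by auto
  then have "card {xs ! j, xs ! k} \<le> card {g \<in> E2. disjnt y g}"
    using finite_E2 by (intro card_mono) auto
  moreover have "xs ! j \<noteq> xs ! k" using jk xs(1) by (simp add: nth_eq_iff_index_eq)
  ultimately show False using y(2) by simp
qed

end

section \<open>The classification\<close>

lemma realizes_copies_path_2:
  assumes "distinct es" "\<And>e. e \<in> set es \<Longrightarrow> card e = 2" "pairwise disjnt (set es)"
  shows "\<exists>f. realizes f (graph_copies (length es) (path_graph 2)) (set es)"
proof -
  have "\<exists>f. realizes f (path_graph 2) {es ! i}" if i: "i < length es" for i
  proof -
    have "card (es ! i) = 2" using assms(2) nth_mem[OF i] by blast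
    then obtain x y where "es ! i = {x, y}" "x \<noteq> y" by (auto simp: card_2_iff)
    then show ?thesis using realizes_path_2[of x y] by auto
  qed
  then obtain f where f: "\<And>i. i < length es \<Longrightarrow> realizes (f i) (path_graph 2) {es ! i}" by metis
  have "realizes (\<lambda>(i, v). f i v) (graph_copies (length es) (path_graph 2)) (\<Union>i<length es. {es ! i})"
  proof (rule realizes_copies[OF f])
    show "disjnt e e'" if "i < length es" "j < length es" "i \<noteq> j" "e \<in> {es ! i}" "e' \<in> {es ! j}" for i j e e'
      using that assms(1) pairwiseD[OF assms(3), of e e'] by (auto simp: nth_eq_iff_index_eq)
  qed
  moreover have "(\<Union>i<length es. {es ! i}) = set es" by (auto simp: set_conv_nth)
  ultimately show ?thesis by auto
qed

text \<open>
  The edges inside the connected component of a vertex, and all the others.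
\<close>

lemma disconnected_edge_partition:
  assumes G: "finite_simple_graph G" "\<not> connected_graph G" "no_isolated_vertices G"
    and ne: "edges G \<noteq> {}"
  obtains A B where "edges G = A \<union> B" "A \<noteq> {}" "B \<noteq> {}"
    "\<And>e f. e \<in> A \<Longrightarrow> f \<in> B \<Longrightarrow> disjnt e f"
proof -
  have two: "e \<subseteq> verts G" "card e = 2" if "e \<in> edges G" for e
    using G(1) that by (auto simp: finite_simple_graph_def)
  have "verts G \<noteq> {}" using ne two by fastforce
  let ?R = "{(x, y). {x, y} \<in> edges G}"
  obtain u v where uv: "u \<in> verts G" "v \<in> verts G" "(u, v) \<notin> ?R\<^sup>*"
    using G(2) \<open>verts G \<noteq> {}\<close> unfolding connected_graph_def by blast
  define C where "C = {w. (u, w) \<in> ?R\<^sup>*}"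
  have closed: "e \<subseteq> C" if e: "e \<in> edges G" "x \<in> e" "x \<in> C" for e x
  proof -
    obtain y where y: "e = {x, y}" using doubleton_containing[OF two(2)[OF e(1)] e(2)] .
    then have "(x, y) \<in> ?R" using e(1) by simp
    then have "y \<in> C" using e(3) unfolding C_def by (auto intro: rtrancl_into_rtrancl)
    then show ?thesis using y e(3) by simp
  qed
  show thesis
  proof (rule that)
    show "edges G = {e \<in> edges G. e \<subseteq> C} \<union> {e \<in> edges G. \<not> e \<subseteq> C}" by blast
    have "u \<in> C" by (simp add: C_def)
    obtain e where "e \<in> edges G" "u \<in> e" using G(3) uv(1) by (auto simp: no_isolated_vertices_def)
    then show "{e \<in> edges G. e \<subseteq> C} \<noteq> {}" using closed \<open>u \<in> C\<close> by blast
    have "v \<notin> C" using uv(3) by (simp add: C_def)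
    obtain f where "f \<in> edges G" "v \<in> f" using G(3) uv(2) by (auto simp: no_isolated_vertices_def)
    then show "{e \<in> edges G. \<not> e \<subseteq> C} \<noteq> {}" using \<open>v \<notin> C\<close> by blast
    show "disjnt e f" if "e \<in> {e \<in> edges G. e \<subseteq> C}" "f \<in> {e \<in> edges G. \<not> e \<subseteq> C}" for e f
      using that closed[of f] by (auto simp: disjnt_iff)
  qed
qed

context surface_matchings
begin

text \<open>
  Together the two pairs of disjoint edges would form a matching with four edges.
\<close>

lemma one_part_intersecting:
  assumes E: "E = A \<union> B" and cross: "\<And>e f. e \<in> A \<Longrightarrow> f \<in> B \<Longrightarrow> disjnt e f"
    and xy: "x \<in> A" "y \<in> A" "x \<noteq> y" "disjnt x y" and zw: "z \<in> B" "w \<in> B" "z \<noteq> w" "disjnt z w"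
  shows False
proof -
  have d: "disjnt x z" "disjnt x w" "disjnt y z" "disjnt y w" using cross xy zw by blast+
  have "u \<noteq> v" if "u \<in> E" "disjnt u v" for u v using neE that by auto
  then have ne: "x \<noteq> z" "x \<noteq> w" "y \<noteq> z" "y \<noteq> w" using d xy(1,2) E by blast+
  have "{x, y, z, w} \<in> matchings E"
    using E xy zw d by (simp add: insert_in_matchings empty_in_matchings)
  then have "card {x, y, z, w} \<le> 3" by (rule card_matching_le_3)
  then show False using xy(3) zw(3) ne by simp
qed

lemma acyclic_ball:
  assumes "acyclic_complex TYPE('k) (matchings E)"
  shows "homology_ball TYPE('k) 2 (matchings E)"
  using acyclic_has_homology_of_ball[OF assms finite_complex_matchings[OF finE]] manifold
  by (simp add: homology_ball_def)

end

text \<open>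
  An edge that is disjoint from all others is split off whenever there is one. In this way a graph with
  three components always appears as a cone, except for three copies of \<open>P\<^sub>3\<close>, whose matching complex is
  a sphere; the remaining case is free of such edges, which rules out short paths in it.
\<close>

lemma split_cases:
  assumes M: "surface_matchings TYPE('k::field) E"
    and AB: "E = A \<union> B" "A \<noteq> {}" "B \<noteq> {}" "\<And>e f. e \<in> A \<Longrightarrow> f \<in> B \<Longrightarrow> disjnt e f"
  obtains a E2 where "split_surface TYPE('k) E {a} E2"
  | a b E2 where "split_surface TYPE('k) E {a, b} E2" "a \<noteq> b"
      "\<And>e. e \<in> E \<Longrightarrow> \<exists>f\<in>E. f \<noteq> e \<and> \<not> disjnt e f"
proof (cases "\<exists>a\<in>E. \<forall>f\<in>E. f \<noteq> a \<longrightarrow> disjnt a f")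
  case True
  then obtain a where a: "a \<in> E" "\<And>f. f \<in> E \<Longrightarrow> f \<noteq> a \<Longrightarrow> disjnt a f" by blast
  have neE: "{} \<notin> E" using M by (simp add: surface_matchings_def)
  have "E \<noteq> {a}"
  proof
    assume "E = {a}"
    then have "A \<subseteq> {a}" "B \<subseteq> {a}" using AB(1) by (metis Un_upper1, metis Un_upper2)
    then have "a \<in> A" "a \<in> B" using AB(2,3) by (simp_all add: subset_singleton_iff)
    then have "disjnt a a" by (rule AB(4))
    then show False using neE a(1) by auto
  qed
  have "split_surface TYPE('k) E {a} (E - {a})"
  proof (intro split_surface.intro[OF M] split_surface_axioms.intro)
    show "E = {a} \<union> (E - {a})" "E - {a} \<noteq> {}" using a(1) \<open>E \<noteq> {a}\<close> by blast+
    show "disjnt e f" if "e \<in> {a}" "f \<in> E - {a}" for e f using that a(2) by simp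
  qed simp_all
  then show thesis by (rule that(1))
next
  case False
  then have noiso: "\<And>e. e \<in> E \<Longrightarrow> \<exists>f\<in>E. f \<noteq> e \<and> \<not> disjnt e f" by blast
  have "(\<forall>e\<in>A. \<forall>f\<in>A. e \<noteq> f \<longrightarrow> \<not> disjnt e f) \<or> (\<forall>e\<in>B. \<forall>f\<in>B. e \<noteq> f \<longrightarrow> \<not> disjnt e f)"
    using surface_matchings.one_part_intersecting[OF M AB(1,4)] by blast
  then have "split_surface TYPE('k) E A B \<or> split_surface TYPE('k) E B A"
  proof
    assume meet: "\<forall>e\<in>A. \<forall>f\<in>A. e \<noteq> f \<longrightarrow> \<not> disjnt e f"
    have "split_surface TYPE('k) E A B"
      by (intro split_surface.intro[OF M] split_surface_axioms.intro AB) (use meet in simp_all)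
    then show ?thesis ..
  next
    assume meet: "\<forall>e\<in>B. \<forall>f\<in>B. e \<noteq> f \<longrightarrow> \<not> disjnt e f"
    have "split_surface TYPE('k) E B A"
    proof (intro split_surface.intro[OF M] split_surface_axioms.intro)
      show "E = B \<union> A" using AB(1) by (simp add: Un_commute)
      show "disjnt e f" if "e \<in> B" "f \<in> A" for e f using AB(4)[OF that(2,1)] by (rule disjnt_sym)
    qed (use meet AB(2,3) in simp_all)
    then show ?thesis ..
  qed
  then obtain E1 E2 where E12: "split_surface TYPE('k) E E1 E2" by blast
  interpret split_surface E "TYPE('k)" E1 E2 by (rule E12)
  have "card E1 \<noteq> 0" using ne1 finE E by simp
  moreover have "card E1 \<noteq> 1"
  proof
    assume "card E1 = 1"
    then obtain a where a: "E1 = {a}" by (auto simp: card_1_singleton_iff)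
    obtain f where "f \<in> E" "f \<noteq> a" "\<not> disjnt a f" using noiso[of a] E a by blast
    then show False using cross[of a f] E a by blast
  qed
  ultimately have "card E1 = 2" using card_E1_le_2 by linarith
  then obtain a b where "E1 = {a, b}" "a \<noteq> b" by (auto simp: card_2_iff)
  with E12 noiso show thesis by (intro that(2)) simp_all
qed

context split_surface
begin

lemma E2_triangle_free:
  "\<lbrakk>x \<in> E2; y \<in> E2; z \<in> E2; x \<noteq> y; x \<noteq> z; y \<noteq> z; disjnt x y; disjnt x z; disjnt y z\<rbrakk> \<Longrightarrow> False"
  using no_three_disjoint by blast

lemma neE1: "{} \<notin> E1"
  using neE E by blast

lemma matchings_join_path:
  assumes "matchings E1 \<cong>\<^sub>C \<Delta>" "finite_complex \<Delta>"
    and "distinct xs" "set xs = E2" "disjointness_pattern False xs"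
  shows "matchings E \<cong>\<^sub>C \<Delta> \<star>\<^sub>C graph_complex (path_graph (length xs))"
  unfolding E
  using path_matchings[OF assms(3,5)] E2_triangle_free unfolding assms(4)
  by (intro matchings_join[OF cross neE1 assms(1) _ assms(2) finite_complex_graphs(1)]) blast+

lemma matchings_join_cycle:
  assumes "matchings E1 \<cong>\<^sub>C \<Delta>" "finite_complex \<Delta>"
    and "distinct xs" "set xs = E2" "disjointness_pattern True xs" "4 \<le> length xs"
  shows "matchings E \<cong>\<^sub>C \<Delta> \<star>\<^sub>C graph_complex (cycle_graph (length xs))"
proof -
  have "finite_complex (graph_complex (cycle_graph (length xs)))"
    using finite_complex_graphs(2)[of "length xs"] assms(6) by simp
  then show ?thesis
    unfolding E
    using cycle_matchings[OF assms(3,5,6)] E2_triangle_free unfolding assms(4)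
    by (intro matchings_join[OF cross neE1 assms(1) _ assms(2)]) blast+
qed

end

theorem theorem5p2:
  fixes G :: "'v graph"
  assumes "finite_simple_graph G"
    and "\<not> connected_graph G"
    and "no_isolated_vertices G"
    and "homology_manifold_with_boundary TYPE('k::field) 2 (matching_complex G)"
  shows "homology_ball TYPE('k) 2 (matching_complex G)
    \<and> (geometric_realization (matching_complex G) homeomorphic_space (nball 0 \<star>\<^sub>T nball 1)
       \<or> geometric_realization (matching_complex G) homeomorphic_space (nball 0 \<star>\<^sub>T nsphere 1)
       \<or> geometric_realization (matching_complex G) homeomorphic_space (nsphere 0 \<star>\<^sub>T nball 1))
    \<and> (G \<cong>\<^sub>G graph_copies 3 (path_graph 2)
         \<and> matching_complex G \<cong>\<^sub>C
             graph_complex (path_graph 1) \<star>\<^sub>C graph_complex (path_graph 2)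
       \<or> G \<cong>\<^sub>G graph_copies 2 (path_graph 2) \<squnion>\<^sub>G path_graph 3
         \<and> matching_complex G \<cong>\<^sub>C
             graph_complex (path_graph 1) \<star>\<^sub>C graph_complex (path_graph 3)
       \<or> G \<cong>\<^sub>G path_graph 2 \<squnion>\<^sub>G path_graph 5
         \<and> matching_complex G \<cong>\<^sub>C
             graph_complex (path_graph 1) \<star>\<^sub>C graph_complex (path_graph 4)
       \<or> G \<cong>\<^sub>G path_graph 2 \<squnion>\<^sub>G banner_graph
         \<and> matching_complex G \<cong>\<^sub>C
             graph_complex (path_graph 1) \<star>\<^sub>C graph_complex (path_graph 5)
       \<or> G \<cong>\<^sub>G path_graph 2 \<squnion>\<^sub>G graph_copies 2 (path_graph 3)
         \<and> matching_complex G \<cong>\<^sub>C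
             graph_complex (path_graph 1) \<star>\<^sub>C graph_complex (cycle_graph 4)
       \<or> G \<cong>\<^sub>G path_graph 2 \<squnion>\<^sub>G cycle_graph 5
         \<and> matching_complex G \<cong>\<^sub>C
             graph_complex (path_graph 1) \<star>\<^sub>C graph_complex (cycle_graph 5)
       \<or> G \<cong>\<^sub>G path_graph 2 \<squnion>\<^sub>G complete_bipartite 3 2
         \<and> matching_complex G \<cong>\<^sub>C
             graph_complex (path_graph 1) \<star>\<^sub>C graph_complex (cycle_graph 6)
       \<or> G \<cong>\<^sub>G path_graph 3 \<squnion>\<^sub>G path_graph 5
         \<and> matching_complex G \<cong>\<^sub>C
             graph_complex (graph_copies 2 (path_graph 1)) \<star>\<^sub>C graph_complex (path_graph 4)
       \<or> G \<cong>\<^sub>G path_graph 3 \<squnion>\<^sub>G banner_graph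
         \<and> matching_complex G \<cong>\<^sub>C
             graph_complex (graph_copies 2 (path_graph 1)) \<star>\<^sub>C graph_complex (path_graph 5))"
proof -
  define E where "E = edges G"
  have M: "matching_complex G = matchings E" by (simp add: E_def matching_complex_eq)
  have two: "card e = 2" if "e \<in> E" for e
    using assms(1) that by (simp add: finite_simple_graph_def E_def)
  have "E \<subseteq> Pow (verts G)" "finite (Pow (verts G))"
    using assms(1) by (auto simp: finite_simple_graph_def E_def)
  then have finE: "finite E" by (rule finite_subset)
  have "{} \<notin> E" using two by fastforce
  then have S: "surface_matchings TYPE('k) E"
    using finE assms(4) M by (simp add: surface_matchings_def)
  note fin = finite_complex_matchings[OF finE]
  obtain m where "m \<in> matchings E" "card m = 2"
    using surface_matchings.boundary_edge[OF S] by metis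
  then have "edges G \<noteq> {}" by (auto simp: matchings_def E_def)
  then obtain A B where AB: "E = A \<union> B" "A \<noteq> {}" "B \<noteq> {}" "\<And>e f. e \<in> A \<Longrightarrow> f \<in> B \<Longrightarrow> disjnt e f"
    using disconnected_edge_partition[OF assms(1-3)] unfolding E_def by metis
  have iso: "G \<cong>\<^sub>G H" if "realizes f H E" for f and H :: "'w graph"
    using realizes_graph_iso[OF assms(1,3)] that by (simp add: E_def)
  from split_cases[OF S AB] consider
    a E2 where "split_surface TYPE('k) E {a} E2"
    | a b E2 where "split_surface TYPE('k) E {a, b} E2" "a \<noteq> b"
      "\<And>e. e \<in> E \<Longrightarrow> \<exists>f\<in>E. f \<noteq> e \<and> \<not> disjnt e f"
    by metis
  then show ?thesis
  proof cases
    case (1 a E2)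
    interpret split_surface E "TYPE('k)" "{a}" E2 by (rule 1)
    have aE: "a \<in> E" and E2E: "E2 \<subseteq> E" using E by blast+
    have ball: "homology_ball TYPE('k) 2 (matchings E)"
    proof (rule acyclic_ball, rule acyclic_matchings_cone[OF finE aE])
      show "disjnt a f" if "f \<in> E" "f \<noteq> a" for f using that E cross by blast
    qed
    obtain u v where a: "a = {u, v}" "u \<noteq> v" using two[OF aE] by (auto simp: card_2_iff)
    have fa: "realizes ((!) [u, v]) (path_graph 2) {a}" using realizes_path_2[OF a(2)] a(1) by simp
    have union: "G \<cong>\<^sub>G path_graph 2 \<squnion>\<^sub>G H" if ex: "\<exists>f. realizes f H E2" for H :: "'w graph"
    proof -
      obtain f where "realizes f H E2" using ex by blast
      from iso[OF realizes_disjoint_union[OF fa this cross, folded E]] show ?thesis by simp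
    qed
    have c2: "card e = 2" if "e \<in> E2" for e using that two E2E by blast
    from pattern_exists[OF c2] consider
      xs where "distinct xs" "set xs = E2" "2 \<le> length xs" "length xs \<le> 5"
        "disjointness_pattern False xs"
      | xs where "distinct xs" "set xs = E2" "4 \<le> length xs" "length xs \<le> 6"
        "disjointness_pattern True xs"
      by metis
    then show ?thesis
    proof cases
      case (1 xs)
      have c2': "card e = 2" if "e \<in> set xs" for e using that c2 1(2) by simp
      have cpx: "matchings E \<cong>\<^sub>C graph_complex (path_graph 1) \<star>\<^sub>C graph_complex (path_graph (length xs))"
        using matchings_join_path[OF single_edge_matchings finite_complex_graphs(1) 1(1,2,5)] .
      have top: "geometric_realization (matchings E) homeomorphic_space (nball 0 \<star>\<^sub>T nball 1)"
        by (rule realization_of_join[OF fin cpx finite_complex_graphs(1) finite_complex_graphs(1)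
          realization_point compact_space_low_dim(1) nonempty_low_dim(1)
          realization_path_graph[OF 1(3)] compact_space_low_dim(2) nonempty_low_dim(1)])
      consider "length xs = 2" | "length xs = 3" | "length xs = 4" | "length xs = 5"
        using 1(3,4) by linarith
      then show ?thesis
      proof cases
        case n: 1
        then have xs: "set xs = {xs ! 0, xs ! 1}" "xs ! 0 \<noteq> xs ! 1"
          using 1(1) by (auto simp: length_Suc_conv numeral_2_eq_2)
        have d: "disjnt (xs ! 0) (xs ! 1)"
          using disjointness_patternD[OF 1(5), of 0 1] n by simp
        have da: "disjnt a (xs ! 0)" "disjnt a (xs ! 1)" using cross xs(1) 1(2) by auto
        have "a \<noteq> xs ! 0" "a \<noteq> xs ! 1" using da irrefl[OF aE] by auto
        then have "\<exists>f. realizes f (graph_copies (length [a, xs ! 0, xs ! 1]) (path_graph 2)) (set [a, xs ! 0, xs ! 1])"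
          using d da d[THEN disjnt_sym] da[THEN disjnt_sym] xs two[OF aE] c2'
          by (intro realizes_copies_path_2) (auto simp: pairwise_insert)
        moreover have "set [a, xs ! 0, xs ! 1] = E" using E xs(1) 1(2) by auto
        moreover have "length [a, xs ! 0, xs ! 1] = 3" by simp
        ultimately have "G \<cong>\<^sub>G graph_copies 3 (path_graph 2)" using iso by metis
        then show ?thesis using ball top cpx unfolding M n by blast
      next
        case n: 2
        then have xs: "set xs = {xs ! 0, xs ! 1, xs ! 2}"
          by (auto simp: length_Suc_conv numeral_3_eq_3)
        have ne: "xs ! 0 \<noteq> xs ! 2" using 1(1) n by (simp add: nth_eq_iff_index_eq)
        have d: "disjnt (xs ! 0) (xs ! 1)" "disjnt (xs ! 1) (xs ! 2)" "\<not> disjnt (xs ! 0) (xs ! 2)"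
          using disjointness_patternD[OF 1(5), of 0 1] disjointness_patternD[OF 1(5), of 1 2]
            disjointness_patternD[OF 1(5), of 0 2] n by simp_all
        have da: "disjnt a (xs ! 0)" "disjnt a (xs ! 1)" "disjnt a (xs ! 2)" using cross xs 1(2) by auto
        have "a \<noteq> xs ! 1" using da irrefl[OF aE] by auto
        then have "\<exists>f. realizes f (graph_copies (length [a, xs ! 1]) (path_graph 2)) (set [a, xs ! 1])"
          using da da[THEN disjnt_sym] xs two[OF aE] c2'
          by (intro realizes_copies_path_2) (auto simp: pairwise_insert)
        then obtain f where f: "realizes f (graph_copies 2 (path_graph 2)) {a, xs ! 1}"
          by (auto simp: numeral_2_eq_2)
        have "card (xs ! 0) = 2" "card (xs ! 2) = 2" using c2' xs by auto
        then obtain x y z where xyz: "xs ! 0 = {x, y}" "xs ! 2 = {y, z}" "distinct [x, y, z]"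
          using intersecting_edges_path ne d(3) by metis
        have g: "realizes ((!) [x, y, z]) (path_graph 3) {xs ! 0, xs ! 2}"
          using realizes_path_3[OF xyz(3)] unfolding xyz .
        have "disjnt e e'" if "e \<in> {a, xs ! 1}" "e' \<in> {xs ! 0, xs ! 2}" for e e'
          using that d da d(1)[THEN disjnt_sym] by auto
        note fg = realizes_disjoint_union[OF f g this]
        have "{a, xs ! 1} \<union> {xs ! 0, xs ! 2} = E" using E xs 1(2) by auto
        with fg have "G \<cong>\<^sub>G graph_copies 2 (path_graph 2) \<squnion>\<^sub>G path_graph 3" using iso by metis
        then show ?thesis using ball top cpx unfolding M n by blast
      next
        case n: 3
        have "G \<cong>\<^sub>G path_graph 2 \<squnion>\<^sub>G path_graph 5"
          using union realizes_path_5[OF 1(5) c2'] n 1(2) by simp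
        then show ?thesis using ball top cpx unfolding M n by blast
      next
        case n: 4
        have "G \<cong>\<^sub>G path_graph 2 \<squnion>\<^sub>G banner_graph"
          using union realizes_banner[OF 1(5) c2'] n 1(2) by simp
        then show ?thesis using ball top cpx unfolding M n by blast
      qed
    next
      case (2 xs)
      have c2': "card e = 2" if "e \<in> set xs" for e using that c2 2(2) by simp
      have cpx: "matchings E \<cong>\<^sub>C graph_complex (path_graph 1) \<star>\<^sub>C graph_complex (cycle_graph (length xs))"
        using matchings_join_cycle[OF single_edge_matchings finite_complex_graphs(1) 2(1,2,5,3)] .
      have n3: "3 \<le> length xs" using 2(3) by simp
      have top: "geometric_realization (matchings E) homeomorphic_space (nball 0 \<star>\<^sub>T nsphere 1)"
        by (rule realization_of_join[OF fin cpx finite_complex_graphs(1) finite_complex_graphs(2)[OF n3]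
          realization_point compact_space_low_dim(1) nonempty_low_dim(1)
          realization_cycle_graph[OF n3] compact_space_low_dim(4) nonempty_low_dim(2)])
      consider "length xs = 4" | "length xs = 5" | "length xs = 6"
        using 2(3,4) by linarith
      then show ?thesis
      proof cases
        case n: 1
        have "G \<cong>\<^sub>G path_graph 2 \<squnion>\<^sub>G graph_copies 2 (path_graph 3)"
          using union realizes_two_paths_3[OF 2(5) c2'] n 2(1,2) by simp
        then show ?thesis using ball top cpx unfolding M n by blast
      next
        case n: 2
        have "G \<cong>\<^sub>G path_graph 2 \<squnion>\<^sub>G cycle_graph 5"
          using union realizes_cycle_5[OF 2(5) c2'] n 2(2) by simp
        then show ?thesis using ball top cpx unfolding M n by blast
      next
        case n: 3
        have "G \<cong>\<^sub>G path_graph 2 \<squnion>\<^sub>G complete_bipartite 3 2"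
          using union realizes_complete_bipartite[OF 2(5) c2'] n 2(2) by simp
        then show ?thesis using ball top cpx unfolding M n by blast
      qed
    qed
  next
    case (2 a b E2)
    interpret split_surface E "TYPE('k)" "{a, b}" E2 by (rule 2)
    have abE: "a \<in> E" "b \<in> E" and E2E: "E2 \<subseteq> E" using E by blast+
    have ab: "\<not> disjnt a b" "\<not> disjnt b a" using meet1' by simp_all
    have c2: "card e = 2" if "e \<in> E2" for e using that two E2E by blast
    obtain xs where xs: "distinct xs" "set xs = E2" "2 \<le> length xs" "length xs \<le> 5"
      and pat: "disjointness_pattern False xs"
      using pattern_exists[OF c2] not_cycle 2(2) by (metis card_2_iff)
    have c2': "card e = 2" if "e \<in> set xs" for e using that c2 xs(2) by simp
    have inE2: "xs ! i \<in> E2" if "i < length xs" for i using that xs(2) nth_mem by blast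
    \<comment> \<open>For two or three edges one of them would be a component of its own.\<close>
    have noiso: "\<exists>f\<in>E2. f \<noteq> e \<and> \<not> disjnt e f" if "e \<in> E2" for e
      using 2(3)[of e] that E cross' by blast
    have "4 \<le> length xs"
    proof (rule ccontr)
      assume "\<not> 4 \<le> length xs"
      then have l: "length xs = 2 \<or> length xs = 3" using xs(3) by linarith
      have "xs ! 1 \<in> E2" using inE2 xs(3) by simp
      then obtain f where f: "f \<in> E2" "f \<noteq> xs ! 1" "\<not> disjnt (xs ! 1) f" using noiso by blast
      then obtain i where i: "i < length xs" "f = xs ! i" using xs(2) by (metis in_set_conv_nth)
      have "i = 0 \<or> i = 2" using i f(2) l by (cases "i = 1") auto
      then show False
        using disjointness_patternD[OF pat, of 0 1] disjointness_patternD[OF pat, of 1 2]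
          disjnt_sym[of "xs ! 0" "xs ! 1"] i f(3) l by auto
    qed
    then consider "length xs = 4" | "length xs = 5" using xs(4) by linarith
    note n = this
    have ball: "homology_ball TYPE('k) 2 (matchings E)"
    proof (rule acyclic_ball, rule acyclic_matchings_delete[OF finE neE abE(2)])
      have "a \<noteq> b" by (rule 2(2))
      have "b \<notin> E2" using cross'[of b b] irrefl[OF abE(2)] by blast
      show "acyclic_complex TYPE('k) (matchings (E - {b}))"
      proof (rule acyclic_matchings_cone[of _ a])
        show "a \<in> E - {b}" using abE(1) \<open>a \<noteq> b\<close> by blast
        show "disjnt a f" if "f \<in> E - {b}" "f \<noteq> a" for f using that E cross by blast
      qed (use finE in simp)
      have "{f \<in> E. disjnt f b} = E2"
        using E cross' ab irrefl[OF abE(2)] by blast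
      moreover have "acyclic_complex TYPE('k) (matchings (set xs))"
      proof (rule acyclic_matchings_path[OF xs(1)])
        show "xs \<noteq> []" using xs(3) by auto
        show "{} \<notin> set xs" using xs(2) E2E neE by blast
      qed (use disjointness_patternD[OF pat] in simp)
      ultimately show "acyclic_complex TYPE('k) (matchings {f \<in> E. disjnt f b})"
        using xs(2) by simp
    qed
    have cpx: "matchings E \<cong>\<^sub>C
        graph_complex (graph_copies 2 (path_graph 1)) \<star>\<^sub>C graph_complex (path_graph (length xs))"
      using matchings_join_path[OF two_edges_matchings[OF 2(2) ab(1)] finite_complex_graphs(3) xs(1,2) pat] .
    have top: "geometric_realization (matchings E) homeomorphic_space (nsphere 0 \<star>\<^sub>T nball 1)"
      by (rule realization_of_join[OF fin cpx finite_complex_graphs(3) finite_complex_graphs(1)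
        realization_two_points compact_space_low_dim(3) nonempty_low_dim(2)
        realization_path_graph[OF xs(3)] compact_space_low_dim(2) nonempty_low_dim(1)])
    obtain x y z where xyz: "a = {x, y}" "b = {y, z}" "distinct [x, y, z]"
      using intersecting_edges_path[OF two[OF abE(1)] two[OF abE(2)] 2(2) ab(1)] .
    have fab: "realizes ((!) [x, y, z]) (path_graph 3) {a, b}"
      using realizes_path_3[OF xyz(3)] unfolding xyz .
    have union: "G \<cong>\<^sub>G path_graph 3 \<squnion>\<^sub>G H" if ex: "\<exists>f. realizes f H E2" for H :: "'w graph"
    proof -
      obtain f where "realizes f H E2" using ex by blast
      from iso[OF realizes_disjoint_union[OF fab this cross, folded E]] show ?thesis by simp
    qed
    show ?thesis
      using n
    proof cases
      case n: 1
      have "G \<cong>\<^sub>G path_graph 3 \<squnion>\<^sub>G path_graph 5"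
        using union realizes_path_5[OF pat c2'] n xs(2) by simp
      then show ?thesis using ball top cpx unfolding M n by blast
    next
      case n: 2
      have "G \<cong>\<^sub>G path_graph 3 \<squnion>\<^sub>G banner_graph"
        using union realizes_banner[OF pat c2'] n xs(2) by simp
      then show ?thesis using ball top cpx unfolding M n by blast
    qed
  qed
qed

end
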